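(* There is an isomorphism $\Psi:\mathcal{R}\otimes_{\mathbb{Z}}\Lambda\to\mathrm{FH}$ of filtered $\mathcal{R}$-algebras (that is, an $\mathcal{R}$-algebra isomorphism with $\Psi(\mathcal{R}\otimes\Lambda^{\le i})=\mathcal{F}^i$ for all $i\ge0$) defined by $$\Psi(e_n)=\sum_{\mu\vdash n}K_\mu\qquad(n\ge1).$$
   Context: $\mathcal{R}=\{f\in\mathbb{Q}[t]:f(m)\in\mathbb{Z}\text{ for all }m\in\mathbb{Z}\}$ is the ring of integer-valued polynomials. The reduced cycle type of a permutation is the partition obtained from its cycle type by subtracting $1$ from each part and discarding zeros. $X_\mu\in Z(\mathbb{Z}S_n)$ is the sum of all elements of $S_n$ of reduced cycle type $\mu$ ($0$ if there are none). By a theorem of Farahat and Higman, for all partitions $\lambda,\mu,\nu$ there is a unique $\phi_{\mu,\nu}^\lambda\in\mathcal{R}$ such that $X_\mu X_\nu=\sum_\lambda\phi_{\mu,\nu}^\lambda(n)X_\lambda$ in $Z(\mathbb{Z}S_n)$ for all $n\ge0$. The Farahat-Higman algebra $\mathrm{FH}$ is the free $\mathcal{R}$-module with basis $K_\mu$ indexed by all partitions, with $\mathcal{R}$-bilinear multiplication $K_\mu K_\nu=\sum_\lambda\phi_{\mu,\nu}^\lambda(t)K_\lambda$; it is a commutative associative unital $\mathcal{R}$-algebra. It is filtered by $\mathcal{F}^i$, the $\mathcal{R}$-span of the $K_\mu$ with $|\mu|\le i$. $\Lambda=\mathbb{Z}[e_1,e_2,\dots]$ is the ring of symmetric functions, $e_r$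 the $r$-th elementary symmetric function (of degree $r$), and $\Lambda^{\le i}$ is the span of the homogeneous elements of degree at most $i$. *)

theory Defs
  imports
    "HOL-Computational_Algebra.Polynomial"
    "HOL-Combinatorics.Orbits"
    "HOL-Algebra.Sym_Groups"
    "HOL-Algebra.Module"
    "HOL-Algebra.QuotRing"
    "HOL-Library.Poly_Mapping"
begin

hide_const (open) Polynomial.smult

section \<open>Algebras over a commutative ring and their filtrations\<close>

definition rspan :: "('a, 'm) ring_scheme \<Rightarrow> ('a, 'b, 'n) module_scheme \<Rightarrow> 'b set \<Rightarrow> 'b set"
  where "rspan R M S = \<Inter> {N. submodule N R M \<and> S \<subseteq> N}"

definition alg_hom ::
    "('a, 'm) ring_scheme \<Rightarrow> ('a, 'b, 'n) module_scheme \<Rightarrow> ('a, 'c, 'k) module_scheme \<Rightarrow> ('b \<Rightarrow> 'c) set"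
  where "alg_hom R A B =
    {h \<in> ring_hom A B. \<forall>r\<in>carrier R. \<forall>x\<in>carrier A. h (r \<odot>\<^bsub>A\<^esub> x) = r \<odot>\<^bsub>B\<^esub> h x}"

definition filtered_alg_iso ::
    "('a, 'm) ring_scheme \<Rightarrow> ('a, 'b, 'n) module_scheme \<Rightarrow> (nat \<Rightarrow> 'b set) \<Rightarrow>
     ('a, 'c, 'k) module_scheme \<Rightarrow> (nat \<Rightarrow> 'c set) \<Rightarrow> ('b \<Rightarrow> 'c) set"
  where "filtered_alg_iso R A FA B FB =
    {h \<in> alg_hom R A B. bij_betw h (carrier A) (carrier B) \<and> (\<forall>i. h ` FA i = FB i)}"

text \<open>The integral monoid ring of \<open>G\<close>, with elements the finitely supported functions from
  \<open>carrier G\<close> to the integers.  (The ring structure that \<^theory>\<open>HOL-Library.Poly_Mapping\<close> puts on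
  its type is for additive monoids given by a type class.)\<close>

definition monoid_ring :: "('a, 'm) monoid_scheme \<Rightarrow> ('a \<Rightarrow>\<^sub>0 int) ring"
  where "monoid_ring G =
    \<lparr> carrier = {c. Poly_Mapping.keys c \<subseteq> carrier G},
      mult = (\<lambda>c d. frag_extend (\<lambda>x. frag_extend (\<lambda>y. frag_of (x \<otimes>\<^bsub>G\<^esub> y)) d) c),
      one = frag_of \<one>\<^bsub>G\<^esub>,
      zero = 0,
      add = (+) \<rparr>"

text \<open>The tensor product of commutative rings \<open>A\<close> and \<open>B\<close> over the integers.  The free abelian group
  on the pairs \<open>(a, b)\<close> is the monoid ring of the product of the multiplicative monoids of
  \<open>A\<close> and \<open>B\<close>, so that the product of the pairs \<open>(a, b)\<close> and \<open>(a', b')\<close> is \<open>(a a', b b')\<close>.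
  The set of biadditivity relations is stable under multiplication by pairs; hence the ideal it
  generates is the subgroup it generates, and the quotient is the usual tensor product of abelian
  groups with its usual multiplication.\<close>

definition tensor_relations :: "'a ring \<Rightarrow> 'b ring \<Rightarrow> ('a \<times> 'b \<Rightarrow>\<^sub>0 int) set"
  where "tensor_relations A B =
    {frag_of (a \<oplus>\<^bsub>A\<^esub> a', b) - frag_of (a, b) - frag_of (a', b) | a a' b.
       a \<in> carrier A \<and> a' \<in> carrier A \<and> b \<in> carrier B} \<union>
    {frag_of (a, b \<oplus>\<^bsub>B\<^esub> b') - frag_of (a, b) - frag_of (a, b') | a b b'.
       a \<in> carrier A \<and> b \<in> carrier B \<and> b' \<in> carrier B}"

definition tensor_ideal :: "'a ring \<Rightarrow> 'b ring \<Rightarrow> ('a \<times> 'b \<Rightarrow>\<^sub>0 int) set"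
  where "tensor_ideal A B = Idl\<^bsub>monoid_ring (A \<times>\<times> B)\<^esub> (tensor_relations A B)"

definition tensor_ring :: "'a ring \<Rightarrow> 'b ring \<Rightarrow> ('a \<times> 'b \<Rightarrow>\<^sub>0 int) set ring"
  where "tensor_ring A B = monoid_ring (A \<times>\<times> B) Quot tensor_ideal A B"

definition pure_tensor :: "'a ring \<Rightarrow> 'b ring \<Rightarrow> 'a \<Rightarrow> 'b \<Rightarrow> ('a \<times> 'b \<Rightarrow>\<^sub>0 int) set"
  where "pure_tensor A B a b = tensor_ideal A B +>\<^bsub>monoid_ring (A \<times>\<times> B)\<^esub> frag_of (a, b)"

definition tensor_algebra :: "'a ring \<Rightarrow> 'b ring \<Rightarrow> ('a, ('a \<times> 'b \<Rightarrow>\<^sub>0 int) set) module"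
  where "tensor_algebra A B =
    \<lparr> carrier = carrier (tensor_ring A B),
      mult = mult (tensor_ring A B),
      one = one (tensor_ring A B),
      zero = zero (tensor_ring A B),
      add = add (tensor_ring A B),
      smult = (\<lambda>a t. pure_tensor A B a \<one>\<^bsub>B\<^esub> \<otimes>\<^bsub>tensor_ring A B\<^esub> t) \<rparr>"

text \<open>The image in \<open>A \<otimes> B\<close> of \<open>A \<otimes> S\<close>, for a subgroup \<open>S\<close> of \<open>B\<close>.\<close>

definition tensor_sub :: "'a ring \<Rightarrow> 'b ring \<Rightarrow> 'b set \<Rightarrow> ('a \<times> 'b \<Rightarrow>\<^sub>0 int) set set"
  where "tensor_sub A B S =
    generate (add_monoid (tensor_ring A B)) {pure_tensor A B a b | a b. a \<in> carrier A \<and> b \<in> S}"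


section \<open>Integer-valued polynomials\<close>

definition int_valued :: "rat poly set"
  where "int_valued = {f. \<forall>m::int. poly f (of_int m) \<in> \<int>}"

definition int_valued_ring :: "rat poly ring"
  where "int_valued_ring =
    \<lparr> carrier = int_valued, mult = (*), one = 1, zero = 0, add = (+) \<rparr>"


section \<open>The ring of symmetric functions\<close>

text \<open>A monomial in variables indexed by the natural numbers is given by its exponents; a
  symmetric function is a formal power series in these variables (given by its coefficients) of
  bounded degree that is invariant under permutation of the variables.\<close>

definition monomial_degree :: "(nat \<Rightarrow>\<^sub>0 nat) \<Rightarrow> nat"
  where "monomial_degree m = (\<Sum>i\<in>Poly_Mapping.keys m. Poly_Mapping.lookup m i)"

definition symmetric_function :: "((nat \<Rightarrow>\<^sub>0 nat) \<Rightarrow> int) \<Rightarrow> bool"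
  where "symmetric_function f \<longleftrightarrow>
    (\<exists>d. \<forall>m. f m \<noteq> 0 \<longrightarrow> monomial_degree m \<le> d) \<and>
    (\<forall>\<pi> m. bij \<pi> \<longrightarrow> f (Poly_Mapping.map_key \<pi> m) = f m)"

definition sym_ring :: "((nat \<Rightarrow>\<^sub>0 nat) \<Rightarrow> int) ring"
  where "sym_ring =
    \<lparr> carrier = {f. symmetric_function f},
      mult = (\<lambda>f g m. \<Sum>(a, b) | a + b = m. f a * g b),
      one = (\<lambda>m. if m = 0 then 1 else 0),
      zero = (\<lambda>m. 0),
      add = (\<lambda>f g m. f m + g m) \<rparr>"

text \<open>The sum of the monomials \<open>x\<^sub>i\<^sub>1 \<cdots> x\<^sub>i\<^sub>r\<close> with \<open>i\<^sub>1 < \<dots> < i\<^sub>r\<close>.\<close>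

definition elem_sym :: "nat \<Rightarrow> (nat \<Rightarrow>\<^sub>0 nat) \<Rightarrow> int"
  where "elem_sym r m =
    (if (\<forall>i. Poly_Mapping.lookup m i \<le> 1) \<and> card (Poly_Mapping.keys m) = r then 1 else 0)"

definition sym_homogeneous :: "nat \<Rightarrow> ((nat \<Rightarrow>\<^sub>0 nat) \<Rightarrow> int) set"
  where "sym_homogeneous d =
    {f \<in> carrier sym_ring. \<forall>m. f m \<noteq> 0 \<longrightarrow> monomial_degree m = d}"

definition sym_le :: "nat \<Rightarrow> ((nat \<Rightarrow>\<^sub>0 nat) \<Rightarrow> int) set"
  where "sym_le i = generate (add_monoid sym_ring) (\<Union>d\<le>i. sym_homogeneous d)"


section \<open>The Farahat-Higman algebra\<close>

text \<open>A partition is the multiset of its parts.\<close>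

definition partitions :: "nat multiset set"
  where "partitions = {\<mu>. 0 \<notin># \<mu>}"

definition partitions_of :: "nat \<Rightarrow> nat multiset set"
  where "partitions_of n = {\<mu> \<in> partitions. sum_mset \<mu> = n}"

definition cycle_type :: "nat \<Rightarrow> (nat \<Rightarrow> nat) \<Rightarrow> nat multiset"
  where "cycle_type n \<sigma> = image_mset card (mset_set (orbit \<sigma> ` {1..n}))"

definition reduced_cycle_type :: "nat \<Rightarrow> (nat \<Rightarrow> nat) \<Rightarrow> nat multiset"
  where "reduced_cycle_type n \<sigma> = filter_mset (\<lambda>k. k \<noteq> 0) (image_mset (\<lambda>k. k - 1) (cycle_type n \<sigma>))"

definition class_sum :: "nat \<Rightarrow> nat multiset \<Rightarrow> ((nat \<Rightarrow> nat) \<Rightarrow>\<^sub>0 int)"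
  where "class_sum n \<mu> =
    (\<Sum>\<sigma> | \<sigma> \<in> carrier (sym_group n) \<and> reduced_cycle_type n \<sigma> = \<mu>. frag_of \<sigma>)"

definition FH_carrier :: "(nat multiset \<Rightarrow>\<^sub>0 rat poly) set"
  where "FH_carrier =
    {c. Poly_Mapping.keys c \<subseteq> partitions \<and> (\<forall>\<mu>. Poly_Mapping.lookup c \<mu> \<in> int_valued)}"

text \<open>\<open>structure_constants \<mu> \<nu>\<close> takes \<open>\<kappa>\<close> to the polynomial \<open>\<phi>\<close> with upper index \<open>\<kappa>\<close> and lower
  indices \<open>\<mu>\<close>, \<open>\<nu>\<close>.  It exists and is unique by the theorem of Farahat and Higman (only finitely
  many of these polynomials are nonzero); the argument of the floor function is always an integer.\<close>

definition structure_constants :: "nat multiset \<Rightarrow> nat multiset \<Rightarrow> (nat multiset \<Rightarrow>\<^sub>0 rat poly)"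
  where "structure_constants \<mu> \<nu> = (THE c. c \<in> FH_carrier \<and>
    (\<forall>n. class_sum n \<mu> \<otimes>\<^bsub>monoid_ring (sym_group n)\<^esub> class_sum n \<nu> =
      (\<Sum>\<kappa>\<in>Poly_Mapping.keys c.
         frag_cmul \<lfloor>poly (Poly_Mapping.lookup c \<kappa>) (of_nat n)\<rfloor> (class_sum n \<kappa>))))"

definition FH_basis :: "nat multiset \<Rightarrow> (nat multiset \<Rightarrow>\<^sub>0 rat poly)"
  where "FH_basis \<mu> = Poly_Mapping.single \<mu> 1"

definition FH_smult :: "rat poly \<Rightarrow> (nat multiset \<Rightarrow>\<^sub>0 rat poly) \<Rightarrow> (nat multiset \<Rightarrow>\<^sub>0 rat poly)"
  where "FH_smult r c = Poly_Mapping.map (\<lambda>p. r * p) c"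

text \<open>The unit is the basis element of the empty partition, since the only permutation of empty
  reduced cycle type is the identity.\<close>

definition FH :: "(rat poly, nat multiset \<Rightarrow>\<^sub>0 rat poly) module"
  where "FH =
    \<lparr> carrier = FH_carrier,
      mult = (\<lambda>c d. \<Sum>\<mu>\<in>Poly_Mapping.keys c. \<Sum>\<nu>\<in>Poly_Mapping.keys d.
        FH_smult (Poly_Mapping.lookup c \<mu> * Poly_Mapping.lookup d \<nu>) (structure_constants \<mu> \<nu>)),
      one = FH_basis {#},
      zero = 0,
      add = (+),
      smult = FH_smult \<rparr>"

definition FH_filtration :: "nat \<Rightarrow> (nat multiset \<Rightarrow>\<^sub>0 rat poly) set"
  where "FH_filtration i =
    rspan int_valued_ring FH {FH_basis \<mu> | \<mu>. \<mu> \<in> partitions \<and> sum_mset \<mu> \<le> i}"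

end

theory Submission
  imports Defs
begin

text \<open>Let \<open>J\<^sub>n = (1 n) + (2 n) + \<dots> + (n-1 n)\<close> be the Jucys-Murphy elements of the group ring of the
  symmetric groups.  They commute, so that substituting \<open>J\<^sub>1, \<dots>, J\<^sub>n\<close> for the variables is, for every
  \<open>n\<close>, a ring homomorphism from the symmetric functions to the group ring of \<open>S\<^sub>n\<close>.  Call the sum of
  the parts of the reduced cycle type of a permutation its rank.

  Specialising \<open>t\<close> to \<open>n\<close> and \<open>K\<^sub>\<mu>\<close> to the class sum \<open>X\<^sub>\<mu>\<close> maps the Farahat-Higman algebra to the
  group ring of \<open>S\<^sub>n\<close>.  These maps are multiplicative, and jointly injective, because a polynomial is
  determined by its values at the large integers (\<open>ev_mult\<close>, \<open>ev_inject\<close>).  This reduces every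
  identity in the Farahat-Higman algebra to identities in group rings.  By a theorem of Jucys,
  \<open>e\<^sub>k(J\<^sub>1, \<dots>, J\<^sub>n)\<close> is the sum of all permutations of rank \<open>k\<close> (\<open>lookup_JM_elem\<close>), which is the
  specialisation of \<open>\<Sum>\<^bsub>\<mu>\<turnstile>k\<^esub> K\<^sub>\<mu>\<close>.  The \<open>e\<^sub>k\<close> generate the ring of symmetric functions
  (\<open>symmetric_elem_gen\<close>); hence for every symmetric function \<open>f\<close> the elements \<open>f(J\<^sub>1, \<dots>, J\<^sub>n)\<close> are the
  specialisations of one element \<open>psi f\<close> of the Farahat-Higman algebra, and \<open>\<Psi>\<close> is the
  \<open>\<R>\<close>-linear extension of \<open>psi\<close>.  Generation also gives uniqueness.

  Bijectivity is a triangularity statement.  The weight \<open>|\<mu>| + \<ell>(\<mu>)\<close> of a partition is the number of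
  points that a permutation of reduced cycle type \<open>\<mu>\<close> moves.  A monomial of type \<open>\<mu>\<close> in the \<open>J\<^sub>i\<close> is a
  sum of products of transpositions in which at most \<open>|\<mu>| + \<ell>(\<mu>)\<close> points occur: every variable
  contributes its own index and one further point for each factor.  If all these points are distinct,
  then the product is a permutation of type \<open>\<mu>\<close> which determines the monomial and all the factors: the
  index of a variable is the largest point of its cycle (\<open>jmon_top\<close>).  So \<open>psi\<close> takes the monomial
  symmetric function of type \<open>\<mu>\<close> to \<open>K\<^sub>\<mu>\<close> plus terms of smaller weight (\<open>psi_msym\<close>).  A product of
  \<open>d\<close> transpositions has rank at most \<open>d\<close>, so these terms also lie in \<open>\<F>\<^bsup>|\<mu>|\<^esup>\<close>, and the
  unitriangular system can be solved within each step of the filtration (\<open>basis_in_image\<close>).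

  The structure constants are dealt with directly (\<open>lookup_csum_mult\<close>).  The coefficient of a
  permutation \<open>\<sigma>\<close> in \<open>X\<^sub>\<mu> X\<^sub>\<nu>\<close> counts factorisations \<open>\<sigma> = \<alpha>\<beta>\<close>; sorted by the set of points moved by \<open>\<alpha>\<close>
  or \<open>\<beta>\<close> but not by \<open>\<sigma>\<close>, it is an integral combination of the binomial coefficients
  of \<open>n - w\<close> over \<open>j\<close>, where \<open>w\<close> is the number of points moved by \<open>\<sigma>\<close>.\<close>

alias lookup = Poly_Mapping.lookup
alias keys = Poly_Mapping.keys
alias single = Poly_Mapping.single
alias map_key = Poly_Mapping.map_key

section \<open>Bijections between finite sets\<close>

lemma image_mset_eq_imp_bij_betw:
  assumes "finite A" "finite B" "image_mset f (mset_set A) = image_mset g (mset_set B)"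
  shows "\<exists>h. bij_betw h A B \<and> (\<forall>x\<in>A. g (h x) = f x)"
  using assms
proof (induction A arbitrary: B rule: finite_induct)
  case empty
  then have "B = {}" by (metis image_mset_is_empty_iff mset_set.empty mset_set_empty_iff)
  then show ?case by (auto simp: bij_betw_def)
next
  case (insert a A)
  from insert.prems have eq: "add_mset (f a) (image_mset f (mset_set A)) = image_mset g (mset_set B)"
    using insert.hyps by simp
  then have "f a \<in># image_mset g (mset_set B)" by (metis union_single_eq_member)
  then obtain b where b: "b \<in> B" "g b = f a" using insert.prems by auto
  have "mset_set B = add_mset b (mset_set (B - {b}))"
    using b insert.prems by (metis mset_set.remove)
  with eq b have "image_mset f (mset_set A) = image_mset g (mset_set (B - {b}))" by simp
  with insert.IH insert.prems obtain h
    where h: "bij_betw h A (B - {b})" "\<forall>x\<in>A. g (h x) = f x" by (metis finite_Diff)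
  have "bij_betw (h(a := b)) A (B - {b})"
    using h(1) insert.hyps by (auto simp: bij_betw_def inj_on_def)
  then have "bij_betw (h(a := b)) (insert a A) (insert b (B - {b}))"
    using insert.hyps(2) notIn_Un_bij_betw[of a A "h(a := b)" "B - {b}"] by simp
  then have "bij_betw (h(a := b)) (insert a A) B" using b by (simp add: insert_absorb)
  moreover have "\<forall>x\<in>insert a A. g ((h(a := b)) x) = f x" using h(2) b insert.hyps by auto
  ultimately show ?case by blast
qed

lemma bij_betw_extends_to_permutes:
  assumes "finite S" "finite T" "bij_betw h S T"
  shows "\<exists>\<pi>. \<pi> permutes (S \<union> T) \<and> (\<forall>x\<in>S. \<pi> x = h x)"
proof -
  have "card S = card T" using assms(3) by (rule bij_betw_same_card)
  then have "card (T - S) = card (S - T)"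
    using assms by (metis card_le_sym_Diff card_le_sym_Diff le_antisym order_refl)
  then obtain g where g: "bij_betw g (T - S) (S - T)"
    using assms finite_same_card_bij by blast
  define \<pi> where "\<pi> x = (if x \<in> S then h x else if x \<in> T then g x else x)" for x
  have "bij_betw \<pi> S T" using assms(3) by (subst bij_betw_cong[of _ _ h]) (auto simp: \<pi>_def)
  moreover have "bij_betw \<pi> (T - S) (S - T)"
    using g by (subst bij_betw_cong[of _ _ g]) (auto simp: \<pi>_def)
  ultimately have "bij_betw \<pi> (S \<union> (T - S)) (T \<union> (S - T))"
    by (rule bij_betw_combine) auto
  then have "bij_betw \<pi> (S \<union> T) (S \<union> T)" by (simp add: Un_commute)
  then have "\<pi> permutes (S \<union> T)" by (rule bij_imp_permutes) (auto simp: \<pi>_def)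
  then show ?thesis by (auto simp: \<pi>_def)
qed

section \<open>Finitary permutations\<close>

text \<open>The finitary permutations of the positive integers contain every \<open>S\<^sub>n\<close>, so that a single group ring
  serves for all \<open>n\<close>.  The group is written additively: the group ring of an additive monoid is an
  instance of the class \<open>ring_1\<close>.\<close>

typedef fperm = "{p :: nat \<Rightarrow> nat. \<exists>n. p permutes {1..n}}"
  morphisms act Fperm
  by (auto intro: exI[of _ id] permutes_id)

setup_lifting type_definition_fperm

lemma permutes_comp_finitary:
  "\<exists>n. p permutes {1..n} \<Longrightarrow> \<exists>n. q permutes {1..n} \<Longrightarrow> \<exists>n. (p \<circ> q) permutes {1..n::nat}"
proof -
  assume "\<exists>n. p permutes {1..n}" "\<exists>n. q permutes {1..n}"
  then obtain m n where "p permutes {1..m}" "q permutes {1..n}" by blast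
  then have "p permutes {1..max m n}" "q permutes {1..max m n}"
    by (auto elim!: permutes_subset)
  then show ?thesis using permutes_compose by blast
qed

instantiation fperm :: group_add
begin
lift_definition zero_fperm :: fperm is id by (auto intro: permutes_id)
lift_definition plus_fperm :: "fperm \<Rightarrow> fperm \<Rightarrow> fperm" is "(\<circ>)" by (rule permutes_comp_finitary)
lift_definition uminus_fperm :: "fperm \<Rightarrow> fperm" is "inv_into UNIV" by (auto intro: permutes_inv)
definition minus_fperm :: "fperm \<Rightarrow> fperm \<Rightarrow> fperm" where "minus_fperm \<sigma> \<tau> = \<sigma> + - \<tau>"
instance
proof
  fix a b c :: fperm
  show "a + b + c = a + (b + c)" by transfer auto
  show "0 + a = a" "a + 0 = a" by (transfer; auto)+
  show "- a + a = 0" by transfer (auto dest: permutes_inv_o)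
  show "a + - b = a - b" by (simp add: minus_fperm_def)
qed
end

lemma act_plus [simp]: "act (\<sigma> + \<tau>) x = act \<sigma> (act \<tau> x)" by transfer simp
lemma act_zero [simp]: "act 0 x = x" by transfer simp
lemma act_plus_fun: "act (\<sigma> + \<tau>) = act \<sigma> \<circ> act \<tau>" by transfer simp
lemma fperm_eqI: "(\<And>x. act \<sigma> x = act \<tau> x) \<Longrightarrow> \<sigma> = \<tau>" by transfer auto
lemma act_uminus [simp]: "act (- \<sigma>) (act \<sigma> x) = x" "act \<sigma> (act (- \<sigma>) x) = x"
  by (metis act_plus act_zero left_minus right_minus)+
lemma act_eq_iff [simp]: "act \<sigma> x = act \<sigma> y \<longleftrightarrow> x = y" by (metis act_uminus(1))
lemma act_minus [simp]: "act (\<sigma> - \<tau>) x = act \<sigma> (act (- \<tau>) x)"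
  by (metis act_plus add_uminus_conv_diff)
lemma act_eq_uminus: "act \<sigma> x = y \<longleftrightarrow> x = act (- \<sigma>) y" by auto

definition supp :: "fperm \<Rightarrow> nat set" where "supp \<sigma> = {x. act \<sigma> x \<noteq> x}"

lemma permutes_iff_supp: "act \<sigma> permutes S \<longleftrightarrow> supp \<sigma> \<subseteq> S"
proof
  assume "supp \<sigma> \<subseteq> S"
  moreover have "bij (act \<sigma>)" by (rule o_bij[of "act (- \<sigma>)"]) (auto simp: fun_eq_iff)
  ultimately show "act \<sigma> permutes S"
    unfolding permutes_def supp_def by (metis bij_pointE mem_Collect_eq subsetD)
qed (auto simp: supp_def permutes_def)

lemma supp_bounded: "\<exists>n. supp \<sigma> \<subseteq> {1..n}"
  using act[of \<sigma>] by (auto simp: permutes_iff_supp)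

lemma finite_supp [simp]: "finite (supp \<sigma>)"
  using supp_bounded[of \<sigma>] finite_subset by blast
lemma zero_notin_supp [simp]: "0 \<notin> supp \<sigma>" using supp_bounded[of \<sigma>] by auto
lemma act_0 [simp]: "act \<sigma> 0 = 0" using zero_notin_supp[of \<sigma>] unfolding supp_def by blast
lemma in_supp: "x \<in> supp \<sigma> \<longleftrightarrow> act \<sigma> x \<noteq> x" by (simp add: supp_def)
lemma act_in_supp [simp]: "act \<sigma> x \<in> supp \<sigma> \<longleftrightarrow> x \<in> supp \<sigma>" by (simp add: supp_def)
lemma act_pos [simp]: "0 < act \<sigma> x \<longleftrightarrow> 0 < x" by (metis act_0 act_eq_iff gr0I)
lemma supp_zero [simp]: "supp 0 = {}" by (simp add: supp_def)
lemma supp_plus: "supp (\<sigma> + \<tau>) \<subseteq> supp \<sigma> \<union> supp \<tau>" by (auto simp: supp_def)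
lemma supp_eq_empty: "supp \<sigma> = {} \<longleftrightarrow> \<sigma> = 0" by (auto simp: supp_def intro: fperm_eqI)

lemma permutes_act: "act \<sigma> permutes supp \<sigma>" by (simp add: permutes_iff_supp)

lemma ex_fperm:
  assumes "p permutes S" "finite S" "0 \<notin> S"
  shows "\<exists>\<sigma>. act \<sigma> = p"
proof -
  have "S \<subseteq> {1..Max S}" using assms by (auto simp: Suc_le_eq intro: gr0I)
  then have "p permutes {1..Max S}" using assms permutes_subset by blast
  then show ?thesis using Fperm_inverse by blast
qed

text \<open>The value for \<open>a = 0\<close> or \<open>b = 0\<close> is a default, since \<open>0\<close> is not permuted.\<close>

definition tr :: "nat \<Rightarrow> nat \<Rightarrow> fperm"
  where "tr a b = Fperm (if a = 0 \<or> b = 0 then id else transpose a b)"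

lemma act_tr: "0 < a \<Longrightarrow> 0 < b \<Longrightarrow> act (tr a b) = transpose a b"
  unfolding tr_def by (subst Fperm_inverse) (auto intro!: exI[of _ "max a b"] permutes_swap_id)

lemma tr_commute: "tr a b = tr b a" by (simp add: tr_def transpose_commute disj_commute)

lemma tr_tr [simp]: "0 < a \<Longrightarrow> 0 < b \<Longrightarrow> tr a b + tr a b = 0"
  by (rule fperm_eqI) (simp add: act_tr)

lemma add_tr_tr [simp]: "0 < a \<Longrightarrow> 0 < b \<Longrightarrow> \<sigma> + tr a b + tr a b = \<sigma>"
  by (metis add.assoc add.right_neutral tr_tr)

lemma supp_tr: "0 < a \<Longrightarrow> 0 < b \<Longrightarrow> a \<noteq> b \<Longrightarrow> supp (tr a b) = {a, b}"
  by (auto simp: supp_def act_tr transpose_def)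

lemma conj_tr: "0 < a \<Longrightarrow> 0 < b \<Longrightarrow> \<sigma> + tr a b = tr (act \<sigma> a) (act \<sigma> b) + \<sigma>"
  by (rule fperm_eqI) (auto simp: act_tr transpose_def)

section \<open>Cycles\<close>

definition cyc :: "fperm \<Rightarrow> nat \<Rightarrow> nat set" where "cyc \<sigma> x = orbit (act \<sigma>) x"

lemma permutation_act: "permutation (act \<sigma>)"
  using permutes_act[of \<sigma>] finite_supp[of \<sigma>] unfolding permutation_permutes by blast

lemma cyc_self [simp]: "x \<in> cyc \<sigma> x"
  unfolding cyc_def by (rule permutation_self_in_orbit[OF permutation_act])

lemma finite_cyc [simp]: "finite (cyc \<sigma> x)"
  unfolding cyc_def using finite_orbit cyc_self cyc_def by metis

lemma cyc_eq: "y \<in> cyc \<sigma> x \<Longrightarrow> cyc \<sigma> y = cyc \<sigma> x"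
  unfolding cyc_def by (metis cyc_def cyc_self orbit_swap orbit_trans subsetI subset_antisym)

lemma mem_cyc_iff: "y \<in> cyc \<sigma> x \<longleftrightarrow> cyc \<sigma> y = cyc \<sigma> x"
  using cyc_eq cyc_self by blast

lemma act_in_cyc [simp]: "act \<sigma> y \<in> cyc \<sigma> x \<longleftrightarrow> y \<in> cyc \<sigma> x"
  by (metis cyc_def cyc_eq cyc_self orbit.base)

lemma cyc_subset: "x \<in> S \<Longrightarrow> (\<And>y. y \<in> S \<Longrightarrow> act \<sigma> y \<in> S) \<Longrightarrow> cyc \<sigma> x \<subseteq> S"
proof
  fix y assume S: "x \<in> S" "\<And>y. y \<in> S \<Longrightarrow> act \<sigma> y \<in> S" and "y \<in> cyc \<sigma> x"
  from this(3) show "y \<in> S" unfolding cyc_def by induction (use S in auto)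
qed

lemma cyc_fixed: "act \<sigma> x = x \<Longrightarrow> cyc \<sigma> x = {x}"
  unfolding cyc_def by (simp add: orbit_eq_singleton_iff)

lemma cyc_cong:
  assumes "\<And>y. y \<in> cyc \<tau> x \<Longrightarrow> act \<sigma> y = act \<tau> y"
  shows "cyc \<sigma> x = cyc \<tau> x"
proof
  show "cyc \<sigma> x \<subseteq> cyc \<tau> x" by (rule cyc_subset) (auto simp: assms)
  have "cyc \<tau> x \<subseteq> cyc \<sigma> x \<inter> cyc \<tau> x"
  proof (rule cyc_subset)
    fix y assume "y \<in> cyc \<sigma> x \<inter> cyc \<tau> x"
    then show "act \<tau> y \<in> cyc \<sigma> x \<inter> cyc \<tau> x"
      using assms[of y] act_in_cyc[of \<sigma> y x] by auto
  qed simp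
  then show "cyc \<tau> x \<subseteq> cyc \<sigma> x" by blast
qed

lemma card_cyc_pos [simp]: "0 < card (cyc \<sigma> x)" by (metis card_gt_0_iff cyc_self emptyE finite_cyc)

lemma card_cyc_eq_1: "card (cyc \<sigma> x) = 1 \<longleftrightarrow> act \<sigma> x = x"
  by (metis act_in_cyc card_1_singletonE cyc_fixed cyc_self is_singletonI is_singleton_altdef singletonD)

lemma cyc_subset_supp: "x \<in> supp \<sigma> \<Longrightarrow> cyc \<sigma> x \<subseteq> supp \<sigma>"
  by (rule cyc_subset) auto

lemma cyc_conj: "cyc (\<pi> + \<sigma> - \<pi>) (act \<pi> x) = act \<pi> ` cyc \<sigma> x"
proof
  show "cyc (\<pi> + \<sigma> - \<pi>) (act \<pi> x) \<subseteq> act \<pi> ` cyc \<sigma> x"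
    by (rule cyc_subset) auto
  have "cyc \<sigma> x \<subseteq> act (- \<pi>) ` cyc (\<pi> + \<sigma> - \<pi>) (act \<pi> x)" (is "_ \<subseteq> _ ` ?C")
  proof (rule cyc_subset)
    show "x \<in> act (- \<pi>) ` ?C" by (rule image_eqI[of _ _ "act \<pi> x"]) auto
    fix y assume "y \<in> act (- \<pi>) ` ?C"
    then obtain z where z: "z \<in> ?C" "y = act (- \<pi>) z" by blast
    have "act (\<pi> + \<sigma> - \<pi>) z \<in> ?C" using z(1) by (subst act_in_cyc)
    then show "act \<sigma> y \<in> act (- \<pi>) ` ?C" by (rule rev_image_eqI) (simp add: z)
  qed
  then show "act \<pi> ` cyc \<sigma> x \<subseteq> ?C" by auto
qed

text \<open>How a cycle grows by one point when a permutation is multiplied by a transposition; supports, ranks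
  and exponents in products of transpositions are followed through this case.\<close>

lemma cyc_insert:
  assumes k: "act \<rho> k = k" "k \<noteq> n" "0 < k" "0 < n"
  shows "cyc (\<rho> + tr k n) x = (if x \<in> insert k (cyc \<rho> n) then insert k (cyc \<rho> n) else cyc \<rho> x)"
proof -
  define \<sigma> where "\<sigma> = \<rho> + tr k n"
  have act: "act \<sigma> k = act \<rho> n" "act \<sigma> n = k" "y \<noteq> k \<Longrightarrow> y \<noteq> n \<Longrightarrow> act \<sigma> y = act \<rho> y" for y
    using k by (auto simp: \<sigma>_def act_tr)
  have kn: "k \<notin> cyc \<rho> n" using k by (metis cyc_eq cyc_fixed cyc_self singletonD)
  have nn: "cyc \<sigma> n = insert k (cyc \<rho> n)"
  proof
    show "cyc \<sigma> n \<subseteq> insert k (cyc \<rho> n)"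
    proof (rule cyc_subset)
      fix y assume "y \<in> insert k (cyc \<rho> n)"
      then show "act \<sigma> y \<in> insert k (cyc \<rho> n)"
        by (cases "y = k"; cases "y = n") (auto simp: act)
    qed simp
    have kin: "k \<in> cyc \<sigma> n" using act(2) by (metis act_in_cyc cyc_self)
    have "cyc \<rho> n \<subseteq> cyc \<sigma> n"
    proof (rule cyc_subset)
      fix y assume y: "y \<in> cyc \<sigma> n"
      show "act \<rho> y \<in> cyc \<sigma> n"
      proof (cases "y = k \<or> y = n")
        case True
        moreover have "act \<rho> n \<in> cyc \<sigma> n" using kin by (subst act(1)[symmetric]) simp
        ultimately show ?thesis using kin k(1) by auto
      next
        case False
        then have "act \<rho> y = act \<sigma> y" by (simp add: act(3))
        then show ?thesis using y by simp
      qed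
    qed simp
    with kin show "insert k (cyc \<rho> n) \<subseteq> cyc \<sigma> n" by simp
  qed
  show ?thesis
  proof (cases "x \<in> insert k (cyc \<rho> n)")
    case True
    then have "x \<in> cyc \<sigma> n" by (simp only: nn)
    from cyc_eq[OF this] nn have "cyc \<sigma> x = insert k (cyc \<rho> n)" by (rule trans)
    then show ?thesis unfolding \<sigma>_def if_P[OF True] .
  next
    case False
    have "cyc \<sigma> x = cyc \<rho> x"
    proof (rule cyc_cong)
      fix y assume y: "y \<in> cyc \<rho> x"
      have xy: "cyc \<rho> y = cyc \<rho> x" using y by (rule cyc_eq)
      have "y \<noteq> k"
      proof
        assume "y = k"
        then have "cyc \<rho> x = {k}" using xy cyc_fixed[OF k(1)] by simp
        then show False using False cyc_self[of x \<rho>] by auto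
      qed
      moreover have "y \<noteq> n" using False xy cyc_self[of x \<rho>] by auto
      ultimately show "act \<sigma> y = act \<rho> y" by (rule act)
    qed
    then show ?thesis unfolding \<sigma>_def if_not_P[OF False] .
  qed
qed

section \<open>Types of monomials and of permutations\<close>

definition mon_type :: "(nat \<Rightarrow>\<^sub>0 nat) \<Rightarrow> nat multiset"
  where "mon_type a = image_mset (lookup a) (mset_set (keys a))"

lemma mon_type_partition [simp]: "mon_type a \<in> partitions"
  by (auto simp: mon_type_def partitions_def in_keys_iff)

lemma sum_mset_mon_type [simp]: "sum_mset (mon_type a) = monomial_degree a"
  by (simp add: mon_type_def monomial_degree_def sum_unfold_sum_mset)

lemma size_mon_type [simp]: "size (mon_type a) = card (keys a)"
  by (simp add: mon_type_def)

text \<open>By \<open>card_supp\<close> below, the number of points moved by a permutation of reduced cycle type \<open>\<mu>\<close>.\<close>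

definition wt :: "nat multiset \<Rightarrow> nat" where "wt \<mu> = sum_mset \<mu> + size \<mu>"

lemma expo_finite: "finite {i. (if Max (cyc \<sigma> i) = i then card (cyc \<sigma> i) - 1 else 0) \<noteq> 0}"
proof (rule finite_subset)
  show "{i. (if Max (cyc \<sigma> i) = i then card (cyc \<sigma> i) - 1 else 0) \<noteq> 0} \<subseteq> supp \<sigma>"
    by (auto simp: in_supp cyc_fixed split: if_splits)
qed simp

text \<open>A permutation \<open>\<sigma>\<close> with cycles of lengths \<open>a\<^sub>i + 1\<close> and largest points \<open>i\<close> is encoded by the monomial
  with exponents \<open>a\<^sub>i\<close>.  It is the only monomial in the Jucys-Murphy elements that has \<open>\<sigma>\<close> as a term and
  a weight no larger than the number of points moved by \<open>\<sigma>\<close>.\<close>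

definition expo :: "fperm \<Rightarrow> (nat \<Rightarrow>\<^sub>0 nat)"
  where "expo \<sigma> = Abs_poly_mapping (\<lambda>i. if Max (cyc \<sigma> i) = i then card (cyc \<sigma> i) - 1 else 0)"

lemma lookup_expo:
  "lookup (expo \<sigma>) i = (if Max (cyc \<sigma> i) = i then card (cyc \<sigma> i) - 1 else 0)"
  unfolding expo_def by (subst lookup_Abs_poly_mapping) (use expo_finite in auto)

lemma card_cyc_supp: "x \<in> supp \<sigma> \<longleftrightarrow> card (cyc \<sigma> x) \<noteq> 1"
  by (simp only: in_supp card_cyc_eq_1)

lemma keys_expo: "keys (expo \<sigma>) = {i \<in> supp \<sigma>. Max (cyc \<sigma> i) = i}"
proof -
  have "card (cyc \<sigma> i) - 1 = 0 \<longleftrightarrow> i \<notin> supp \<sigma>" for i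
    using card_cyc_pos[of \<sigma> i] card_cyc_supp[of i \<sigma>] by linarith
  then have "i \<in> keys (expo \<sigma>) \<longleftrightarrow> i \<in> supp \<sigma> \<and> Max (cyc \<sigma> i) = i" for i
    unfolding in_keys_iff lookup_expo by metis
  then show ?thesis by blast
qed

lemma Max_cyc_in [simp]: "Max (cyc \<sigma> x) \<in> cyc \<sigma> x"
  by (rule Max_in) (simp, metis cyc_self empty_iff)

text \<open>A cycle is recovered from its largest point, so that the exponents list the nontrivial cycles without
  repetition.\<close>

lemma bij_betw_cyc_keys: "bij_betw (cyc \<sigma>) (keys (expo \<sigma>)) (cyc \<sigma> ` supp \<sigma>)"
  unfolding bij_betw_def
proof
  show "inj_on (cyc \<sigma>) (keys (expo \<sigma>))"
    by (rule inj_onI) (metis (mono_tags, lifting) keys_expo mem_Collect_eq)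
  have "cyc \<sigma> x \<in> cyc \<sigma> ` keys (expo \<sigma>)" if "x \<in> supp \<sigma>" for x
  proof
    show eq: "cyc \<sigma> x = cyc \<sigma> (Max (cyc \<sigma> x))" by (metis Max_cyc_in cyc_eq)
    have "Max (cyc \<sigma> x) \<in> supp \<sigma>" using cyc_subset_supp[OF that] by (meson Max_cyc_in subsetD)
    then show "Max (cyc \<sigma> x) \<in> keys (expo \<sigma>)"
      using eq by (simp add: keys_expo)
  qed
  then show "cyc \<sigma> ` keys (expo \<sigma>) = cyc \<sigma> ` supp \<sigma>" by (auto simp: keys_expo)
qed

definition rtype :: "fperm \<Rightarrow> nat multiset" where "rtype \<sigma> = mon_type (expo \<sigma>)"

lemma rtype_cycles: "rtype \<sigma> = image_mset (\<lambda>C. card C - 1) (mset_set (cyc \<sigma> ` supp \<sigma>))"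
proof -
  have "mset_set (cyc \<sigma> ` supp \<sigma>) = image_mset (cyc \<sigma>) (mset_set (keys (expo \<sigma>)))"
    using bij_betw_cyc_keys[of \<sigma>] by (metis bij_betw_def image_mset_mset_set)
  moreover have "image_mset (\<lambda>i. card (cyc \<sigma> i) - 1) (mset_set (keys (expo \<sigma>))) = rtype \<sigma>"
    unfolding rtype_def mon_type_def
    by (rule image_mset_cong) (auto simp: keys_expo lookup_expo)
  ultimately show ?thesis by (simp add: multiset.map_comp comp_def)
qed

lemma rtype_partition [simp]: "rtype \<sigma> \<in> partitions" by (simp add: rtype_def)

lemma sum_card_cyc:
  assumes "finite S" "\<And>x. x \<in> S \<Longrightarrow> cyc \<sigma> x \<subseteq> S"
  shows "(\<Sum>C\<in>cyc \<sigma> ` S. card C) = card S"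
proof -
  have "\<Union> (cyc \<sigma> ` S) = S" using assms(2) by (auto intro: cyc_self)
  moreover have "card (\<Union> (cyc \<sigma> ` S)) = sum card (cyc \<sigma> ` S)"
  proof (rule card_Union_disjoint)
    show "disjoint (cyc \<sigma> ` S)"
    proof (rule disjointI)
      fix C D assume "C \<in> cyc \<sigma> ` S" "D \<in> cyc \<sigma> ` S" "C \<noteq> D"
      then obtain x y where "C = cyc \<sigma> x" "D = cyc \<sigma> y" by blast
      with \<open>C \<noteq> D\<close> show "C \<inter> D = {}" using cyc_eq[of _ \<sigma> x] cyc_eq[of _ \<sigma> y] by blast
    qed
  qed auto
  ultimately show ?thesis by simp
qed

lemma card_supp: "card (supp \<sigma>) = wt (rtype \<sigma>)"
proof -
  have "card (supp \<sigma>) = (\<Sum>C\<in>cyc \<sigma> ` supp \<sigma>. card C)"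
    by (rule sum_card_cyc[symmetric]) (use cyc_subset_supp in auto)
  also have "\<dots> = (\<Sum>C\<in>cyc \<sigma> ` supp \<sigma>. (card C - 1) + 1)"
    by (rule sum.cong) (auto simp: Suc_leI)
  also have "\<dots> = wt (rtype \<sigma>)"
    unfolding sum.distrib by (simp add: rtype_cycles wt_def sum_unfold_sum_mset)
  finally show ?thesis .
qed

lemma cyc_subset_interval: "supp \<sigma> \<subseteq> {1..n} \<Longrightarrow> x \<in> {1..n} \<Longrightarrow> cyc \<sigma> x \<subseteq> {1..n}"
  by (rule cyc_subset) (metis (no_types, lifting) act_in_supp in_supp subset_iff)+

lemma nontrivial_cycles:
  assumes "supp \<sigma> \<subseteq> {1..n}"
  shows "{C \<in> cyc \<sigma> ` {1..n}. card C - 1 \<noteq> 0} = cyc \<sigma> ` supp \<sigma>"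
proof -
  have "card (cyc \<sigma> x) - 1 \<noteq> 0 \<longleftrightarrow> x \<in> supp \<sigma>" for x
    using card_cyc_pos[of \<sigma> x] card_cyc_supp[of x \<sigma>] by linarith
  then show ?thesis using assms by auto
qed

lemma reduced_cycle_type_act:
  assumes "supp \<sigma> \<subseteq> {1..n}"
  shows "reduced_cycle_type n (act \<sigma>) = rtype \<sigma>"
proof -
  have "reduced_cycle_type n (act \<sigma>) =
      image_mset (\<lambda>C. card C - 1) (filter_mset (\<lambda>C. card C - 1 \<noteq> 0) (mset_set (cyc \<sigma> ` {1..n})))"
    unfolding reduced_cycle_type_def cycle_type_def cyc_def
    by (simp add: filter_mset_image_mset multiset.map_comp comp_def not_le)
  also have "filter_mset (\<lambda>C. card C - 1 \<noteq> 0) (mset_set (cyc \<sigma> ` {1..n})) = mset_set (cyc \<sigma> ` supp \<sigma>)"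
    using nontrivial_cycles[OF assms] by simp
  finally show ?thesis by (simp add: rtype_cycles)
qed

lemma rank_plus_card_cycles:
  assumes "supp \<sigma> \<subseteq> {1..n}"
  shows "sum_mset (rtype \<sigma>) + card (cyc \<sigma> ` {1..n}) = n"
proof -
  have "n = (\<Sum>C\<in>cyc \<sigma> ` {1..n}. card C)"
    using sum_card_cyc[of "{1..n}" \<sigma>] cyc_subset_interval[OF assms] by simp
  also have "\<dots> = (\<Sum>C\<in>cyc \<sigma> ` {1..n}. (card C - 1) + 1)"
    by (rule sum.cong) (auto simp: Suc_leI)
  also have "\<dots> = (\<Sum>C\<in>cyc \<sigma> ` {1..n}. card C - 1) + card (cyc \<sigma> ` {1..n})"
    unfolding sum.distrib by simp
  also have "(\<Sum>C\<in>cyc \<sigma> ` {1..n}. card C - 1) = (\<Sum>C\<in>{C \<in> cyc \<sigma> ` {1..n}. card C - 1 \<noteq> 0}. card C - 1)"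
    by (rule sum.mono_neutral_right) auto
  also have "\<dots> = sum_mset (rtype \<sigma>)"
    unfolding nontrivial_cycles[OF assms] by (simp add: rtype_cycles sum_unfold_sum_mset)
  finally show ?thesis by simp
qed

lemma supp_subset_common: "\<exists>n. supp \<sigma> \<subseteq> {1..n} \<and> supp \<tau> \<subseteq> {1..n} \<and> a \<le> n \<and> (b::nat) \<le> n"
proof -
  obtain m k where "supp \<sigma> \<subseteq> {1..m}" "supp \<tau> \<subseteq> {1..k}" using supp_bounded by meson
  then show ?thesis by (intro exI[of _ "max (max m k) (max a b)"]) fastforce
qed

lemma supp_plus_tr: "0 < a \<Longrightarrow> 0 < b \<Longrightarrow> supp (\<sigma> + tr a b) \<subseteq> supp \<sigma> \<union> {a, b}"
  using supp_plus[of \<sigma> "tr a b"] by (cases "a = b") (auto simp: supp_tr in_supp act_tr)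

text \<open>The cycles of \<open>\<sigma>\<close> that contain neither \<open>a\<close> nor \<open>b\<close> are still cycles after the multiplication, and
  \<open>a\<close> lies in a further one.  So at most one cycle is lost.\<close>

lemma rank_plus_tr_le:
  assumes "0 < a" "0 < b"
  shows "sum_mset (rtype (\<sigma> + tr a b)) \<le> Suc (sum_mset (rtype \<sigma>))"
proof -
  define \<tau> where "\<tau> = \<sigma> + tr a b"
  obtain n where n: "supp \<sigma> \<subseteq> {1..n}" "a \<le> n" "b \<le> n"
    using supp_subset_common[of \<sigma> \<sigma> a b] by auto
  have n': "supp \<tau> \<subseteq> {1..n}" using supp_plus_tr[OF assms, of \<sigma>] n assms by (auto simp: \<tau>_def)
  let ?C = "cyc \<sigma> ` {1..n}" and ?D = "cyc \<tau> ` {1..n}"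
  have *: "cyc \<tau> x = cyc \<sigma> x" if "a \<notin> cyc \<sigma> x" "b \<notin> cyc \<sigma> x" for x
    by (rule cyc_cong) (use that assms in \<open>auto simp: \<tau>_def act_tr transpose_def\<close>)
  have union: "cyc \<tau> a \<subseteq> cyc \<sigma> a \<union> cyc \<sigma> b"
    by (rule cyc_subset) (use assms in \<open>auto simp: \<tau>_def act_tr transpose_def\<close>)
  have "insert (cyc \<tau> a) (?C - {cyc \<sigma> a, cyc \<sigma> b}) \<subseteq> ?D"
  proof
    fix X assume X: "X \<in> insert (cyc \<tau> a) (?C - {cyc \<sigma> a, cyc \<sigma> b})"
    show "X \<in> ?D"
    proof (cases "X = cyc \<tau> a")
      case True
      then show ?thesis using n assms by auto
    next
      case False
      with X obtain x where x: "x \<in> {1..n}" "X = cyc \<sigma> x" "cyc \<sigma> x \<noteq> cyc \<sigma> a" "cyc \<sigma> x \<noteq> cyc \<sigma> b"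
        by blast
      then have "cyc \<tau> x = cyc \<sigma> x" by (intro *) (auto simp: mem_cyc_iff)
      then show ?thesis using x by (metis imageI)
    qed
  qed
  then have le: "card (insert (cyc \<tau> a) (?C - {cyc \<sigma> a, cyc \<sigma> b})) \<le> card ?D"
    by (intro card_mono) auto
  have "cyc \<tau> a \<notin> ?C - {cyc \<sigma> a, cyc \<sigma> b}"
    by (metis Diff_iff cyc_eq cyc_self imageE insertCI)
  then have "card (insert (cyc \<tau> a) (?C - {cyc \<sigma> a, cyc \<sigma> b})) = Suc (card (?C - {cyc \<sigma> a, cyc \<sigma> b}))"
    by simp
  moreover have "card ?C - 2 \<le> card (?C - {cyc \<sigma> a, cyc \<sigma> b})"
    using diff_card_le_card_Diff[of "{cyc \<sigma> a, cyc \<sigma> b}" ?C]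
    by (auto simp: card_insert_if split: if_splits)
  ultimately have "card ?C \<le> Suc (card ?D)" using le by linarith
  then show ?thesis
    using rank_plus_card_cycles[OF n(1)] rank_plus_card_cycles[OF n'] by (simp add: \<tau>_def)
qed

lemma supp_insert:
  assumes "act \<rho> k = k" "k \<noteq> n" "0 < k" "0 < n"
  shows "supp (\<rho> + tr k n) = insert k (insert n (supp \<rho>))"
proof -
  have "act \<rho> n \<noteq> k" using assms by (metis act_eq_iff)
  then show ?thesis using assms by (auto simp: in_supp act_tr transpose_def split: if_splits)
qed

text \<open>The cycles \<open>{k}\<close> and \<open>cyc \<rho> n\<close> become one.\<close>

lemma rank_insert:
  assumes k: "act \<rho> k = k" "k \<noteq> n" "0 < k" "0 < n"
  shows "sum_mset (rtype (\<rho> + tr k n)) = Suc (sum_mset (rtype \<rho>))"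
proof -
  define \<sigma> where "\<sigma> = \<rho> + tr k n"
  obtain N where N: "supp \<rho> \<subseteq> {1..N}" "k \<le> N" "n \<le> N"
    using supp_subset_common[of \<rho> \<rho> k n] by auto
  have N': "supp \<sigma> \<subseteq> {1..N}" unfolding \<sigma>_def supp_insert[OF k] using N k by auto
  let ?C = "cyc \<rho> ` {1..N}" and ?I = "insert k (cyc \<rho> n)"
  have kn: "k \<notin> cyc \<rho> n" using k by (metis cyc_eq cyc_fixed cyc_self singletonD)
  have ck: "cyc \<rho> k = {k}" using k(1) by (rule cyc_fixed)
  have cycI: "cyc \<sigma> x = ?I" if "x \<in> ?I" for x
    unfolding \<sigma>_def using cyc_insert[OF k, of x] unfolding if_P[OF that] .
  have cycN: "cyc \<sigma> x = cyc \<rho> x" if "x \<notin> ?I" for x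
    unfolding \<sigma>_def using cyc_insert[OF k, of x] unfolding if_not_P[OF that] .
  have eq: "cyc \<sigma> ` {1..N} = insert ?I (?C - {{k}, cyc \<rho> n})"
  proof (intro equalityI subsetI)
    fix X assume "X \<in> cyc \<sigma> ` {1..N}"
    then obtain x where x: "x \<in> {1..N}" "X = cyc \<sigma> x" by blast
    show "X \<in> insert ?I (?C - {{k}, cyc \<rho> n})"
    proof (cases "x \<in> ?I")
      case True
      then show ?thesis unfolding x(2) cycI[OF True] by simp
    next
      case False
      then have "cyc \<rho> x \<noteq> {k}" "cyc \<rho> x \<noteq> cyc \<rho> n" using cyc_self[of x \<rho>] by blast+
      then show ?thesis unfolding x(2) cycN[OF False] using x(1) by blast
    qed
  next
    fix X assume X: "X \<in> insert ?I (?C - {{k}, cyc \<rho> n})"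
    show "X \<in> cyc \<sigma> ` {1..N}"
    proof (cases "X = ?I")
      case True
      then have "X = cyc \<sigma> n" using cycI[of n] by simp
      then show ?thesis using N k by simp
    next
      case False
      then obtain x where x: "x \<in> {1..N}" "X = cyc \<rho> x" "X \<noteq> {k}" "X \<noteq> cyc \<rho> n" using X by blast
      then have "x \<notin> ?I" using ck cyc_eq by blast
      then show ?thesis using x using cycN[of x] by blast
    qed
  qed
  have "?I \<notin> ?C"
  proof
    assume "?I \<in> ?C"
    then obtain x where "?I = cyc \<rho> x" by blast
    then have "k \<in> cyc \<rho> x" by blast
    then have "?I = {k}" using ck cyc_eq \<open>?I = cyc \<rho> x\<close> by metis
    then show False using cyc_self[of n \<rho>] k(2) by blast
  qed
  moreover have "{{k}, cyc \<rho> n} \<subseteq> ?C" using N k ck by (auto intro: image_eqI[of _ _ k])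
  moreover have "card {{k}, cyc \<rho> n} = 2"
  proof -
    have "{k} \<noteq> cyc \<rho> n" using kn by blast
    then show ?thesis by simp
  qed
  ultimately have "card (cyc \<sigma> ` {1..N}) = Suc (card ?C - 2)" "2 \<le> card ?C"
    unfolding eq using card_mono[of ?C "{{k}, cyc \<rho> n}"] by (auto simp: card_Diff_subset)
  then show ?thesis
    using rank_plus_card_cycles[OF N(1)] rank_plus_card_cycles[OF N'] by (simp add: \<sigma>_def)
qed

text \<open>The cycle of \<open>n\<close> gains the point \<open>k < n\<close> and keeps its largest point \<open>n\<close>.\<close>

lemma expo_insert:
  assumes k: "act \<rho> k = k" "0 < k" "k < n" and n: "supp \<rho> \<subseteq> {1..n}"
  shows "expo (\<rho> + tr k n) = expo \<rho> + single n 1"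
proof (rule poly_mapping_eqI)
  fix i
  have ck: "cyc \<rho> k = {k}" using k(1) by (rule cyc_fixed)
  have kn: "k \<notin> cyc \<rho> n" using k by (metis cyc_eq cyc_fixed cyc_self less_irrefl singletonD)
  have sub: "cyc \<rho> n \<subseteq> {1..n}" using cyc_subset_interval[OF n] k by simp
  then have Max: "Max (cyc \<rho> n) = n" "Max (insert k (cyc \<rho> n)) = n"
    using k(3) by (auto intro!: Max_eqI)
  have cyc: "cyc (\<rho> + tr k n) x = (if x \<in> insert k (cyc \<rho> n) then insert k (cyc \<rho> n) else cyc \<rho> x)" for x
    using k by (intro cyc_insert) auto
  consider "i = n" | "i \<noteq> n" "i \<in> insert k (cyc \<rho> n)" | "i \<notin> insert k (cyc \<rho> n)" by blast
  then show "lookup (expo (\<rho> + tr k n)) i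
      = lookup (expo \<rho> + single n 1) i"
  proof cases
    case 1
    then show ?thesis using kn by (simp add: lookup_expo lookup_add cyc Max lookup_single)
  next
    case 2
    then have "cyc \<rho> i = {k} \<and> i = k \<or> cyc \<rho> i = cyc \<rho> n" using ck cyc_eq by blast
    then show ?thesis using 2 Max by (auto simp: lookup_expo lookup_add cyc lookup_single)
  next
    case 3
    then have "i \<noteq> n" by auto
    then show ?thesis using 3 by (simp add: lookup_expo lookup_add cyc lookup_single)
  qed
qed

section \<open>Conjugacy\<close>

lemma act_pow_eq_iff:
  "(act \<sigma> ^^ i) x = (act \<sigma> ^^ j) x \<longleftrightarrow> i mod card (cyc \<sigma> x) = j mod card (cyc \<sigma> x)"
proof -
  define c where "c = funpow_dist1 (act \<sigma>) x x"
  have x: "x \<in> orbit (act \<sigma>) x" using cyc_self cyc_def by metis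
  have inj: "inj_on (\<lambda>n. (act \<sigma> ^^ n) x) {0..<c}"
    unfolding c_def by (rule inj_on_funpow_dist1[OF x])
  have "cyc \<sigma> x = (\<lambda>n. (act \<sigma> ^^ n) x) ` {0..<c}"
    unfolding c_def cyc_def by (rule orbit_conv_funpow_dist1[OF x])
  then have c: "card (cyc \<sigma> x) = c" using inj by (simp add: card_image)
  have "(act \<sigma> ^^ c) x = x" unfolding c_def by (rule funpow_dist1_prop[OF x])
  then have m: "(act \<sigma> ^^ (n mod c)) x = (act \<sigma> ^^ n) x" for n by (rule funpow_mod_eq)
  have "0 < c" using c card_cyc_pos[of \<sigma> x] by simp
  then have "(act \<sigma> ^^ (i mod c)) x = (act \<sigma> ^^ (j mod c)) x \<longleftrightarrow> i mod c = j mod c"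
    using inj by (auto dest: inj_onD)
  then show ?thesis by (simp add: m c)
qed

lemma cyc_altdef: "cyc \<sigma> x = {(act \<sigma> ^^ i) x | i. True}"
  unfolding cyc_def by (rule orbit_altdef_permutation[OF permutation_act])

text \<open>Match the cycles of \<open>\<sigma>\<close> with those of \<open>\<tau>\<close> of the same length, choose a base point in every cycle and
  send the \<open>i\<close>-th point after a base point to the \<open>i\<close>-th point after the corresponding one; this does
  not depend on the choice of \<open>i\<close> because the lengths agree.\<close>

lemma equivariant_bij:
  assumes "rtype \<sigma> = rtype \<tau>"
  shows "\<exists>f. bij_betw f (supp \<sigma>) (supp \<tau>) \<and> (\<forall>z\<in>supp \<sigma>. f (act \<sigma> z) = act \<tau> (f z))"
proof -
  obtain h where h: "bij_betw h (cyc \<sigma> ` supp \<sigma>) (cyc \<tau> ` supp \<tau>)"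
      "\<And>C. C \<in> cyc \<sigma> ` supp \<sigma> \<Longrightarrow> card (h C) - 1 = card C - 1"
    using image_mset_eq_imp_bij_betw[OF _ _ assms[unfolded rtype_cycles]] by auto
  define y where "y z = Max (h (cyc \<sigma> z))" for z
  have hC: "h (cyc \<sigma> z) = cyc \<tau> (y z) \<and> y z \<in> supp \<tau> \<and> card (cyc \<tau> (y z)) = card (cyc \<sigma> z)"
    if z: "z \<in> supp \<sigma>" for z
  proof -
    from h(1) z have "h (cyc \<sigma> z) \<in> cyc \<tau> ` supp \<tau>" by (auto simp: bij_betw_def)
    then obtain w where w: "w \<in> supp \<tau>" "h (cyc \<sigma> z) = cyc \<tau> w" by blast
    then have yw: "y z \<in> cyc \<tau> w" by (simp add: y_def)
    then have "y z \<in> supp \<tau>" using cyc_subset_supp w by blast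
    moreover have e: "h (cyc \<sigma> z) = cyc \<tau> (y z)" using w yw cyc_eq by metis
    moreover have "card (cyc \<tau> (y z)) = card (cyc \<sigma> z)"
      using h(2)[of "cyc \<sigma> z"] z card_cyc_pos[of \<tau> "y z"] card_cyc_pos[of \<sigma> z] e
      by (metis Suc_pred' diff_Suc_1 imageI One_nat_def)
    ultimately show ?thesis by simp
  qed
  define x where "x z = Max (cyc \<sigma> z)" for z
  have cx: "cyc \<sigma> (x z) = cyc \<sigma> z" for z unfolding x_def by (metis Max_cyc_in cyc_eq)
  have "\<exists>i. (act \<sigma> ^^ i) (x z) = z" for z
  proof -
    have "z \<in> cyc \<sigma> (x z)" unfolding cx by simp
    then obtain i where "z = (act \<sigma> ^^ i) (x z)" unfolding cyc_altdef by blast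
    from this[symmetric] show ?thesis by (rule exI)
  qed
  then obtain i where i: "\<And>z. (act \<sigma> ^^ i z) (x z) = z" by metis
  define f where "f z = (act \<tau> ^^ i z) (y z)" for z
  have f: "f z = (act \<tau> ^^ j) (y z)" if "z \<in> supp \<sigma>" "z = (act \<sigma> ^^ j) (x z)" for z j
  proof -
    have "i z mod card (cyc \<sigma> z) = j mod card (cyc \<sigma> z)"
      using i[of z] that(2) act_pow_eq_iff[where \<sigma> = \<sigma> and i = "i z" and x = "x z" and j = j] by (simp add: cx)
    then show ?thesis using hC[OF that(1)] unfolding f_def by (simp add: act_pow_eq_iff)
  qed
  have f_cyc: "cyc \<tau> (f z) = h (cyc \<sigma> z)" if "z \<in> supp \<sigma>" for z
    using hC[OF that] unfolding f_def by (metis (mono_tags, lifting) cyc_altdef cyc_eq mem_Collect_eq)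
  have same: "y z = y w" "x z = x w" if "cyc \<sigma> z = cyc \<sigma> w" for z w
    using that by (simp_all add: x_def y_def)
  have inj: "inj_on f (supp \<sigma>)"
  proof (rule inj_onI)
    fix z w assume zw: "z \<in> supp \<sigma>" "w \<in> supp \<sigma>" "f z = f w"
    then have "h (cyc \<sigma> z) = h (cyc \<sigma> w)" using f_cyc by metis
    then have c: "cyc \<sigma> z = cyc \<sigma> w" using h(1) zw by (auto simp: bij_betw_def inj_on_def)
    have "(act \<tau> ^^ i z) (y z) = (act \<tau> ^^ i w) (y z)"
      using zw(3) same[OF c] by (simp add: f_def)
    then have "(act \<sigma> ^^ i z) (x z) = (act \<sigma> ^^ i w) (x z)"
      unfolding act_pow_eq_iff cx using hC[OF zw(1)] by metis
    then have "z = (act \<sigma> ^^ i w) (x z)" unfolding i[of z] .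
    also have "\<dots> = w" unfolding same(2)[OF c] i[of w] ..
    finally show "z = w" .
  qed
  moreover have "f ` supp \<sigma> = supp \<tau>"
  proof (intro equalityI subsetI)
    fix w assume "w \<in> f ` supp \<sigma>"
    then obtain z where z: "z \<in> supp \<sigma>" "w = f z" by blast
    then have "w \<in> cyc \<tau> (y z)" using f_cyc hC cyc_self by metis
    then show "w \<in> supp \<tau>" using hC[OF z(1)] cyc_subset_supp by blast
  next
    fix w assume w: "w \<in> supp \<tau>"
    then have "cyc \<tau> w \<in> h ` (cyc \<sigma> ` supp \<sigma>)" using h(1) by (auto simp: bij_betw_def)
    then obtain u where u: "u \<in> supp \<sigma>" "cyc \<tau> w = h (cyc \<sigma> u)" by blast
    then have "w \<in> cyc \<tau> (y u)" using hC cyc_self by metis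
    then obtain j where j: "w = (act \<tau> ^^ j) (y u)" by (auto simp: cyc_altdef)
    define z where "z = (act \<sigma> ^^ j) (x u)"
    have "z \<in> cyc \<sigma> u" by (metis (mono_tags, lifting) z_def cx cyc_altdef mem_Collect_eq)
    then have zu: "cyc \<sigma> z = cyc \<sigma> u" by (rule cyc_eq)
    have "z \<in> supp \<sigma>" using u(1) \<open>z \<in> cyc \<sigma> u\<close> cyc_subset_supp by blast
    moreover have "f z = w"
      using f[OF calculation, of j] same[OF zu] j by (simp add: z_def)
    ultimately show "w \<in> f ` supp \<sigma>" by blast
  qed
  moreover have "f (act \<sigma> z) = act \<tau> (f z)" if z: "z \<in> supp \<sigma>" for z
  proof -
    have c: "cyc \<sigma> (act \<sigma> z) = cyc \<sigma> z" by (rule cyc_eq) simp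
    have "act \<sigma> z = (act \<sigma> ^^ Suc (i z)) (x (act \<sigma> z))"
      unfolding same(2)[OF c] funpow.simps comp_apply i[of z] ..
    then have "f (act \<sigma> z) = (act \<tau> ^^ Suc (i z)) (y (act \<sigma> z))" using z by (intro f) simp_all
    then show ?thesis using same[OF c] by (simp add: f_def)
  qed
  ultimately show ?thesis unfolding bij_betw_def by blast
qed

text \<open>The sets \<open>T\<close> and \<open>U\<close> are carried along for the count of factorisations below, which has to be
  independent of the choice of a permutation of given type and of a set of given size off its support.\<close>

lemma same_type_conjugate:
  assumes "rtype \<sigma> = rtype \<tau>" "finite T" "finite U" "card T = card U" "0 \<notin> T" "0 \<notin> U"
    "T \<inter> supp \<sigma> = {}" "U \<inter> supp \<tau> = {}"
  shows "\<exists>\<pi>. \<tau> = \<pi> + \<sigma> - \<pi> \<and> act \<pi> ` T = U"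
proof -
  obtain f where f: "bij_betw f (supp \<sigma>) (supp \<tau>)" "\<And>z. z \<in> supp \<sigma> \<Longrightarrow> f (act \<sigma> z) = act \<tau> (f z)"
    using equivariant_bij[OF assms(1)] by blast
  obtain g where g: "bij_betw g T U" using assms(2-4) finite_same_card_bij by blast
  define h where "h x = (if x \<in> T then g x else f x)" for x
  have "bij_betw h T U" using g by (subst bij_betw_cong[of _ _ g]) (auto simp: h_def)
  moreover have "bij_betw h (supp \<sigma>) (supp \<tau>)"
    using f(1) assms(7) by (subst bij_betw_cong[of _ _ f]) (auto simp: h_def)
  ultimately have "bij_betw h (T \<union> supp \<sigma>) (U \<union> supp \<tau>)"
    using assms(8) by (rule bij_betw_combine)
  then obtain p where p: "p permutes (T \<union> supp \<sigma> \<union> (U \<union> supp \<tau>))" "\<And>x. x \<in> T \<union> supp \<sigma> \<Longrightarrow> p x = h x"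
    using bij_betw_extends_to_permutes[of "T \<union> supp \<sigma>" "U \<union> supp \<tau>" h] assms by auto
  then obtain \<pi> where \<pi>: "act \<pi> = p" using ex_fperm[OF p(1)] assms by auto
  have "act \<pi> ` T = U" using \<open>bij_betw h T U\<close> p(2) by (auto simp: \<pi> bij_betw_def)
  moreover have "\<tau> + \<pi> = \<pi> + \<sigma>"
  proof (rule fperm_eqI)
    fix z
    have pf: "act \<pi> z = f z" if "z \<in> supp \<sigma>" for z
      using that p(2)[of z] assms(7) by (auto simp: \<pi> h_def)
    show "act (\<tau> + \<pi>) z = act (\<pi> + \<sigma>) z"
    proof (cases "z \<in> supp \<sigma>")
      case True
      then show ?thesis using pf[of z] pf[of "act \<sigma> z"] f(2) by simp
    next
      case False
      have "act \<pi> z \<notin> supp \<tau>"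
      proof
        assume "act \<pi> z \<in> supp \<tau>"
        then have "act \<pi> z \<in> f ` supp \<sigma>" using f(1) by (simp add: bij_betw_def)
        then obtain w where "w \<in> supp \<sigma>" "f w = act \<pi> z" by auto
        then have "w = z" using pf[of w] by simp
        then show False using \<open>w \<in> supp \<sigma>\<close> False by simp
      qed
      then show ?thesis using False by (simp add: in_supp)
    qed
  qed
  then have "\<tau> = \<pi> + \<sigma> - \<pi>" by (metis add_diff_cancel)
  ultimately show ?thesis by blast
qed

lemma supp_conj: "supp (\<pi> + \<sigma> - \<pi>) = act \<pi> ` supp \<sigma>"
proof (intro equalityI subsetI)
  fix x assume "x \<in> supp (\<pi> + \<sigma> - \<pi>)"
  then have "act (- \<pi>) x \<in> supp \<sigma>" by (auto simp: in_supp act_eq_uminus)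
  then show "x \<in> act \<pi> ` supp \<sigma>" by (metis act_uminus(2) imageI)
qed (auto simp: in_supp)

lemma rtype_conj: "rtype (\<pi> + \<sigma> - \<pi>) = rtype \<sigma>"
proof -
  have "cyc (\<pi> + \<sigma> - \<pi>) ` supp (\<pi> + \<sigma> - \<pi>) = (`) (act \<pi>) ` cyc \<sigma> ` supp \<sigma>"
    by (simp add: supp_conj image_image cyc_conj)
  moreover have inj: "inj (act \<pi>)" by (rule injI) simp
  ultimately have "mset_set (cyc (\<pi> + \<sigma> - \<pi>) ` supp (\<pi> + \<sigma> - \<pi>))
      = image_mset ((`) (act \<pi>)) (mset_set (cyc \<sigma> ` supp \<sigma>))"
    by (metis image_mset_mset_set inj_image_eq_iff inj_onI)
  moreover have "card (act \<pi> ` C) = card C" for C using inj by (simp add: card_image inj_on_def)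
  ultimately show ?thesis by (simp add: rtype_cycles multiset.map_comp comp_def)
qed

lemma mon_type_single: "n \<notin> keys a \<Longrightarrow> 0 < b \<Longrightarrow>
  mon_type (a + single n b) = add_mset b (mon_type a)"
proof -
  assume n: "n \<notin> keys a" "0 < b"
  then have k: "keys (a + single n b) = insert n (keys a)"
    by (auto simp: in_keys_iff lookup_add lookup_single when_def split: if_splits)
  have "image_mset (lookup (a + single n b)) (mset_set (keys a))
      = mon_type a"
    unfolding mon_type_def by (rule image_mset_cong) (use n in \<open>auto simp: lookup_add lookup_single when_def\<close>)
  then show ?thesis unfolding mon_type_def k using n
    by (simp add: lookup_add lookup_single not_in_keys_iff_lookup_eq_zero)
qed

text \<open>Starting from the fixed point \<open>M\<close>, insert \<open>b\<close> fixed points smaller than \<open>M\<close> into its cycle.\<close>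

lemma ex_rtype_add:
  assumes "supp \<sigma> \<subseteq> {1..N}" and "N + b < M"
  shows "\<exists>\<tau>. expo \<tau> = expo \<sigma> + single M b \<and> supp \<tau> \<subseteq> {1..N + b} \<union> {M}"
  using assms(2)
proof (induction b)
  case 0
  then show ?case using assms(1) by (intro exI[of _ \<sigma>]) auto
next
  case (Suc b)
  then obtain \<tau> where \<tau>: "expo \<tau> = expo \<sigma> + single M b" "supp \<tau> \<subseteq> {1..N + b} \<union> {M}"
    by auto
  let ?k = "N + Suc b"
  have "?k \<notin> supp \<tau>" using \<tau>(2) Suc.prems by auto
  then have k: "act \<tau> ?k = ?k" by (simp add: in_supp)
  have "expo (\<tau> + tr ?k M) = expo \<tau> + single M 1"
    using Suc.prems \<tau>(2) k by (intro expo_insert) auto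
  also have "\<dots> = expo \<sigma> + single M (Suc b)"
    by (simp add: \<tau>(1) add.assoc single_add[symmetric])
  finally show ?case using \<tau>(2) supp_insert[OF k, of M] Suc.prems
    by (intro exI[of _ "\<tau> + tr ?k M"]) auto
qed

lemma ex_rtype:
  assumes "\<mu> \<in> partitions"
  shows "\<exists>\<sigma>. rtype \<sigma> = \<mu>"
  using assms
proof (induction \<mu>)
  case empty
  have "expo 0 = 0" by (rule poly_mapping_eqI) (simp add: lookup_expo cyc_fixed)
  then show ?case by (intro exI[of _ 0]) (simp add: rtype_def mon_type_def)
next
  case (add b \<mu>)
  then obtain \<sigma> where \<sigma>: "rtype \<sigma> = \<mu>" by (auto simp: partitions_def)
  obtain N where N: "supp \<sigma> \<subseteq> {1..N}" using supp_bounded by blast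
  obtain \<tau> where \<tau>: "expo \<tau> = expo \<sigma> + single (Suc (N + b)) b"
    using ex_rtype_add[OF N, of b "Suc (N + b)"] by auto
  have "Suc (N + b) \<notin> keys (expo \<sigma>)" using N by (auto simp: keys_expo)
  then have "rtype \<tau> = add_mset b \<mu>"
    using add.prems \<sigma> by (simp add: rtype_def \<tau> mon_type_single partitions_def)
  then show ?case by blast
qed

section \<open>Jucys-Murphy elements\<close>

type_synonym gring = "fperm \<Rightarrow>\<^sub>0 int"

lemma frag_of_mult: "frag_of a * frag_of b = frag_of (a + b)"
  by (simp add: mult_single)

lemma frag_induct [case_names zero one diff]:
  assumes "P 0" "\<And>x. P (frag_of x)" "\<And>a b. P a \<Longrightarrow> P b \<Longrightarrow> P (a - b)"
  shows "P c"
  by (rule frag_induction[of c UNIV P]) (use assms in auto)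

lemma lookup_mult_frag_of:
  fixes x :: gring
  shows "lookup (x * frag_of \<tau>) \<sigma> = lookup x (\<sigma> - \<tau>)"
proof (induction x rule: frag_induct)
  case (one \<rho>)
  have "\<rho> + \<tau> = \<sigma> \<longleftrightarrow> \<rho> = \<sigma> - \<tau>" by (metis add_diff_cancel diff_add_cancel)
  then show ?case unfolding frag_of_mult lookup_single when_def by presburger
qed (simp_all add: left_diff_distrib lookup_minus)

definition JM :: "nat \<Rightarrow> gring" where "JM n = (\<Sum>k\<in>{1..<n}. frag_of (tr k n))"

lemma lookup_mult_JM:
  "lookup (x * JM n) \<sigma> = (\<Sum>k\<in>{1..<n}. lookup x (\<sigma> + tr k n))"
proof -
  have "\<sigma> - tr k n = \<sigma> + tr k n" if "k \<in> {1..<n}" for k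
    using that add_tr_tr[of k n \<sigma>] by (metis add_diff_cancel atLeastLessThan_iff le_trans less_imp_le less_le_trans zero_less_one)
  then show ?thesis by (simp add: JM_def sum_distrib_left lookup_sum lookup_mult_frag_of)
qed

text \<open>Conjugation by \<open>\<sigma>\<close> permutes the summands of \<open>JM n\<close>.\<close>

lemma frag_of_commute_JM:
  assumes "supp \<sigma> \<subseteq> {1..<n}"
  shows "frag_of \<sigma> * JM n = JM n * frag_of \<sigma>"
proof -
  have "act \<sigma> permutes {1..<n}" using assms by (simp add: permutes_iff_supp)
  then have bij: "bij_betw (act \<sigma>) {1..<n} {1..<n}" by (rule permutes_imp_bij)
  have "n \<notin> supp \<sigma>" using assms by auto
  then have n: "act \<sigma> n = n" by (simp add: in_supp)
  have "frag_of \<sigma> * JM n = (\<Sum>k\<in>{1..<n}. frag_of (\<sigma> + tr k n))"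
    by (simp add: JM_def sum_distrib_left frag_of_mult)
  also have "\<dots> = (\<Sum>k\<in>{1..<n}. frag_of (tr (act \<sigma> k) n + \<sigma>))"
    by (rule sum.cong) (auto simp: conj_tr n)
  also have "\<dots> = (\<Sum>k\<in>{1..<n}. frag_of (tr k n + \<sigma>))"
    by (rule sum.reindex_bij_betw[OF bij])
  also have "\<dots> = JM n * frag_of \<sigma>"
    by (simp add: JM_def sum_distrib_right frag_of_mult)
  finally show ?thesis .
qed

lemma JM_commute: "JM i * JM j = JM j * JM i"
proof (induction i j rule: linorder_wlog)
  case (le i j)
  show ?case
  proof (cases "i = j")
    case False
    have "JM i * JM j = (\<Sum>k\<in>{1..<i}. frag_of (tr k i) * JM j)"
      unfolding JM_def[of i] by (rule sum_distrib_right)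
    also have "\<dots> = (\<Sum>k\<in>{1..<i}. JM j * frag_of (tr k i))"
      by (intro sum.cong refl frag_of_commute_JM) (use le False in \<open>auto simp: supp_tr\<close>)
    also have "\<dots> = JM j * JM i" unfolding JM_def[of i] by (rule sum_distrib_left[symmetric])
    finally show ?thesis .
  qed simp
qed simp

text \<open>The value of a monomial in the variables \<open>x\<^sub>0, \<dots>, x\<^bsub>N-1\<^esub>\<close> at the Jucys-Murphy elements, where
  \<open>JM 0 = JM 1 = 0\<close>.\<close>

fun jmon :: "nat \<Rightarrow> (nat \<Rightarrow>\<^sub>0 nat) \<Rightarrow> gring" where
  "jmon 0 a = 1"
| "jmon (Suc N) a = jmon N a * JM N ^ lookup a N"

lemma JM_commute_power: "JM i * JM j ^ m = JM j ^ m * JM i"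
  by (rule power_commuting_commutes[symmetric]) (rule JM_commute)

lemma jmon_commute_JM: "jmon N a * JM i = JM i * jmon N a"
  by (induction N) (simp_all add: mult.assoc, metis JM_commute_power mult.assoc)

lemma jmon_commute_JM_power: "jmon N a * JM i ^ m = JM i ^ m * jmon N a"
  by (rule power_commuting_commutes[symmetric]) (simp add: jmon_commute_JM)

lemma jmon_add: "jmon N (a + b) = jmon N a * jmon N b"
proof (induction N)
  case (Suc N)
  let ?i = "JM N ^ lookup a N" and ?j = "JM N ^ lookup b N"
  have "jmon (Suc N) (a + b) = jmon N a * (jmon N b * ?i) * ?j"
    by (simp add: Suc lookup_add power_add mult.assoc)
  also have "\<dots> = jmon (Suc N) a * jmon (Suc N) b"
    unfolding jmon_commute_JM_power[of N b N "lookup a N"] by (simp add: mult.assoc)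
  finally show ?case .
qed simp

lemma jmon_cong: "(\<And>i. i < N \<Longrightarrow> lookup a i = lookup b i) \<Longrightarrow> jmon N a = jmon N b"
  by (induction N) simp_all

lemma monomial_degree_superset:
  "finite A \<Longrightarrow> keys a \<subseteq> A \<Longrightarrow> monomial_degree a = (\<Sum>i\<in>A. lookup a i)"
  unfolding monomial_degree_def by (rule sum.mono_neutral_left) (auto simp: in_keys_iff)

lemma monomial_degree_add: "monomial_degree (a + b) = monomial_degree a + monomial_degree b"
proof -
  let ?A = "keys a \<union> keys b"
  have "keys (a + b) \<subseteq> ?A" by (rule keys_add)
  then show ?thesis
    using monomial_degree_superset[of ?A "a + b"] monomial_degree_superset[of ?A a]
      monomial_degree_superset[of ?A b] by (simp add: lookup_add sum.distrib)
qed

lemma monomial_degree_single [simp]: "monomial_degree (single n b) = b"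
  by (simp add: monomial_degree_def)

lemma monomial_degree_0 [simp]: "monomial_degree 0 = 0" by (simp add: monomial_degree_def)

definition mwt :: "(nat \<Rightarrow>\<^sub>0 nat) \<Rightarrow> nat" where "mwt a = monomial_degree a + card (keys a)"

lemma wt_mon_type: "wt (mon_type a) = mwt a" by (simp add: wt_def mwt_def)

lemma card_supp_expo: "card (supp \<sigma>) = mwt (expo \<sigma>)"
  by (simp add: card_supp rtype_def wt_mon_type)

lemma mwt_add_single:
  assumes "n \<notin> keys a"
  shows "mwt (a + single n b) = (if b = 0 then mwt a else mwt a + b + 1)"
proof (cases "b = 0")
  case False
  then have "keys (a + single n b) = insert n (keys a)"
    by (auto simp: in_keys_iff lookup_add lookup_single when_def split: if_splits)
  then show ?thesis using assms False by (simp add: mwt_def monomial_degree_add)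
qed simp

lemma expo_keys_bound:
  assumes "keys (expo \<sigma>) \<subseteq> {..N}"
  shows "supp \<sigma> \<subseteq> {1..N}"
proof
  fix x assume x: "x \<in> supp \<sigma>"
  have "cyc \<sigma> x \<in> cyc \<sigma> ` keys (expo \<sigma>)"
    using bij_betw_cyc_keys[of \<sigma>] x by (auto simp: bij_betw_def)
  then obtain i where i: "i \<in> keys (expo \<sigma>)" "cyc \<sigma> x = cyc \<sigma> i" by blast
  then have "x \<in> cyc \<sigma> i" using cyc_self by metis
  moreover have "Max (cyc \<sigma> i) = i" using i by (simp add: keys_expo)
  ultimately have "x \<le> i" by (metis Max_ge finite_cyc)
  moreover have "x \<noteq> 0" using x by (metis zero_notin_supp)
  ultimately show "x \<in> {1..N}" using i assms by auto
qed

text \<open>Adding factors \<open>JM N\<close> one at a time on the right.  A term of the product arises from a term \<open>\<rho>\<close> by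
  multiplication with some transposition \<open>(k N)\<close>, which adds at most the two points \<open>k\<close> and \<open>N\<close> to the
  support, and only \<open>k\<close> once \<open>N\<close> is moved.  The middle claim is what controls the terms in which a
  repeated point made \<open>N\<close> fixed again: they fall short of the weight by two, so that even
  two new points do not lead to a permutation of full support.\<close>

lemma jmon_step:
  assumes N: "keys a \<subseteq> {..<N}"
    and IH1: "\<And>\<rho>. lookup (jmon N a) \<rho> \<noteq> 0 \<Longrightarrow>
        supp \<rho> \<subseteq> {..<N} \<and> card (supp \<rho>) \<le> mwt a \<and> sum_mset (rtype \<rho>) \<le> monomial_degree a"
    and IH3: "\<And>\<rho>. card (supp \<rho>) = mwt a \<Longrightarrow>
        lookup (jmon N a) \<rho> = (if expo \<rho> = a then 1 else 0)"
  shows "(\<forall>\<sigma>. lookup (jmon N a * JM N ^ b) \<sigma> \<noteq> 0 \<longrightarrow>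
        supp \<sigma> \<subseteq> {..<Suc N} \<and> card (supp \<sigma>) \<le> mwt (a + single N b) \<and>
        sum_mset (rtype \<sigma>) \<le> monomial_degree (a + single N b)) \<and>
     (\<forall>\<sigma>. 0 < b \<longrightarrow> lookup (jmon N a * JM N ^ b) \<sigma> \<noteq> 0 \<longrightarrow> act \<sigma> N = N \<longrightarrow>
        card (supp \<sigma>) + 2 \<le> mwt (a + single N b)) \<and>
     (\<forall>\<sigma>. card (supp \<sigma>) = mwt (a + single N b) \<longrightarrow>
        lookup (jmon N a * JM N ^ b) \<sigma> =
          (if expo \<sigma> = a + single N b then 1 else 0))"
proof (induction b)
  case 0
  then show ?case using IH1 IH3 by fastforce
next
  case (Suc b)
  define x where "x = jmon N a * JM N ^ b"
  define c where "c = a + single N b"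
  define d where "d = a + single N (Suc b)"
  have Na: "N \<notin> keys a" using N by auto
  have d: "d = c + single N 1"
    by (simp add: c_def d_def add.assoc single_add[symmetric])
  have wd: "mwt d = (if b = 0 then mwt c + 2 else mwt c + 1)"
    by (simp add: c_def d_def mwt_add_single[OF Na])
  have dd: "monomial_degree d = Suc (monomial_degree c)"
    by (simp add: d monomial_degree_add)
  have c1: "supp \<rho> \<subseteq> {..<Suc N}" "card (supp \<rho>) \<le> mwt c" "sum_mset (rtype \<rho>) \<le> monomial_degree c"
    if "lookup x \<rho> \<noteq> 0" for \<rho>
    using Suc.IH that by (auto simp: x_def c_def)
  have c0: "act \<rho> N = N" if "lookup x \<rho> \<noteq> 0" "b = 0" for \<rho>
    using IH1[of \<rho>] that by (auto simp: x_def in_supp subset_iff)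
  have c2: "card (supp \<rho>) + 2 \<le> mwt c"
    if "lookup x \<rho> \<noteq> 0" "0 < b" "act \<rho> N = N" for \<rho>
    using Suc.IH that by (auto simp: x_def c_def)
  have c3: "lookup x \<rho> = (if expo \<rho> = c then 1 else 0)" if "card (supp \<rho>) = mwt c" for \<rho>
    using Suc.IH that by (auto simp: x_def c_def)
  have y: "jmon N a * JM N ^ Suc b = x * JM N"
    by (simp add: x_def mult.assoc power_commutes)
  have supp2: "supp \<sigma> \<subseteq> insert k (insert N (supp \<rho>))" "card (supp \<sigma>) \<le> card (supp \<rho>) + 2"
    if "\<sigma> = \<rho> + tr k N" "k \<in> {1..<N}" for \<sigma> \<rho> k
  proof -
    show *: "supp \<sigma> \<subseteq> insert k (insert N (supp \<rho>))"
      unfolding that(1) using supp_plus_tr[of k N \<rho>] that(2) by auto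
    have "card (supp \<sigma>) \<le> card (insert k (insert N (supp \<rho>)))" by (rule card_mono[OF _ *]) simp
    also have "\<dots> \<le> card (supp \<rho>) + 2" by (simp add: card_insert_if)
    finally show "card (supp \<sigma>) \<le> card (supp \<rho>) + 2" .
  qed
  have supp1: "card (supp \<sigma>) \<le> card (insert k (supp \<rho>))"
    if "\<sigma> = \<rho> + tr k N" "k \<in> {1..<N}" "act \<rho> N \<noteq> N" for \<sigma> \<rho> k
    using supp2(1)[OF that(1,2)] that(3) by (intro card_mono) (auto simp: in_supp)
  have nz: "\<exists>k\<in>{1..<N}. lookup x (\<sigma> + tr k N) \<noteq> 0 \<and> \<sigma> = (\<sigma> + tr k N) + tr k N"
    if "lookup (x * JM N) \<sigma> \<noteq> 0" for \<sigma>
  proof -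
    from that obtain k where k: "k \<in> {1..<N}" "lookup x (\<sigma> + tr k N) \<noteq> 0"
      unfolding lookup_mult_JM by (meson sum.not_neutral_contains_not_neutral)
    then show ?thesis by (intro bexI[of _ k]) (auto simp del: add_tr_tr intro: add_tr_tr[symmetric])
  qed
  have P1: "supp \<sigma> \<subseteq> {..<Suc N} \<and> card (supp \<sigma>) \<le> mwt d \<and> sum_mset (rtype \<sigma>) \<le> monomial_degree d"
    if \<sigma>: "lookup (x * JM N) \<sigma> \<noteq> 0" for \<sigma>
  proof -
    from nz[OF \<sigma>] obtain k \<rho> where k: "k \<in> {1..<N}" "lookup x \<rho> \<noteq> 0" "\<sigma> = \<rho> + tr k N"
      by blast
    have "supp \<sigma> \<subseteq> {..<Suc N}" using supp2(1)[OF k(3,1)] c1(1)[OF k(2)] k(1) by fastforce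
    moreover have "sum_mset (rtype \<sigma>) \<le> monomial_degree d"
      using rank_plus_tr_le[of k N \<rho>] c1(3)[OF k(2)] k(1) by (simp add: k(3) dd)
    moreover have "card (supp \<sigma>) \<le> mwt d"
    proof (cases "b = 0")
      case True
      then show ?thesis using supp2(2)[OF k(3,1)] c1(2)[OF k(2)] wd by simp
    next
      case b: False
      show ?thesis
      proof (cases "act \<rho> N = N")
        case True
        then show ?thesis using supp2(2)[OF k(3,1)] c2[OF k(2)] wd b by simp
      next
        case False
        have "card (insert k (supp \<rho>)) \<le> Suc (card (supp \<rho>))" by (simp add: card_insert_if)
        then show ?thesis using supp1[OF k(3,1) False] c1(2)[OF k(2)] wd b by simp
      qed
    qed
    ultimately show ?thesis by simp
  qed
  have P2: "card (supp \<sigma>) + 2 \<le> mwt d"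
    if \<sigma>: "lookup (x * JM N) \<sigma> \<noteq> 0" and fixed: "act \<sigma> N = N" for \<sigma>
  proof -
    from nz[OF \<sigma>] obtain k where k: "k \<in> {1..<N}" "lookup x (\<sigma> + tr k N) \<noteq> 0" by blast
    define \<rho> where "\<rho> = \<sigma> + tr k N"
    have \<rho>k: "act \<rho> k = N" using k(1) fixed by (simp add: \<rho>_def act_tr)
    then have \<rho>N: "act \<rho> N \<noteq> N" using k(1) by (metis act_eq_iff atLeastLessThan_iff less_irrefl)
    then have b: "0 < b" using c0[of \<rho>] k by (auto simp: \<rho>_def)
    have "supp \<sigma> \<subseteq> supp \<rho> - {N}"
    proof
      fix z assume z: "z \<in> supp \<sigma>"
      then have "z \<noteq> N" using fixed by (auto simp: in_supp)
      moreover have "z \<in> supp \<rho>"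
        using z \<rho>k k(1) \<open>z \<noteq> N\<close> by (cases "z = k") (auto simp: in_supp \<rho>_def act_tr)
      ultimately show "z \<in> supp \<rho> - {N}" by simp
    qed
    then have "card (supp \<sigma>) \<le> card (supp \<rho> - {N})" by (intro card_mono) auto
    moreover have "N \<in> supp \<rho>" using \<rho>N by (simp add: in_supp)
    then have "Suc (card (supp \<rho> - {N})) = card (supp \<rho>)" by (metis card_Suc_Diff1 finite_supp)
    ultimately have "card (supp \<sigma>) + 1 \<le> mwt c" using c1(2)[of \<rho>] k by (simp add: \<rho>_def)
    then show ?thesis using wd b by simp
  qed
  have P3: "lookup (x * JM N) \<sigma> = (if expo \<sigma> = d then 1 else 0)"
    if full: "card (supp \<sigma>) = mwt d" for \<sigma>
  proof -
    \<comment> \<open>A summand \<open>(k N)\<close> can only contribute if \<open>k\<close> is a new point of the support.  It is then the image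
      of \<open>N\<close> under \<open>\<sigma>\<close>, so that there is at most one such summand.\<close>
    have A: "act \<sigma> N = k \<and> expo \<sigma> = d"
      if k: "k \<in> {1..<N}" and z: "lookup x (\<sigma> + tr k N) \<noteq> 0" for k
    proof -
      define \<rho> where "\<rho> = \<sigma> + tr k N"
      have \<sigma>: "\<sigma> = \<rho> + tr k N" using k by (simp add: \<rho>_def)
      have z: "lookup x \<rho> \<noteq> 0" using z by (simp add: \<rho>_def)
      have "k \<notin> supp \<rho> \<and> card (supp \<rho>) = mwt c"
      proof (cases "b = 0")
        case True
        have "card (supp \<sigma>) \<le> card (insert k (insert N (supp \<rho>)))"
          by (rule card_mono[OF _ supp2(1)[OF \<sigma> k]]) simp
        then show ?thesis using full wd True c1(2)[OF z] by (auto simp: card_insert_if split: if_splits)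
      next
        case False
        have "act \<rho> N \<noteq> N"
        proof
          assume "act \<rho> N = N"
          then show False using c2[OF z] False full wd supp2(2)[OF \<sigma> k] by simp
        qed
        then show ?thesis using supp1[OF \<sigma> k] full wd False c1(2)[OF z]
          by (auto simp: card_insert_if split: if_splits)
      qed
      then have k': "act \<rho> k = k" and w: "card (supp \<rho>) = mwt c" by (auto simp: in_supp)
      have e: "expo \<rho> = c" using c3[OF w] z by (simp split: if_splits)
      have "supp \<rho> \<subseteq> {1..N}" using c1(1)[OF z] by (metis atLeastAtMost_iff lessThan_iff less_Suc_eq_le
            not_less_eq_eq One_nat_def le_zero_eq subset_iff zero_notin_supp)
      then have "expo \<sigma> = d" unfolding \<sigma> d e[symmetric] using k k' by (intro expo_insert) auto
      moreover have "act \<sigma> N = k" using k k' by (simp add: \<sigma> act_tr)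
      ultimately show ?thesis by simp
    qed
    show ?thesis
    proof (cases "expo \<sigma> = d")
      case False
      then have "lookup (x * JM N) \<sigma> = 0"
        unfolding lookup_mult_JM using A by (intro sum.neutral) blast
      then show ?thesis using False by simp
    next
      case True
      \<comment> \<open>Conversely, \<open>N\<close> is the largest point of a nontrivial cycle of \<open>\<sigma>\<close>; removing the image of \<open>N\<close>
        from this cycle gives the contributing term.\<close>
      define k where "k = act \<sigma> N"
      define \<rho> where "\<rho> = \<sigma> + tr k N"
      have "lookup (expo \<sigma>) N \<noteq> 0" by (simp add: True d lookup_add)
      then have "N \<in> keys (expo \<sigma>)" by (simp add: in_keys_iff)
      then have N': "N \<in> supp \<sigma>" "Max (cyc \<sigma> N) = N" by (auto simp: keys_expo)
      have "k \<in> cyc \<sigma> N" unfolding k_def by simp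
      then have "k \<le> N" using N'(2) by (metis Max_ge finite_cyc)
      moreover have "k \<noteq> N" using N'(1) by (simp add: in_supp k_def)
      moreover have "N \<noteq> 0" using N'(1) by (metis zero_notin_supp)
      then have "k \<noteq> 0" unfolding k_def using act_pos[of \<sigma> N] by simp
      ultimately have k: "k \<in> {1..<N}" by auto
      have \<sigma>: "\<sigma> = \<rho> + tr k N" using k by (simp add: \<rho>_def)
      have \<rho>k: "act \<rho> k = k" using k by (simp add: \<rho>_def act_tr k_def)
      have "keys c \<subseteq> {..N}"
        using keys_add[of a "single N b"] N unfolding c_def
        by (auto split: if_splits)
      moreover have "keys d \<subseteq> keys c \<union> {N}"
        unfolding d using keys_add[of c "single N 1"] by auto
      ultimately have "supp \<sigma> \<subseteq> {1..N}" by (intro expo_keys_bound) (use True in auto)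
      then have "supp \<rho> \<subseteq> {1..N}" using supp_plus_tr[of k N \<sigma>] k by (auto simp: \<rho>_def)
      then have "expo \<sigma> = expo \<rho> + single N 1"
        unfolding \<sigma> using k \<rho>k by (intro expo_insert) auto
      then have "expo \<rho> = c" using True d by simp
      then have one: "lookup x \<rho> = 1" using c3[of \<rho>] by (simp add: card_supp_expo)
      have "lookup (x * JM N) \<sigma> = (\<Sum>j\<in>{k}. lookup x (\<sigma> + tr j N))"
        unfolding lookup_mult_JM using k A k_def by (intro sum.mono_neutral_right) auto
      then show ?thesis using one True by (simp add: \<rho>_def)
    qed
  qed
  show ?case unfolding y d_def[symmetric] using P1 P2 P3 by blast
qed

text \<open>Induction on the number of variables; \<open>jmon_step\<close> brings in the powers of one further variable, whose
  index is larger than every point moved so far.\<close>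

lemma jmon_leading:
  assumes "keys a \<subseteq> {..<N}"
  shows "(\<forall>\<rho>. lookup (jmon N a) \<rho> \<noteq> 0 \<longrightarrow>
        supp \<rho> \<subseteq> {..<N} \<and> card (supp \<rho>) \<le> mwt a \<and> sum_mset (rtype \<rho>) \<le> monomial_degree a) \<and>
      (\<forall>\<rho>. card (supp \<rho>) = mwt a \<longrightarrow>
        lookup (jmon N a) \<rho> = (if expo \<rho> = a then 1 else 0))"
  using assms
proof (induction N arbitrary: a)
  case 0
  then have a: "a = 0" by simp
  have e0: "expo 0 = 0" by (rule poly_mapping_eqI) (simp add: lookup_expo cyc_fixed)
  have "rtype 0 = {#}" by (simp add: rtype_def e0 mon_type_def)
  moreover have "expo \<rho> = 0 \<longleftrightarrow> \<rho> = 0" for \<rho>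
    using card_supp_expo[of \<rho>] e0 supp_eq_empty[of \<rho>] by (auto simp: mwt_def)
  ultimately show ?case
    by (auto simp: a mwt_def lookup_one when_def supp_eq_empty split: if_splits)
next
  case (Suc N)
  define b where "b = lookup a N"
  define a' where "a' = a - single N b"
  have la: "lookup a' i = (if i = N then 0 else lookup a i)" for i
    by (simp add: a'_def lookup_minus lookup_single b_def when_def)
  have a: "a = a' + single N b"
  proof (rule poly_mapping_eqI)
    fix i
    show "lookup a i = lookup (a' + single N b) i"
      unfolding lookup_add la lookup_single by (cases "i = N") (auto simp: b_def)
  qed
  have ka: "keys a' \<subseteq> {..<N}"
  proof
    fix i assume "i \<in> keys a'"
    then have "i \<noteq> N" "i \<in> keys a" unfolding in_keys_iff la by (auto split: if_splits)
    then have "i \<in> {..<Suc N}" using Suc.prems by blast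
    then show "i \<in> {..<N}" using \<open>i \<noteq> N\<close> by simp
  qed
  have j: "jmon (Suc N) a = jmon N a' * JM N ^ b"
    using jmon_cong[of N a a'] by (simp add: la b_def)
  show ?case unfolding j using jmon_step[OF ka, of b] Suc.IH[OF ka] unfolding a[symmetric] by blast
qed

lemmas jmon_supp = jmon_leading[THEN conjunct1, rule_format]
lemmas jmon_top = jmon_leading[THEN conjunct2, rule_format]

section \<open>Elementary symmetric functions of the Jucys-Murphy elements\<close>

definition ind :: "nat set \<Rightarrow> (nat \<Rightarrow>\<^sub>0 nat)" where "ind S = (\<Sum>i\<in>S. single i 1)"

lemma lookup_ind: "finite S \<Longrightarrow> lookup (ind S) i = (if i \<in> S then 1 else 0)"
  by (simp add: ind_def lookup_sum lookup_single when_def)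

lemma keys_ind: "finite S \<Longrightarrow> keys (ind S) = S"
  by (auto simp: in_keys_iff lookup_ind split: if_splits)

definition JM_elem :: "nat \<Rightarrow> nat \<Rightarrow> gring"
  where "JM_elem N k = (\<Sum>S | S \<subseteq> {..<N} \<and> card S = k. jmon N (ind S))"

lemma jmon_ind_Suc:
  assumes "S \<subseteq> {..<N}"
  shows "jmon (Suc N) (ind S) = jmon N (ind S)" "jmon (Suc N) (ind (insert N S)) = jmon N (ind S) * JM N"
proof -
  have f: "finite S" using assms finite_subset by blast
  show "jmon (Suc N) (ind S) = jmon N (ind S)" using assms f by (auto simp: lookup_ind)
  show "jmon (Suc N) (ind (insert N S)) = jmon N (ind S) * JM N"
    using jmon_cong[of N "ind (insert N S)" "ind S"] f by (simp add: lookup_ind)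
qed

lemma JM_elem_Suc: "JM_elem (Suc N) (Suc k) = JM_elem N (Suc k) + JM_elem N k * JM N"
proof -
  let ?S = "{S. S \<subseteq> {..<Suc N} \<and> card S = Suc k}"
  let ?A = "{S. S \<subseteq> {..<N} \<and> card S = Suc k}" and ?B = "{S. S \<subseteq> {..<N} \<and> card S = k}"
  have S: "?S = ?A \<union> insert N ` ?B"
  proof (intro equalityI subsetI)
    fix S assume S: "S \<in> ?S"
    then have fin: "finite S" using finite_subset by blast
    show "S \<in> ?A \<union> insert N ` ?B"
    proof (cases "N \<in> S")
      case True
      then have "S - {N} \<in> ?B" "S = insert N (S - {N})" using S fin by (auto simp: less_Suc_eq)
      then show ?thesis by blast
    next
      case False
      then show ?thesis using S by (auto simp: less_Suc_eq)
    qed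
  next
    fix S assume "S \<in> ?A \<union> insert N ` ?B"
    moreover have "card (insert N T) = Suc (card T)" if "T \<subseteq> {..<N}" for T
      using that by (subst card_insert_disjoint) (auto intro: finite_subset)
    ultimately show "S \<in> ?S" by auto
  qed
  have fin: "finite ?A" "finite ?B" by (auto intro: finite_subset[of _ "Pow {..<N}"])
  have inj: "inj_on (insert N) ?B" by (rule inj_onI) (auto simp: subset_iff; blast)
  have "JM_elem (Suc N) (Suc k) = (\<Sum>S\<in>?A. jmon (Suc N) (ind S)) + (\<Sum>S\<in>insert N ` ?B. jmon (Suc N) (ind S))"
    unfolding JM_elem_def S using fin by (intro sum.union_disjoint) auto
  also have "(\<Sum>S\<in>insert N ` ?B. jmon (Suc N) (ind S)) = (\<Sum>S\<in>?B. jmon (Suc N) (ind (insert N S)))"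
    using inj by (simp add: sum.reindex)
  also have "\<dots> = JM_elem N k * JM N"
    unfolding JM_elem_def sum_distrib_right by (rule sum.cong) (auto simp: jmon_ind_Suc simp del: jmon.simps)
  also have "(\<Sum>S\<in>?A. jmon (Suc N) (ind S)) = JM_elem N (Suc k)"
    unfolding JM_elem_def by (rule sum.cong) (auto simp: jmon_ind_Suc simp del: jmon.simps)
  finally show ?thesis .
qed

lemma jmon_0 [simp]: "jmon N 0 = 1" by (induction N) simp_all

lemma JM_elem_0 [simp]: "JM_elem N 0 = 1"
proof -
  have "{S. S \<subseteq> {..<N} \<and> card S = 0} = {{}}" by (auto dest: finite_subset)
  then show ?thesis by (simp add: JM_elem_def ind_def)
qed

lemma rtype_eq_empty: "rtype \<sigma> = {#} \<longleftrightarrow> \<sigma> = 0"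
proof -
  have "rtype \<sigma> = {#} \<longleftrightarrow> supp \<sigma> = {}"
    unfolding rtype_cycles by (simp add: mset_set_empty_iff)
  then show ?thesis unfolding supp_eq_empty .
qed

lemma partition_sum_0: "\<mu> \<in> partitions \<Longrightarrow> sum_mset \<mu> = 0 \<longleftrightarrow> \<mu> = {#}"
  unfolding partitions_def by (cases \<mu>) simp_all

lemma rank_eq_0: "sum_mset (rtype \<sigma>) = 0 \<longleftrightarrow> \<sigma> = 0"
  unfolding partition_sum_0[OF rtype_partition] rtype_eq_empty ..

text \<open>Jucys' theorem.  A permutation that moves \<open>N\<close> is uniquely a permutation fixing \<open>N\<close> times a
  transposition \<open>(j N)\<close>, and this factor raises the rank by one; the recursion \<open>JM_elem_Suc\<close> splits the
  terms in the same way.\<close>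

theorem lookup_JM_elem:
  "lookup (JM_elem N k) \<sigma> = (if supp \<sigma> \<subseteq> {..<N} \<and> sum_mset (rtype \<sigma>) = k then 1 else 0)"
proof (induction N arbitrary: k \<sigma>)
  case 0
  show ?case
  proof (cases k)
    case 0
    then show ?thesis by (simp add: lookup_one when_def supp_eq_empty rank_eq_0 del: sum_mset_0_iff)
  next
    case (Suc k)
    have "sum_mset (rtype \<sigma>) = 0" if "supp \<sigma> = {}" using that unfolding supp_eq_empty rank_eq_0 .
    moreover have "JM_elem 0 (Suc k) = 0"
      unfolding JM_elem_def by (rule sum.neutral) auto
    ultimately show ?thesis using Suc by (auto simp del: sum_mset_0_iff)
  qed
next
  case (Suc N)
  show ?case
  proof (cases k)
    case 0
    have "supp 0 \<subseteq> {..<Suc N}" by simp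
    with 0 show ?thesis by (auto simp: lookup_one when_def rank_eq_0 simp del: sum_mset_0_iff)
  next
    case k: (Suc k')
    have "lookup (JM_elem (Suc N) k) \<sigma> = lookup (JM_elem N k) \<sigma> +
        (\<Sum>j\<in>{1..<N}. lookup (JM_elem N k') (\<sigma> + tr j N))"
      by (simp add: k JM_elem_Suc lookup_add lookup_mult_JM)
    also have "\<dots> = (if supp \<sigma> \<subseteq> {..<Suc N} \<and> sum_mset (rtype \<sigma>) = k then 1 else 0)"
    proof (cases "act \<sigma> N = N")
      case True
      have "\<not> supp (\<sigma> + tr j N) \<subseteq> {..<N}" if "j \<in> {1..<N}" for j
      proof -
        have "act (\<sigma> + tr j N) j = N" using that True by (simp add: act_tr)
        then have "act (\<sigma> + tr j N) N \<noteq> N" using that by (metis act_eq_iff atLeastLessThan_iff less_irrefl)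
        then have "N \<in> supp (\<sigma> + tr j N)" unfolding in_supp .
        then show ?thesis by blast
      qed
      then have "(\<Sum>j\<in>{1..<N}. lookup (JM_elem N k') (\<sigma> + tr j N)) = 0"
        by (intro sum.neutral) (auto simp: Suc.IH)
      moreover have "supp \<sigma> \<subseteq> {..<N} \<longleftrightarrow> supp \<sigma> \<subseteq> {..<Suc N}"
        using True by (auto simp: in_supp less_Suc_eq subset_iff)
      ultimately show ?thesis by (simp add: Suc.IH)
    next
      case False
      then have N: "N \<in> supp \<sigma>" by (simp add: in_supp)
      define j where "j = act (- \<sigma>) N"
      define \<rho> where "\<rho> = \<sigma> + tr j N"
      have \<sigma>j: "act \<sigma> j = N" by (simp add: j_def)
      have "j \<noteq> N" using False \<sigma>j by auto
      have "0 < N" using N zero_notin_supp by (metis gr0I)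
      then have "0 < j" by (simp add: j_def)
      have \<sigma>: "\<sigma> = \<rho> + tr N j" using \<open>0 < N\<close> \<open>0 < j\<close> by (simp add: \<rho>_def tr_commute[of N j])
      have \<rho>N: "act \<rho> N = N" using \<open>0 < N\<close> \<open>0 < j\<close> \<sigma>j by (simp add: \<rho>_def act_tr)
      have rank: "sum_mset (rtype \<sigma>) = Suc (sum_mset (rtype \<rho>))"
        unfolding \<sigma> using \<rho>N \<open>j \<noteq> N\<close> \<open>0 < N\<close> \<open>0 < j\<close> by (intro rank_insert) auto
      have supp: "supp \<sigma> = insert N (insert j (supp \<rho>))"
        unfolding \<sigma> using \<rho>N \<open>j \<noteq> N\<close> \<open>0 < N\<close> \<open>0 < j\<close> by (intro supp_insert) auto
      have only: "lookup (JM_elem N k') (\<sigma> + tr i N) = 0" if "i \<in> {1..<N}" "i \<noteq> j" for i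
      proof -
        have "act (\<sigma> + tr i N) N \<noteq> N" using that \<open>0 < N\<close> \<sigma>j by (simp add: act_tr) (metis act_eq_iff)
        then have "N \<in> supp (\<sigma> + tr i N)" unfolding in_supp .
        then show ?thesis by (auto simp: Suc.IH)
      qed
      have "(\<Sum>i\<in>{1..<N}. lookup (JM_elem N k') (\<sigma> + tr i N)) =
          (if j < N then lookup (JM_elem N k') \<rho> else 0)"
      proof (cases "j < N")
        case True
        then have "(\<Sum>i\<in>{1..<N}. lookup (JM_elem N k') (\<sigma> + tr i N)) =
            (\<Sum>i\<in>{j}. lookup (JM_elem N k') (\<sigma> + tr i N))"
          using \<open>0 < j\<close> only by (intro sum.mono_neutral_right) auto
        then show ?thesis using True by (simp add: \<rho>_def)
      next
        case False
        then show ?thesis using only by (auto intro!: sum.neutral)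
      qed
      moreover have "supp \<sigma> \<subseteq> {..<Suc N} \<longleftrightarrow> j < N \<and> supp \<rho> \<subseteq> {..<N}"
      proof -
        have "N \<notin> supp \<rho>" using \<rho>N by (simp add: in_supp)
        then have "supp \<rho> \<subseteq> {..<Suc N} \<longleftrightarrow> supp \<rho> \<subseteq> {..<N}" by (auto simp: less_Suc_eq subset_iff)
        then show ?thesis using \<open>j \<noteq> N\<close> by (auto simp: supp less_Suc_eq)
      qed
      moreover have "\<not> supp \<sigma> \<subseteq> {..<N}" using N by auto
      ultimately show ?thesis by (simp add: Suc.IH rank k)
    qed
    finally show ?thesis .
  qed
qed

section \<open>Class sums and structure constants\<close>

definition perms :: "nat \<Rightarrow> fperm set" where "perms n = {\<sigma>. supp \<sigma> \<subseteq> {1..n}}"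

lemma inj_act: "inj act" by (simp add: act_inject inj_on_def)

lemma act_image_perms: "act ` perms n = {p. p permutes {1..n}}"
proof (intro equalityI subsetI)
  fix p assume p: "p \<in> {p. p permutes {1..n}}"
  then obtain \<sigma> where "act \<sigma> = p" using ex_fperm[of p "{1..n}"] by auto
  then show "p \<in> act ` perms n" using p by (auto simp: perms_def simp flip: permutes_iff_supp)
qed (auto simp: perms_def permutes_iff_supp)

lemma finite_perms [simp]: "finite (perms n)"
proof -
  have "finite (act ` perms n)" unfolding act_image_perms by (rule finite_permutations) simp
  then show ?thesis using inj_act by (metis finite_imageD inj_on_subset subset_UNIV)
qed

lemma perms_plus: "\<sigma> \<in> perms n \<Longrightarrow> \<tau> \<in> perms n \<Longrightarrow> \<sigma> + \<tau> \<in> perms n"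
  using supp_plus[of \<sigma> \<tau>] by (auto simp: perms_def)

definition csum :: "nat \<Rightarrow> nat multiset \<Rightarrow> gring"
  where "csum n \<mu> = (\<Sum>\<sigma> | \<sigma> \<in> perms n \<and> rtype \<sigma> = \<mu>. frag_of \<sigma>)"

lemma lookup_csum:
  "lookup (csum n \<mu>) \<sigma> = (if \<sigma> \<in> perms n \<and> rtype \<sigma> = \<mu> then 1 else 0)"
proof -
  have "finite {\<sigma>. \<sigma> \<in> perms n \<and> rtype \<sigma> = \<mu>}" by simp
  then show ?thesis by (simp add: csum_def lookup_sum)
qed

text \<open>Factorisations of \<open>\<sigma>\<close> sorted by the set \<open>T\<close> of points that are moved by a factor but not by \<open>\<sigma>\<close>.\<close>

definition splittings :: "nat multiset \<Rightarrow> nat multiset \<Rightarrow> fperm \<Rightarrow> nat set \<Rightarrow> (fperm \<times> fperm) set"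
  where "splittings \<mu> \<nu> \<sigma> T = {(\<alpha>, \<beta>). rtype \<alpha> = \<mu> \<and> rtype \<beta> = \<nu> \<and> \<alpha> + \<beta> = \<sigma> \<and>
    supp \<alpha> \<union> supp \<beta> = supp \<sigma> \<union> T}"

lemma card_splittings_conj:
  assumes "act \<pi> ` T = U"
  shows "card (splittings \<mu> \<nu> \<sigma> T) = card (splittings \<mu> \<nu> (\<pi> + \<sigma> - \<pi>) U)"
proof (rule bij_betw_same_card)
  let ?c = "\<lambda>\<pi> (\<alpha>, \<beta>). (\<pi> + \<alpha> - \<pi>, \<pi> + \<beta> - \<pi> :: fperm)"
  have conj_plus: "(\<pi> + \<alpha> - \<pi>) + (\<pi> + \<beta> - \<pi>) = \<pi> + (\<alpha> + \<beta>) - \<pi>" for \<pi> \<alpha> \<beta> :: fperm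
    by (simp add: add.assoc diff_conv_add_uminus del: add_uminus_conv_diff)
  have conj_inv: "- \<pi> + (\<pi> + \<alpha> - \<pi>) - (- \<pi>) = \<alpha>" "\<pi> + (- \<pi> + \<alpha> - (- \<pi>)) - \<pi> = \<alpha>" for \<pi> \<alpha> :: fperm
    by (simp_all add: add.assoc diff_conv_add_uminus del: add_uminus_conv_diff)
  have into: "?c \<pi> ` splittings \<mu> \<nu> \<sigma> T \<subseteq> splittings \<mu> \<nu> (\<pi> + \<sigma> - \<pi>) (act \<pi> ` T)" for \<pi> \<sigma> T
  proof
    fix q assume "q \<in> ?c \<pi> ` splittings \<mu> \<nu> \<sigma> T"
    then obtain \<alpha> \<beta> where ab: "(\<alpha>, \<beta>) \<in> splittings \<mu> \<nu> \<sigma> T" "q = (\<pi> + \<alpha> - \<pi>, \<pi> + \<beta> - \<pi>)"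
      by auto
    then have "act \<pi> ` supp \<alpha> \<union> act \<pi> ` supp \<beta> = act \<pi> ` supp \<sigma> \<union> act \<pi> ` T"
      unfolding splittings_def image_Un[symmetric] by auto
    then show "q \<in> splittings \<mu> \<nu> (\<pi> + \<sigma> - \<pi>) (act \<pi> ` T)"
      using ab by (simp add: splittings_def rtype_conj supp_conj conj_plus)
  qed
  have U: "act (- \<pi>) ` U = T" using assms by (auto simp: image_image)
  show "bij_betw (?c \<pi>) (splittings \<mu> \<nu> \<sigma> T) (splittings \<mu> \<nu> (\<pi> + \<sigma> - \<pi>) U)"
  proof (rule bij_betw_byWitness[where f' = "?c (- \<pi>)"])
    show "?c \<pi> ` splittings \<mu> \<nu> \<sigma> T \<subseteq> splittings \<mu> \<nu> (\<pi> + \<sigma> - \<pi>) U"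
      using into[of \<pi> \<sigma> T] assms by simp
    show "?c (- \<pi>) ` splittings \<mu> \<nu> (\<pi> + \<sigma> - \<pi>) U \<subseteq> splittings \<mu> \<nu> \<sigma> T"
      using into[of "- \<pi>" "\<pi> + \<sigma> - \<pi>" U] unfolding conj_inv U .
  qed (intro ballI; clarify; simp only: case_prod_conv conj_inv)+
qed

text \<open>Any two permutations of the same type, together with sets of the same size off their supports, are
  conjugate, so that this number is independent of the choice.\<close>

definition splitting_number :: "nat multiset \<Rightarrow> nat multiset \<Rightarrow> nat multiset \<Rightarrow> nat \<Rightarrow> nat"
  where "splitting_number \<mu> \<nu> \<kappa> j = (SOME c. \<exists>\<sigma> T. rtype \<sigma> = \<kappa> \<and> finite T \<and> 0 \<notin> T \<and>
    T \<inter> supp \<sigma> = {} \<and> card T = j \<and> c = card (splittings \<mu> \<nu> \<sigma> T))"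

lemma splitting_number_eq:
  assumes "finite T" "0 \<notin> T" "T \<inter> supp \<sigma> = {}"
  shows "splitting_number \<mu> \<nu> (rtype \<sigma>) (card T) = card (splittings \<mu> \<nu> \<sigma> T)"
proof -
  have "\<exists>c \<sigma>' T'. rtype \<sigma>' = rtype \<sigma> \<and> finite T' \<and> 0 \<notin> T' \<and> T' \<inter> supp \<sigma>' = {} \<and>
      card T' = card T \<and> c = card (splittings \<mu> \<nu> \<sigma>' T')"
    using assms by blast
  from someI_ex[OF this] obtain \<sigma>' T' where *: "rtype \<sigma>' = rtype \<sigma>" "finite T'" "0 \<notin> T'"
      "T' \<inter> supp \<sigma>' = {}" "card T' = card T"
      "splitting_number \<mu> \<nu> (rtype \<sigma>) (card T) = card (splittings \<mu> \<nu> \<sigma>' T')"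
    unfolding splitting_number_def by blast
  obtain \<pi> where "\<sigma> = \<pi> + \<sigma>' - \<pi>" "act \<pi> ` T' = T"
    using same_type_conjugate[OF *(1,2) assms(1) *(5,3) assms(2) *(4) assms(3)] by blast
  then show ?thesis using card_splittings_conj[of \<pi> T' T \<mu> \<nu> \<sigma>'] *(6) by simp
qed

text \<open>Every point of \<open>T\<close> is moved by one of the factors.  This makes the sum below finite independently of
  \<open>n\<close>, and leaves only finitely many types in a product.\<close>

lemma splittings_bound:
  assumes "finite T" "T \<inter> supp \<sigma> = {}" "splittings \<mu> \<nu> \<sigma> T \<noteq> {}"
  shows "card (supp \<sigma>) + card T \<le> wt \<mu> + wt \<nu>"
proof -
  obtain \<alpha> \<beta> where ab: "rtype \<alpha> = \<mu>" "rtype \<beta> = \<nu>" "supp \<alpha> \<union> supp \<beta> = supp \<sigma> \<union> T"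
    using assms(3) by (auto simp: splittings_def)
  have "card (supp \<sigma>) + card T = card (supp \<sigma> \<union> T)"
    using assms by (subst card_Un_disjoint) auto
  also have "\<dots> \<le> card (supp \<alpha>) + card (supp \<beta>)" unfolding ab(3)[symmetric] by (rule card_Un_le)
  finally show ?thesis using ab by (simp add: card_supp)
qed

lemma finite_splittings: "finite T \<Longrightarrow> finite (splittings \<mu> \<nu> \<sigma> T)"
proof -
  assume T: "finite T"
  define m where "m = Max (insert 0 (supp \<sigma> \<union> T))"
  have "supp \<sigma> \<union> T \<subseteq> {..m}" using T by (auto simp: m_def)
  then have "\<alpha> \<in> perms m" if "supp \<alpha> \<subseteq> supp \<sigma> \<union> T" for \<alpha>
  proof -
    have "x \<in> {1..m}" if x: "x \<in> supp \<alpha>" for x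
    proof -
      have "x \<noteq> 0" using x by (metis zero_notin_supp)
      moreover have "x \<le> m" using x \<open>supp \<alpha> \<subseteq> supp \<sigma> \<union> T\<close> \<open>supp \<sigma> \<union> T \<subseteq> {..m}\<close> by blast
      ultimately show ?thesis by simp
    qed
    then show ?thesis by (auto simp only: perms_def)
  qed
  then have "splittings \<mu> \<nu> \<sigma> T \<subseteq> perms m \<times> perms m" by (auto simp: splittings_def)
  then show ?thesis by (rule finite_subset) simp
qed

text \<open>The binomial coefficient counts the sets \<open>T\<close> of size \<open>j\<close> in \<open>{1..n}\<close> off the support of \<open>\<sigma>\<close>.\<close>

lemma lookup_csum_mult:
  assumes \<sigma>: "\<sigma> \<in> perms n"
  shows "lookup (csum n \<mu> * csum n \<nu>) \<sigma> =
    (\<Sum>j\<le>wt \<mu> + wt \<nu>. int (splitting_number \<mu> \<nu> (rtype \<sigma>) j) * int ((n - wt (rtype \<sigma>)) choose j))"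
proof -
  let ?P = "\<lambda>\<mu>. {\<alpha>. \<alpha> \<in> perms n \<and> rtype \<alpha> = \<mu>}"
  let ?C = "{1..n} - supp \<sigma>" and ?D = "wt \<mu> + wt \<nu>"
  let ?W = "{p \<in> ?P \<mu> \<times> ?P \<nu>. fst p + snd p = \<sigma>}"
  have fin: "finite (?P \<mu> \<times> ?P \<nu>)" by simp
  have "csum n \<mu> * csum n \<nu> = (\<Sum>p\<in>?P \<mu> \<times> ?P \<nu>. frag_of (fst p + snd p))"
    by (simp add: csum_def sum_product sum.cartesian_product frag_of_mult case_prod_beta)
  then have "lookup (csum n \<mu> * csum n \<nu>) \<sigma> =
      (\<Sum>p\<in>?P \<mu> \<times> ?P \<nu>. if fst p + snd p = \<sigma> then 1 else 0)"
    by (simp add: lookup_sum eq_commute)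
  also have "\<dots> = int (card ?W)" using fin by (simp add: sum.If_cases Int_def)
  also have "?W = (\<Union>T\<in>Pow ?C. splittings \<mu> \<nu> \<sigma> T)"
  proof (intro equalityI subsetI)
    fix p assume p: "p \<in> ?W"
    define T where "T = (supp (fst p) \<union> supp (snd p)) - supp \<sigma>"
    have "supp \<sigma> \<subseteq> supp (fst p) \<union> supp (snd p)" using p supp_plus by blast
    then have "supp (fst p) \<union> supp (snd p) = supp \<sigma> \<union> T" by (auto simp: T_def)
    then have "p \<in> splittings \<mu> \<nu> \<sigma> T"
      using p unfolding splittings_def case_prod_beta mem_Collect_eq mem_Times_iff by blast
    moreover have "T \<in> Pow ?C" using p by (auto simp: T_def perms_def)
    ultimately show "p \<in> (\<Union>T\<in>Pow ?C. splittings \<mu> \<nu> \<sigma> T)" by blast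
  next
    fix p assume "p \<in> (\<Union>T\<in>Pow ?C. splittings \<mu> \<nu> \<sigma> T)"
    then obtain T where T: "T \<subseteq> ?C" "p \<in> splittings \<mu> \<nu> \<sigma> T" by blast
    have "supp \<sigma> \<union> T \<subseteq> {1..n}" using T \<sigma> by (auto simp: perms_def)
    then show "p \<in> ?W" using T by (auto simp: splittings_def perms_def)
  qed
  also have "card (\<Union>T\<in>Pow ?C. splittings \<mu> \<nu> \<sigma> T) = (\<Sum>T\<in>Pow ?C. card (splittings \<mu> \<nu> \<sigma> T))"
  proof (rule card_UN_disjoint)
    show "\<forall>T\<in>Pow ?C. finite (splittings \<mu> \<nu> \<sigma> T)"
      using finite_splittings by (metis Pow_iff finite_Diff finite_atLeastAtMost finite_subset)
    show "\<forall>T\<in>Pow ?C. \<forall>U\<in>Pow ?C. T \<noteq> U \<longrightarrow> splittings \<mu> \<nu> \<sigma> T \<inter> splittings \<mu> \<nu> \<sigma> U = {}"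
    proof (intro ballI impI equals0I)
      fix T U p assume "T \<in> Pow ?C" "U \<in> Pow ?C" "T \<noteq> U" "p \<in> splittings \<mu> \<nu> \<sigma> T \<inter> splittings \<mu> \<nu> \<sigma> U"
      then have "supp \<sigma> \<union> T = supp \<sigma> \<union> U" "T \<inter> supp \<sigma> = {}" "U \<inter> supp \<sigma> = {}"
        by (auto simp: splittings_def)
      then show False using \<open>T \<noteq> U\<close> by blast
    qed
  qed simp
  also have "\<dots> = (\<Sum>T\<in>{T \<in> Pow ?C. card T \<le> ?D}. card (splittings \<mu> \<nu> \<sigma> T))"
  proof (rule sum.mono_neutral_right)
    show "\<forall>T\<in>Pow ?C - {T \<in> Pow ?C. card T \<le> ?D}. card (splittings \<mu> \<nu> \<sigma> T) = 0"
    proof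
      fix T assume T: "T \<in> Pow ?C - {T \<in> Pow ?C. card T \<le> ?D}"
      then have "finite T" by (auto intro: finite_subset)
      then show "card (splittings \<mu> \<nu> \<sigma> T) = 0"
        using splittings_bound[of T \<sigma> \<mu> \<nu>] T by fastforce
    qed
  qed auto
  also have "{T \<in> Pow ?C. card T \<le> ?D} = (\<Union>j\<in>{..?D}. {T. T \<subseteq> ?C \<and> card T = j})" by auto
  also have "(\<Sum>T\<in>(\<Union>j\<in>{..?D}. {T. T \<subseteq> ?C \<and> card T = j}). card (splittings \<mu> \<nu> \<sigma> T)) =
      (\<Sum>j\<le>?D. \<Sum>T\<in>{T. T \<subseteq> ?C \<and> card T = j}. card (splittings \<mu> \<nu> \<sigma> T))"
    by (rule sum.UNION_disjoint) (auto intro: finite_subset[of _ "Pow ?C"])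
  also have "\<dots> = (\<Sum>j\<le>?D. splitting_number \<mu> \<nu> (rtype \<sigma>) j * (card ?C choose j))"
  proof (rule sum.cong[OF refl])
    fix j
    have "(\<Sum>T\<in>{T. T \<subseteq> ?C \<and> card T = j}. card (splittings \<mu> \<nu> \<sigma> T)) =
        (\<Sum>T\<in>{T. T \<subseteq> ?C \<and> card T = j}. splitting_number \<mu> \<nu> (rtype \<sigma>) j)"
    proof (rule sum.cong[OF refl])
      fix T assume T: "T \<in> {T. T \<subseteq> ?C \<and> card T = j}"
      then have "finite T" by (auto intro: finite_subset)
      moreover have "0 \<notin> T" "T \<inter> supp \<sigma> = {}" using T by auto
      ultimately show "card (splittings \<mu> \<nu> \<sigma> T) = splitting_number \<mu> \<nu> (rtype \<sigma>) j"
        using splitting_number_eq[of T \<sigma> \<mu> \<nu>] T by simp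
    qed
    then show "(\<Sum>T\<in>{T. T \<subseteq> ?C \<and> card T = j}. card (splittings \<mu> \<nu> \<sigma> T)) =
        splitting_number \<mu> \<nu> (rtype \<sigma>) j * (card ?C choose j)"
      by (simp add: n_subsets)
  qed
  also have "card ?C = n - wt (rtype \<sigma>)"
    using \<sigma> by (simp add: perms_def card_Diff_subset card_supp)
  finally show ?thesis by simp
qed

definition binom_poly :: "nat \<Rightarrow> nat \<Rightarrow> rat poly"
  where "binom_poly w j = Polynomial.smult (1 / fact j) (\<Prod>i = 0..<j. [:- of_nat (w + i), 1:])"

lemma poly_binom_poly: "poly (binom_poly w j) x = (x - of_nat w) gchoose j"
  by (simp add: binom_poly_def poly_prod gbinomial_prod_rev algebra_simps)

lemma gbinomial_of_int_Ints: "(of_int a :: rat) gchoose j \<in> \<int>"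
proof -
  obtain q :: int where q: "(\<Prod>i = 0..<j. a - int i) = fact j * q"
    by (rule that[OF gbinomial_int_mult_fact[symmetric]])
  have "fact j * ((of_int a :: rat) gchoose j) = (\<Prod>i = 0..<j. of_int a - of_nat i)"
    by (rule gbinomial_mult_fact)
  also have "\<dots> = of_int (\<Prod>i = 0..<j. a - int i)" by simp
  also have "\<dots> = fact j * of_int q" unfolding q by simp
  finally have "(of_int a :: rat) gchoose j = of_int q" by simp
  then show ?thesis by simp
qed

lemma int_valued_0 [simp]: "0 \<in> int_valued" and int_valued_1 [simp]: "1 \<in> int_valued"
  and int_valued_add: "p \<in> int_valued \<Longrightarrow> q \<in> int_valued \<Longrightarrow> p + q \<in> int_valued"
  and int_valued_diff: "p \<in> int_valued \<Longrightarrow> q \<in> int_valued \<Longrightarrow> p - q \<in> int_valued"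
  and int_valued_uminus: "p \<in> int_valued \<Longrightarrow> - p \<in> int_valued"
  and int_valued_mult: "p \<in> int_valued \<Longrightarrow> q \<in> int_valued \<Longrightarrow> p * q \<in> int_valued"
  and int_valued_of_nat [simp]: "of_nat k \<in> int_valued"
  and int_valued_of_int [simp]: "of_int l \<in> int_valued"
  by (auto simp: int_valued_def)

lemma int_valued_sum: "(\<And>x. x \<in> A \<Longrightarrow> f x \<in> int_valued) \<Longrightarrow> sum f A \<in> int_valued"
  by (induction A rule: infinite_finite_induct) (auto intro: int_valued_add)

lemma int_valued_binom_poly [simp]: "binom_poly w j \<in> int_valued"
  using gbinomial_of_int_Ints[of "m - int w" j for m] by (simp add: int_valued_def poly_binom_poly)

definition struct_poly :: "nat multiset \<Rightarrow> nat multiset \<Rightarrow> nat multiset \<Rightarrow> rat poly"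
  where "struct_poly \<mu> \<nu> \<kappa> =
    (\<Sum>j\<le>wt \<mu> + wt \<nu>. of_nat (splitting_number \<mu> \<nu> \<kappa> j) * binom_poly (wt \<kappa>) j)"

lemma struct_poly_int_valued: "struct_poly \<mu> \<nu> \<kappa> \<in> int_valued"
  unfolding struct_poly_def by (intro int_valued_sum int_valued_mult) auto

lemma perms_wt: "\<sigma> \<in> perms n \<Longrightarrow> wt (rtype \<sigma>) \<le> n"
  unfolding perms_def card_supp[symmetric] using card_mono[of "{1..n}" "supp \<sigma>"] by simp

lemma poly_struct_poly:
  assumes "\<sigma> \<in> perms n"
  shows "poly (struct_poly \<mu> \<nu> (rtype \<sigma>)) (of_nat n) =
    of_int (lookup (csum n \<mu> * csum n \<nu>) \<sigma>)"
proof -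
  let ?w = "wt (rtype \<sigma>)"
  have "poly (binom_poly ?w j) (of_nat n) = of_nat ((n - ?w) choose j)" for j
  proof -
    have "(of_nat n - of_nat ?w :: rat) = of_nat (n - ?w)"
      using perms_wt[OF assms] by (simp add: of_nat_diff)
    then have "(of_nat n - of_nat ?w :: rat) gchoose j = of_nat (n - ?w) gchoose j" by (rule arg_cong)
    then show ?thesis unfolding poly_binom_poly by (simp only: binomial_gbinomial)
  qed
  then show ?thesis
    unfolding lookup_csum_mult[OF assms] struct_poly_def by (simp add: poly_sum)
qed

lemma finite_partitions_wt: "finite {\<kappa> \<in> partitions. wt \<kappa> \<le> D}"
proof (rule finite_subset)
  show "{\<kappa> \<in> partitions. wt \<kappa> \<le> D} \<subseteq> mset ` {xs. set xs \<subseteq> {..D} \<and> length xs \<le> D}"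
  proof
    fix \<kappa> assume k: "\<kappa> \<in> {\<kappa> \<in> partitions. wt \<kappa> \<le> D}"
    obtain xs where xs: "\<kappa> = mset xs" by (metis ex_mset)
    have "x \<le> D" if "x \<in># \<kappa>" for x
    proof -
      have "x \<le> sum_mset \<kappa>" using that by (metis multi_member_split le_add1 sum_mset.add_mset)
      then show ?thesis using k by (simp add: wt_def)
    qed
    then show "\<kappa> \<in> mset ` {xs. set xs \<subseteq> {..D} \<and> length xs \<le> D}"
      using k xs by (auto simp: wt_def)
  qed
  show "finite (mset ` {xs. set xs \<subseteq> {..D} \<and> length xs \<le> D})"
    by (intro finite_imageI finite_lists_length_le) simp
qed

lemma struct_poly_eq_0:
  assumes "\<kappa> \<in> partitions" "wt \<mu> + wt \<nu> < wt \<kappa>"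
  shows "struct_poly \<mu> \<nu> \<kappa> = 0"
proof -
  obtain \<sigma> where \<sigma>: "rtype \<sigma> = \<kappa>" using ex_rtype[OF assms(1)] by blast
  have "splitting_number \<mu> \<nu> \<kappa> j = 0" for j
  proof -
    obtain m where m: "supp \<sigma> \<subseteq> {1..m}" using supp_bounded by blast
    let ?T = "{m + 1..m + j}"
    have T: "?T \<inter> supp \<sigma> = {}" using m by fastforce
    have "splittings \<mu> \<nu> \<sigma> ?T = {}"
      using splittings_bound[of ?T \<sigma> \<mu> \<nu>] T assms(2) by (auto simp: card_supp \<sigma>)
    then show ?thesis using splitting_number_eq[of ?T \<sigma> \<mu> \<nu>] T by (simp add: \<sigma>)
  qed
  then show ?thesis by (simp add: struct_poly_def)
qed

definition struct_map :: "nat multiset \<Rightarrow> nat multiset \<Rightarrow> (nat multiset \<Rightarrow>\<^sub>0 rat poly)"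
  where "struct_map \<mu> \<nu> = Abs_poly_mapping (\<lambda>\<kappa>. if \<kappa> \<in> partitions then struct_poly \<mu> \<nu> \<kappa> else 0)"

lemma lookup_struct_map:
  "lookup (struct_map \<mu> \<nu>) \<kappa> = (if \<kappa> \<in> partitions then struct_poly \<mu> \<nu> \<kappa> else 0)"
proof -
  have "finite {\<kappa>. (if \<kappa> \<in> partitions then struct_poly \<mu> \<nu> \<kappa> else 0) \<noteq> 0}"
  proof (rule finite_subset[OF _ finite_partitions_wt[of "wt \<mu> + wt \<nu>"]], rule subsetI)
    fix \<kappa> assume "\<kappa> \<in> {\<kappa>. (if \<kappa> \<in> partitions then struct_poly \<mu> \<nu> \<kappa> else 0) \<noteq> 0}"
    then have "\<kappa> \<in> partitions" "struct_poly \<mu> \<nu> \<kappa> \<noteq> 0" by (auto split: if_splits)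
    then show "\<kappa> \<in> {\<kappa> \<in> partitions. wt \<kappa> \<le> wt \<mu> + wt \<nu>}"
      using struct_poly_eq_0[of \<kappa> \<mu> \<nu>] by force
  qed
  then show ?thesis unfolding struct_map_def by (simp only: lookup_Abs_poly_mapping)
qed

lemma struct_map_FH: "struct_map \<mu> \<nu> \<in> FH_carrier"
  by (auto simp: FH_carrier_def lookup_struct_map in_keys_iff struct_poly_int_valued split: if_splits)

section \<open>Specialisation to the group ring of a symmetric group\<close>

definition ev :: "nat \<Rightarrow> (nat multiset \<Rightarrow>\<^sub>0 rat poly) \<Rightarrow> gring"
  where "ev n c = (\<Sum>\<kappa>\<in>keys c.
    frag_cmul \<lfloor>poly (lookup c \<kappa>) (of_nat n)\<rfloor> (csum n \<kappa>))"

lemma lookup_ev: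
  "lookup (ev n c) \<sigma> =
    (if \<sigma> \<in> perms n then \<lfloor>poly (lookup c (rtype \<sigma>)) (of_nat n)\<rfloor> else 0)"
proof -
  have "lookup (ev n c) \<sigma> = (\<Sum>\<kappa>\<in>keys c.
      if \<kappa> = rtype \<sigma> then (if \<sigma> \<in> perms n then \<lfloor>poly (lookup c (rtype \<sigma>)) (of_nat n)\<rfloor> else 0) else 0)"
    unfolding ev_def lookup_sum by (rule sum.cong) (auto simp: lookup_csum)
  then show ?thesis by (simp add: in_keys_iff)
qed

lemma int_valued_floor:
  "p \<in> int_valued \<Longrightarrow> of_int \<lfloor>poly p (of_nat n)\<rfloor> = poly p (of_nat n)"
proof -
  assume "p \<in> int_valued"
  then have "poly p (of_int (int n)) \<in> \<int>" unfolding int_valued_def by blast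
  then show ?thesis by (auto elim: Ints_cases)
qed

lemma int_valued_eqI:
  assumes iv: "p \<in> int_valued" "q \<in> int_valued"
    and eq: "\<And>n. m \<le> n \<Longrightarrow> \<lfloor>poly p (of_nat n)\<rfloor> = \<lfloor>poly q (of_nat n)\<rfloor>"
  shows "p = q"
proof -
  have "poly (p - q) (of_nat n) = 0" if "m \<le> n" for n
    using int_valued_floor[OF iv(1), of n] int_valued_floor[OF iv(2), of n] eq[OF that]
    unfolding poly_diff right_minus_eq by argo
  then have "(of_nat :: nat \<Rightarrow> rat) ` {m..} \<subseteq> {x. poly (p - q) x = 0}" by auto
  moreover have "infinite ((of_nat :: nat \<Rightarrow> rat) ` {m..})"
    using infinite_Ici by (subst finite_image_iff) (auto simp: inj_on_def)
  ultimately have "infinite {x. poly (p - q) x = 0}" using finite_subset by blast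
  then have "p - q = 0" using poly_roots_finite by blast
  then show ?thesis by simp
qed

text \<open>A permutation of type \<open>\<kappa>\<close> lies in \<open>S\<^sub>n\<close> for all large \<open>n\<close>, and its coefficients are then the values of
  the polynomial with index \<open>\<kappa>\<close>.\<close>

lemma ev_inject:
  assumes c: "c \<in> FH_carrier" "d \<in> FH_carrier" and eq: "\<And>n. ev n c = ev n d"
  shows "c = d"
proof (rule poly_mapping_eqI)
  fix \<kappa>
  show "lookup c \<kappa> = lookup d \<kappa>"
  proof (cases "\<kappa> \<in> partitions")
    case False
    then have "\<kappa> \<notin> keys c" "\<kappa> \<notin> keys d" using c by (auto simp: FH_carrier_def)
    then show ?thesis by (simp add: not_in_keys_iff_lookup_eq_zero)
  next
    case True
    then obtain \<sigma> where \<sigma>: "rtype \<sigma> = \<kappa>" using ex_rtype by blast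
    obtain m where m: "supp \<sigma> \<subseteq> {1..m}" using supp_bounded by blast
    show ?thesis
    proof (rule int_valued_eqI)
      show "lookup c \<kappa> \<in> int_valued" "lookup d \<kappa> \<in> int_valued"
        using c by (auto simp: FH_carrier_def)
      fix n assume "m \<le> n"
      then have "\<sigma> \<in> perms n" using m by (auto simp: perms_def)
      then show "\<lfloor>poly (lookup c \<kappa>) (of_nat n)\<rfloor> = \<lfloor>poly (lookup d \<kappa>) (of_nat n)\<rfloor>"
        using lookup_ev[of n c \<sigma>] lookup_ev[of n d \<sigma>] eq[of n] \<sigma> by simp
    qed
  qed
qed

lemma ev_struct_map: "ev n (struct_map \<mu> \<nu>) = csum n \<mu> * csum n \<nu>"
proof (rule poly_mapping_eqI)
  fix \<sigma>
  show "lookup (ev n (struct_map \<mu> \<nu>)) \<sigma> = lookup (csum n \<mu> * csum n \<nu>) \<sigma>"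
  proof (cases "\<sigma> \<in> perms n")
    case True
    then show ?thesis by (simp add: lookup_ev lookup_struct_map poly_struct_poly)
  next
    case False
    have "keys (csum n \<mu> * csum n \<nu>) \<subseteq> perms n"
    proof -
      have "keys (csum n \<mu>) \<subseteq> perms n" for \<mu> by (auto simp: in_keys_iff lookup_csum split: if_splits)
      then show ?thesis using keys_mult[of "csum n \<mu>" "csum n \<nu>"] perms_plus by blast
    qed
    then show ?thesis using False by (auto simp: lookup_ev in_keys_iff)
  qed
qed

text \<open>The passage from permutations as elements of a type to permutations as functions, in which the
  structure constants are defined.\<close>

definition to_frag :: "gring \<Rightarrow> ((nat \<Rightarrow> nat) \<Rightarrow>\<^sub>0 int)" where "to_frag = frag_extend (frag_of \<circ> act)"

lemma to_frag_mult: "to_frag (x * y) = to_frag x \<otimes>\<^bsub>monoid_ring (sym_group n)\<^esub> to_frag y"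
proof (induction x rule: frag_induct)
  case (one \<sigma>)
  show ?case
    by (induction y rule: frag_induct)
      (simp_all add: to_frag_def monoid_ring_def sym_group_def frag_of_mult act_plus_fun
        right_diff_distrib frag_extend_diff)
qed (simp_all add: to_frag_def monoid_ring_def left_diff_distrib frag_extend_diff)

lemma lookup_to_frag: "lookup (to_frag x) (act \<sigma>) = lookup x \<sigma>"
  by (induction x rule: frag_induct)
    (auto simp: to_frag_def frag_extend_diff lookup_minus act_inject)

lemma to_frag_inject: "to_frag x = to_frag y \<longleftrightarrow> x = y"
  using lookup_to_frag by (metis poly_mapping_eqI)

lemma to_frag_csum: "to_frag (csum n \<mu>) = class_sum n \<mu>"
proof -
  have "{\<sigma>. \<sigma> \<in> carrier (sym_group n) \<and> reduced_cycle_type n \<sigma> = \<mu>} =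
      act ` {\<sigma>. \<sigma> \<in> perms n \<and> rtype \<sigma> = \<mu>}" (is "?A = ?B")
  proof -
    have "?A = {p \<in> act ` perms n. reduced_cycle_type n p = \<mu>}"
      by (simp add: act_image_perms sym_group_def)
    also have "\<dots> = ?B" by (auto simp: perms_def reduced_cycle_type_act)
    finally show ?thesis .
  qed
  then have "class_sum n \<mu> = sum frag_of (act ` {\<sigma>. \<sigma> \<in> perms n \<and> rtype \<sigma> = \<mu>})"
    unfolding class_sum_def by (rule arg_cong)
  also have "\<dots> = (\<Sum>\<sigma> | \<sigma> \<in> perms n \<and> rtype \<sigma> = \<mu>. frag_of (act \<sigma>))"
    using inj_on_subset[OF inj_act subset_UNIV] by (subst sum.reindex) (auto simp: comp_def)
  also have "\<dots> = to_frag (csum n \<mu>)"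
    unfolding csum_def to_frag_def by (simp add: frag_extend_sum comp_def)
  finally show ?thesis by (rule sym)
qed

lemma to_frag_ev: "to_frag (ev n c) = (\<Sum>\<kappa>\<in>keys c.
    frag_cmul \<lfloor>poly (lookup c \<kappa>) (of_nat n)\<rfloor> (class_sum n \<kappa>))"
  unfolding ev_def to_frag_csum[symmetric] to_frag_def frag_extend_sum[OF finite_keys]
    frag_extend_cmul comp_def ..

text \<open>The theorem of Farahat and Higman: existence is \<open>ev_struct_map\<close>, uniqueness is \<open>ev_inject\<close>.\<close>

lemma structure_constants_eq: "structure_constants \<mu> \<nu> = struct_map \<mu> \<nu>"
  unfolding structure_constants_def to_frag_ev[symmetric]
  unfolding to_frag_csum[symmetric] to_frag_mult[symmetric] to_frag_inject
  by (rule the_equality) (auto simp: struct_map_FH ev_struct_map intro: ev_inject)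

lemma structure_constants_FH: "structure_constants \<mu> \<nu> \<in> FH_carrier"
  by (simp add: structure_constants_eq struct_map_FH)

lemma ev_structure_constants: "ev n (structure_constants \<mu> \<nu>) = csum n \<mu> * csum n \<nu>"
  by (simp add: structure_constants_eq ev_struct_map)

section \<open>The Farahat-Higman algebra\<close>

definition val :: "nat \<Rightarrow> rat poly \<Rightarrow> int" where "val n p = \<lfloor>poly p (of_nat n)\<rfloor>"

lemma of_int_val: "p \<in> int_valued \<Longrightarrow> of_int (val n p) = poly p (of_nat n)"
  unfolding val_def by (rule int_valued_floor)

lemma val_eqI: "p \<in> int_valued \<Longrightarrow> (of_int k :: rat) = poly p (of_nat n) \<Longrightarrow> val n p = k"
  using of_int_val[of p n] by (metis of_int_eq_iff)

lemma val_0 [simp]: "val n 0 = 0" and val_1 [simp]: "val n 1 = 1" by (simp_all add: val_def)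

lemma val_add: "p \<in> int_valued \<Longrightarrow> q \<in> int_valued \<Longrightarrow> val n (p + q) = val n p + val n q"
  by (rule val_eqI) (simp_all add: int_valued_add of_int_val)

lemma val_mult: "p \<in> int_valued \<Longrightarrow> q \<in> int_valued \<Longrightarrow> val n (p * q) = val n p * val n q"
  by (rule val_eqI) (simp_all add: int_valued_mult of_int_val)

lemma val_of_int [simp]: "val n (of_int k) = k" by (simp add: val_def)

lemma frag_cmul_of_int: "frag_cmul k x = of_int k * (x :: gring)"
proof (induction k rule: int_induct[where k = 0])
  case (step1 i)
  then show ?case by (simp add: frag_cmul_distrib distrib_right)
next
  case (step2 i)
  then show ?case by (simp add: frag_cmul_diff_distrib left_diff_distrib)
qed simp

lemma lookup_of_int_mult: "lookup (of_int k * x :: gring) \<sigma> = k * lookup x \<sigma>"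
  by (simp flip: frag_cmul_of_int)

lemma of_int_commute: "of_int k * x = x * (of_int k :: gring)"
  by (rule mult_of_int_commute)

lemma lookup_ev': "lookup (ev n c) \<sigma> =
    (if \<sigma> \<in> perms n then val n (lookup c (rtype \<sigma>)) else 0)"
  by (simp add: lookup_ev val_def)

lemma ev_def': "ev n c = (\<Sum>\<kappa>\<in>keys c. of_int (val n (lookup c \<kappa>)) * csum n \<kappa>)"
  by (simp add: ev_def val_def frag_cmul_of_int)

lemma lookup_FH_smult [simp]: "lookup (FH_smult r c) \<mu> = r * lookup c \<mu>"
  by (simp add: FH_smult_def map.rep_eq when_def)

lemma lookup_FH_basis: "lookup (FH_basis \<mu>) \<kappa> = (if \<mu> = \<kappa> then 1 else 0)"
  by (simp add: FH_basis_def lookup_single when_def)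

lemma FH_carrier_iff:
  "c \<in> FH_carrier \<longleftrightarrow> (\<forall>\<mu>. lookup c \<mu> \<in> int_valued \<and> (\<mu> \<notin> partitions \<longrightarrow> lookup c \<mu> = 0))"
  by (auto simp: FH_carrier_def in_keys_iff)

lemma lookup_FH: "c \<in> FH_carrier \<Longrightarrow> lookup c \<mu> \<in> int_valued"
  by (simp add: FH_carrier_iff)

lemma FH_carrier_0 [simp]: "0 \<in> FH_carrier"
  and FH_carrier_add: "c \<in> FH_carrier \<Longrightarrow> d \<in> FH_carrier \<Longrightarrow> c + d \<in> FH_carrier"
  and FH_carrier_diff: "c \<in> FH_carrier \<Longrightarrow> d \<in> FH_carrier \<Longrightarrow> c - d \<in> FH_carrier"
  and FH_carrier_uminus: "c \<in> FH_carrier \<Longrightarrow> - c \<in> FH_carrier"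
  and FH_carrier_smult: "r \<in> int_valued \<Longrightarrow> c \<in> FH_carrier \<Longrightarrow> FH_smult r c \<in> FH_carrier"
  and FH_carrier_basis: "\<mu> \<in> partitions \<Longrightarrow> FH_basis \<mu> \<in> FH_carrier"
  by (auto simp: FH_carrier_iff lookup_add lookup_minus lookup_uminus lookup_FH_basis
      intro: int_valued_add int_valued_diff int_valued_uminus int_valued_mult)

lemma FH_carrier_sum: "(\<And>x. x \<in> A \<Longrightarrow> f x \<in> FH_carrier) \<Longrightarrow> sum f A \<in> FH_carrier"
  by (induction A rule: infinite_finite_induct) (auto intro: FH_carrier_add)

lemma ev_0 [simp]: "ev n 0 = 0" by (simp add: ev_def)

lemma ev_add: "c \<in> FH_carrier \<Longrightarrow> d \<in> FH_carrier \<Longrightarrow> ev n (c + d) = ev n c + ev n d"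
  by (rule poly_mapping_eqI) (simp add: lookup_ev' lookup_add val_add lookup_FH)

lemma ev_smult: "r \<in> int_valued \<Longrightarrow> c \<in> FH_carrier \<Longrightarrow> ev n (FH_smult r c) = of_int (val n r) * ev n c"
  by (rule poly_mapping_eqI) (simp add: lookup_ev' lookup_of_int_mult val_mult lookup_FH)

lemma ev_basis: "\<mu> \<in> partitions \<Longrightarrow> ev n (FH_basis \<mu>) = csum n \<mu>"
  by (rule poly_mapping_eqI) (auto simp: lookup_ev' lookup_FH_basis lookup_csum)

lemma ev_sum: "(\<And>x. x \<in> A \<Longrightarrow> f x \<in> FH_carrier) \<Longrightarrow> ev n (sum f A) = (\<Sum>x\<in>A. ev n (f x))"
  by (induction A rule: infinite_finite_induct) (auto simp: ev_add FH_carrier_sum)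

lemma FH_sel: "carrier FH = FH_carrier" "\<one>\<^bsub>FH\<^esub> = FH_basis {#}" "\<zero>\<^bsub>FH\<^esub> = 0"
  "x \<oplus>\<^bsub>FH\<^esub> y = x + y" "r \<odot>\<^bsub>FH\<^esub> x = FH_smult r x"
  by (simp_all add: FH_def)

lemma mult_FH: "c \<otimes>\<^bsub>FH\<^esub> d = (\<Sum>\<mu>\<in>keys c. \<Sum>\<nu>\<in>keys d.
    FH_smult (lookup c \<mu> * lookup d \<nu>) (structure_constants \<mu> \<nu>))"
  by (simp add: FH_def)

lemma FH_carrier_mult: "c \<in> FH_carrier \<Longrightarrow> d \<in> FH_carrier \<Longrightarrow> c \<otimes>\<^bsub>FH\<^esub> d \<in> FH_carrier"
  unfolding mult_FH
  by (intro FH_carrier_sum FH_carrier_smult int_valued_mult lookup_FH structure_constants_FH)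

lemma ev_mult:
  assumes "c \<in> FH_carrier" "d \<in> FH_carrier"
  shows "ev n (c \<otimes>\<^bsub>FH\<^esub> d) = ev n c * ev n d"
proof -
  let ?c = "\<lambda>\<mu>. lookup c \<mu>" and ?d = "\<lambda>\<mu>. lookup d \<mu>"
  have iv: "?c \<mu> \<in> int_valued" "?d \<mu> \<in> int_valued" for \<mu> using assms by (simp_all add: lookup_FH)
  have car: "FH_smult (?c \<mu> * ?d \<nu>) (structure_constants \<mu> \<nu>) \<in> FH_carrier" for \<mu> \<nu>
    using iv by (intro FH_carrier_smult int_valued_mult structure_constants_FH)
  have "ev n (c \<otimes>\<^bsub>FH\<^esub> d) = (\<Sum>\<mu>\<in>keys c. \<Sum>\<nu>\<in>keys d.
      ev n (FH_smult (?c \<mu> * ?d \<nu>) (structure_constants \<mu> \<nu>)))"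
    unfolding mult_FH by (simp add: ev_sum FH_carrier_sum car)
  also have "\<dots> = (\<Sum>\<mu>\<in>keys c. \<Sum>\<nu>\<in>keys d.
      (of_int (val n (?c \<mu>)) * csum n \<mu>) * (of_int (val n (?d \<nu>)) * csum n \<nu>))"
  proof (intro sum.cong refl)
    fix \<mu> \<nu>
    have "ev n (FH_smult (?c \<mu> * ?d \<nu>) (structure_constants \<mu> \<nu>)) =
        of_int (val n (?c \<mu>)) * of_int (val n (?d \<nu>)) * (csum n \<mu> * csum n \<nu>)"
      using iv by (simp add: ev_smult int_valued_mult structure_constants_FH ev_structure_constants val_mult)
    also have "\<dots> = of_int (val n (?c \<mu>)) * (of_int (val n (?d \<nu>)) * csum n \<mu>) * csum n \<nu>"
      by (simp only: mult.assoc)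
    also have "\<dots> = (of_int (val n (?c \<mu>)) * csum n \<mu>) * (of_int (val n (?d \<nu>)) * csum n \<nu>)"
      unfolding of_int_commute[of "val n (?d \<nu>)" "csum n \<mu>"] by (simp only: mult.assoc)
    finally show "ev n (FH_smult (?c \<mu> * ?d \<nu>) (structure_constants \<mu> \<nu>)) =
        (of_int (val n (?c \<mu>)) * csum n \<mu>) * (of_int (val n (?d \<nu>)) * csum n \<nu>)" .
  qed
  also have "\<dots> = ev n c * ev n d" unfolding ev_def' sum_product ..
  finally show ?thesis .
qed

lemma empty_partition [simp]: "{#} \<in> partitions" by (simp add: partitions_def)

lemma ev_one: "ev n (FH_basis {#}) = 1"
proof (rule poly_mapping_eqI)
  fix \<sigma>
  have "\<sigma> \<in> perms n \<and> rtype \<sigma> = {#} \<longleftrightarrow> \<sigma> = 0"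
    unfolding rtype_eq_empty by (auto simp: perms_def)
  then show "lookup (ev n (FH_basis {#})) \<sigma> = lookup 1 \<sigma>"
    unfolding ev_basis[OF empty_partition] lookup_csum lookup_one when_def by presburger
qed

lemma abelian_group_FH: "abelian_group FH"
proof (rule abelian_groupI)
  fix x assume x: "x \<in> carrier FH"
  have "- x \<oplus>\<^bsub>FH\<^esub> x = \<zero>\<^bsub>FH\<^esub>" by (simp add: FH_sel)
  then show "\<exists>y\<in>carrier FH. y \<oplus>\<^bsub>FH\<^esub> x = \<zero>\<^bsub>FH\<^esub>"
    using x FH_carrier_uminus unfolding FH_sel by blast
qed (auto simp: FH_sel FH_carrier_add add_ac)

text \<open>Every ring axiom holds because it holds after each specialisation.\<close>

lemma ring_FH: "ring FH"
proof (rule ringI[OF abelian_group_FH])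
  show "monoid FH"
    by (rule monoidI; (rule ev_inject)?)
      (auto simp: FH_sel FH_carrier_mult FH_carrier_basis ev_mult ev_one mult.assoc)
next
  fix x y z assume "x \<in> carrier FH" "y \<in> carrier FH" "z \<in> carrier FH"
  then have c: "x \<in> FH_carrier" "y \<in> FH_carrier" "z \<in> FH_carrier" by (simp_all add: FH_sel)
  show "(x \<oplus>\<^bsub>FH\<^esub> y) \<otimes>\<^bsub>FH\<^esub> z = x \<otimes>\<^bsub>FH\<^esub> z \<oplus>\<^bsub>FH\<^esub> y \<otimes>\<^bsub>FH\<^esub> z"
    unfolding FH_sel
    by (rule ev_inject) (simp_all add: c FH_carrier_add FH_carrier_mult ev_add ev_mult distrib_right)
  show "z \<otimes>\<^bsub>FH\<^esub> (x \<oplus>\<^bsub>FH\<^esub> y) = z \<otimes>\<^bsub>FH\<^esub> x \<oplus>\<^bsub>FH\<^esub> z \<otimes>\<^bsub>FH\<^esub> y"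
    unfolding FH_sel
    by (rule ev_inject) (simp_all add: c FH_carrier_add FH_carrier_mult ev_add ev_mult distrib_left)
qed

lemma inv_FH: "x \<in> FH_carrier \<Longrightarrow> inv\<^bsub>add_monoid FH\<^esub> x = - x"
  using abelian_group.minus_equality[OF abelian_group_FH, of "- x" x]
  by (simp add: FH_sel FH_carrier_uminus a_inv_def)

text \<open>The filtration \<open>\<F>\<^sup>i\<close> described by coefficients; see \<open>FH_filtration_eq\<close>.\<close>

definition FH_le :: "nat \<Rightarrow> (nat multiset \<Rightarrow>\<^sub>0 rat poly) set"
  where "FH_le i = {c \<in> FH_carrier. \<forall>\<kappa>\<in>keys c. sum_mset \<kappa> \<le> i}"

lemma FH_le_iff: "c \<in> FH_le i \<longleftrightarrow> c \<in> FH_carrier \<and> (\<forall>\<kappa>. i < sum_mset \<kappa> \<longrightarrow> lookup c \<kappa> = 0)"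
  by (force simp: FH_le_def in_keys_iff not_less[symmetric])

lemma submodule_FHI:
  assumes "N \<subseteq> FH_carrier" "0 \<in> N" "\<And>x y. x \<in> N \<Longrightarrow> y \<in> N \<Longrightarrow> x + y \<in> N"
    "\<And>r x. r \<in> int_valued \<Longrightarrow> x \<in> N \<Longrightarrow> FH_smult r x \<in> N"
  shows "submodule N int_valued_ring FH"
proof -
  have uminus: "- x \<in> N" if "x \<in> N" for x
  proof -
    have "FH_smult (- 1) x = - x" by (rule poly_mapping_eqI) simp
    moreover have "- 1 \<in> int_valued" by (intro int_valued_uminus) simp
    ultimately show ?thesis using assms(4) that by metis
  qed
  have "subgroup N (add_monoid FH)"
  proof (intro subgroup.intro)
    fix x assume "x \<in> N"
    then show "inv\<^bsub>add_monoid FH\<^esub> x \<in> N"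
      using uminus[of x] inv_FH[of x] assms(1) by auto
  qed (use assms in \<open>auto simp: FH_sel\<close>)
  then show ?thesis
    using assms(4) by (auto simp: submodule_def submodule_axioms_def FH_sel int_valued_ring_def)
qed

lemma FH_expansion: "c = (\<Sum>\<kappa>\<in>keys c. FH_smult (lookup c \<kappa>) (FH_basis \<kappa>))"
proof (rule poly_mapping_eqI)
  fix \<mu>
  have "(\<Sum>\<kappa>\<in>keys c. lookup c \<kappa> * (if \<kappa> = \<mu> then 1 else 0)) =
      lookup c \<mu>" by (simp add: in_keys_iff if_distrib cong: if_cong)
  then show "lookup c \<mu> = lookup
      (\<Sum>\<kappa>\<in>keys c. FH_smult (lookup c \<kappa>) (FH_basis \<kappa>)) \<mu>"
    by (simp add: lookup_sum lookup_FH_basis)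
qed

lemma FH_filtration_eq: "FH_filtration i = FH_le i"
proof
  have "submodule (FH_le i) int_valued_ring FH"
    by (rule submodule_FHI)
      (auto simp: FH_le_iff lookup_add FH_carrier_add FH_carrier_smult)
  moreover have "{FH_basis \<mu> | \<mu>. \<mu> \<in> partitions \<and> sum_mset \<mu> \<le> i} \<subseteq> FH_le i"
    by (auto simp: FH_le_iff FH_carrier_basis lookup_FH_basis)
  ultimately show "FH_filtration i \<subseteq> FH_le i" unfolding FH_filtration_def rspan_def by blast
next
  show "FH_le i \<subseteq> FH_filtration i" unfolding FH_filtration_def rspan_def
  proof (intro subsetI InterI)
    fix c N assume c: "c \<in> FH_le i"
      and "N \<in> {N. submodule N int_valued_ring FH \<and> {FH_basis \<mu> | \<mu>. \<mu> \<in> partitions \<and> sum_mset \<mu> \<le> i} \<subseteq> N}"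
    then have N: "submodule N int_valued_ring FH"
        "\<And>\<mu>. \<mu> \<in> partitions \<Longrightarrow> sum_mset \<mu> \<le> i \<Longrightarrow> FH_basis \<mu> \<in> N" by blast+
    have add: "x + y \<in> N" if "x \<in> N" "y \<in> N" for x y
      using subgroup.m_closed[OF submodule.axioms(1)[OF N(1)] that] by (simp add: FH_sel)
    have zero: "0 \<in> N" using subgroup.one_closed[OF submodule.axioms(1)[OF N(1)]] by (simp add: FH_sel)
    have sumN: "sum f A \<in> N" if "\<And>x. x \<in> A \<Longrightarrow> f x \<in> N" for f and A :: "nat multiset set"
      using that by (induction A rule: infinite_finite_induct) (auto intro: add zero)
    have elem: "FH_smult (lookup c \<kappa>) (FH_basis \<kappa>) \<in> N" if "\<kappa> \<in> keys c" for \<kappa>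
    proof -
      have "\<kappa> \<in> partitions" "sum_mset \<kappa> \<le> i" "lookup c \<kappa> \<in> int_valued"
        using c that by (auto simp: FH_le_def FH_carrier_def)
      then show ?thesis using submodule.smult_closed[OF N(1)] N(2) by (simp add: FH_sel int_valued_ring_def)
    qed
    have "(\<Sum>\<kappa>\<in>keys c. FH_smult (lookup c \<kappa>) (FH_basis \<kappa>)) \<in> N"
      by (rule sumN) (rule elem)
    then show "c \<in> N" unfolding FH_expansion[symmetric] .
  qed
qed

section \<open>The ring of symmetric functions\<close>

type_synonym mono = "nat \<Rightarrow>\<^sub>0 nat"

lemma finite_bounded_monos: "finite {a :: mono. keys a \<subseteq> {..<N} \<and> monomial_degree a \<le> d}"
proof -
  let ?F = "{f. \<forall>i. (i \<in> {..<N} \<longrightarrow> f i \<in> {..d}) \<and> (i \<notin> {..<N} \<longrightarrow> f i = (0::nat))}"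
  have "finite ?F" by (rule finite_set_of_finite_funs) auto
  moreover have "lookup ` {a :: mono. keys a \<subseteq> {..<N} \<and> monomial_degree a \<le> d} \<subseteq> ?F"
  proof (rule image_subsetI)
    fix a :: mono assume a: "a \<in> {a. keys a \<subseteq> {..<N} \<and> monomial_degree a \<le> d}"
    have "lookup a i \<le> monomial_degree a" for i
      by (cases "i \<in> keys a")
        (auto simp: monomial_degree_def not_in_keys_iff_lookup_eq_zero intro: member_le_sum)
    then show "lookup a \<in> ?F"
      using a by (auto simp: not_in_keys_iff_lookup_eq_zero[symmetric] intro: order_trans)
  qed
  ultimately have "finite (lookup ` {a :: mono. keys a \<subseteq> {..<N} \<and> monomial_degree a \<le> d})"
    by (rule rev_finite_subset)
  then show ?thesis by (rule finite_imageD) (auto intro: inj_onI poly_mapping_eqI)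
qed

lemma keys_add_mono: "keys (a + b :: mono) = keys a \<union> keys b"
  by (auto simp: in_keys_iff lookup_add)

lemma ex_keys_bound: "\<exists>N. keys (m :: mono) \<subseteq> {..<N}"
  using finite_nat_bounded[OF finite_keys] by blast

lemma finite_pairs: "finite {(a, b). a + b = (m :: mono)}"
proof -
  obtain N where N: "keys m \<subseteq> {..<N}" using ex_keys_bound by blast
  let ?B = "{a :: mono. keys a \<subseteq> {..<N} \<and> monomial_degree a \<le> monomial_degree m}"
  have "{(a, b). a + b = m} \<subseteq> ?B \<times> ?B"
    using N by (auto simp: keys_add_mono monomial_degree_add)
  then show ?thesis using finite_bounded_monos by (meson finite_SigmaI finite_subset)
qed

type_synonym series = "mono \<Rightarrow> int"

definition smul :: "series \<Rightarrow> series \<Rightarrow> series"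
  where "smul f g m = (\<Sum>(a, b) | a + b = m. f a * g b)"

definition bounded_degree :: "series \<Rightarrow> nat \<Rightarrow> bool"
  where "bounded_degree f d \<longleftrightarrow> (\<forall>m. f m \<noteq> 0 \<longrightarrow> monomial_degree m \<le> d)"

lemma symmetric_bounded: "symmetric_function f \<Longrightarrow> \<exists>d. bounded_degree f d"
  by (simp add: symmetric_function_def bounded_degree_def)

text \<open>Setting \<open>x\<^sub>N = x\<^bsub>N+1\<^esub> = \<dots> = 0\<close> turns a power series of bounded degree into a polynomial.  Polynomials
  form a ring by their type, and all truncations together determine the series; this gives the ring
  axioms for symmetric functions.\<close>

definition trunc :: "nat \<Rightarrow> series \<Rightarrow> (mono \<Rightarrow>\<^sub>0 int)"
  where "trunc N f = Abs_poly_mapping (\<lambda>m. if keys m \<subseteq> {..<N} then f m else 0)"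

lemma lookup_trunc:
  assumes "bounded_degree f d"
  shows "lookup (trunc N f) m = (if keys m \<subseteq> {..<N} then f m else 0)"
proof -
  have "finite {m. (if keys m \<subseteq> {..<N} then f m else 0) \<noteq> 0}"
    by (rule finite_subset[OF _ finite_bounded_monos[of N d]])
      (use assms in \<open>auto simp: bounded_degree_def split: if_splits\<close>)
  then show ?thesis unfolding trunc_def by (simp only: lookup_Abs_poly_mapping)
qed

lemma lookup_mult_pairs:
  fixes P Q :: "mono \<Rightarrow>\<^sub>0 int"
  shows "lookup (P * Q) m =
    (\<Sum>(a, b) | a + b = m. lookup P a * lookup Q b)"
proof (induction P rule: frag_induct)
  case (one x)
  show ?case
  proof (induction Q rule: frag_induct)
    case (one y)
    have "(\<Sum>(a, b) | a + b = m. lookup (frag_of x) a * lookup (frag_of y) b)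
        = (\<Sum>p\<in>{(a, b). a + b = m}. if p = (x, y) then 1 else 0)"
      by (rule sum.cong) (auto split: if_splits)
    also have "\<dots> = (if x + y = m then 1 else 0)" using finite_pairs[of m] by simp
    finally show ?case by (simp add: frag_of_mult eq_commute)
  qed (simp_all add: right_diff_distrib lookup_minus sum_subtractf case_prod_beta)
qed (simp_all add: left_diff_distrib lookup_minus sum_subtractf case_prod_beta)

lemma smul_nonzero:
  assumes "smul f g m \<noteq> 0"
  shows "\<exists>a b. a + b = m \<and> f a \<noteq> 0 \<and> g b \<noteq> 0"
proof -
  from assms obtain p where "p \<in> {(a, b). a + b = m}" "(case p of (a, b) \<Rightarrow> f a * g b) \<noteq> 0"
    unfolding smul_def by (rule sum.not_neutral_contains_not_neutral)
  then have "fst p + snd p = m \<and> f (fst p) \<noteq> 0 \<and> g (snd p) \<noteq> 0" by (auto simp: case_prod_beta)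
  then show ?thesis by blast
qed

lemma bounded_smul:
  assumes "bounded_degree f d" "bounded_degree g e"
  shows "bounded_degree (smul f g) (d + e)"
  unfolding bounded_degree_def
proof (intro allI impI)
  fix m assume "smul f g m \<noteq> 0"
  then obtain a b where "a + b = m" "f a \<noteq> 0" "g b \<noteq> 0" using smul_nonzero by blast
  then show "monomial_degree m \<le> d + e"
    using assms add_mono unfolding bounded_degree_def monomial_degree_add[symmetric]
    by (metis monomial_degree_add)
qed

lemma trunc_smul:
  assumes "bounded_degree f d" "bounded_degree g e"
  shows "trunc N (smul f g) = trunc N f * trunc N g"
proof (rule poly_mapping_eqI)
  fix m
  show "lookup (trunc N (smul f g)) m = lookup (trunc N f * trunc N g) m"
  proof (cases "keys m \<subseteq> {..<N}")
    case True
    then have "(\<Sum>(a, b) | a + b = m. f a * g b) =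
        (\<Sum>(a, b) | a + b = m. lookup (trunc N f) a * lookup (trunc N g) b)"
      by (intro sum.cong) (auto simp: lookup_trunc[OF assms(1)] lookup_trunc[OF assms(2)] keys_add_mono)
    then show ?thesis
      using True by (simp add: lookup_trunc[OF bounded_smul[OF assms]] lookup_mult_pairs smul_def)
  next
    case False
    then have "(\<Sum>(a, b) | a + b = m. lookup (trunc N f) a * lookup (trunc N g) b) = 0"
      by (intro sum.neutral) (auto simp: lookup_trunc[OF assms(1)] lookup_trunc[OF assms(2)] keys_add_mono)
    then show ?thesis
      using False by (simp add: lookup_trunc[OF bounded_smul[OF assms]] lookup_mult_pairs)
  qed
qed

lemma trunc_inject:
  assumes "bounded_degree f d" "bounded_degree g e" "\<And>N. trunc N f = trunc N g"
  shows "f = g"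
proof
  fix m :: mono
  obtain N where "keys m \<subseteq> {..<N}" using ex_keys_bound by blast
  then show "f m = g m"
    using lookup_trunc[OF assms(1), of N m] lookup_trunc[OF assms(2), of N m] assms(3)[of N] by simp
qed

lemma bounded_one: "bounded_degree (\<lambda>m. if m = 0 then 1 else 0) 0"
  by (simp add: bounded_degree_def)

lemma trunc_one: "trunc N (\<lambda>m. if m = 0 then 1 else 0) = 1"
  by (rule poly_mapping_eqI) (auto simp: lookup_trunc[OF bounded_one] lookup_one when_def)

lemma bounded_add:
  "bounded_degree f d \<Longrightarrow> bounded_degree g e \<Longrightarrow> bounded_degree (\<lambda>m. f m + g m) (max d e)"
  unfolding bounded_degree_def by (metis add.right_neutral add.left_neutral max.coboundedI1 max.coboundedI2)

lemma trunc_add: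
  assumes "bounded_degree f d" "bounded_degree g e"
  shows "trunc N (\<lambda>m. f m + g m) = trunc N f + trunc N g"
  by (rule poly_mapping_eqI)
    (simp add: lookup_trunc[OF bounded_add[OF assms]] lookup_trunc[OF assms(1)] lookup_trunc[OF assms(2)] lookup_add)

lemma symmetric_zero: "symmetric_function (\<lambda>m. 0)" by (simp add: symmetric_function_def)

lemma symmetric_uminus: "symmetric_function f \<Longrightarrow> symmetric_function (\<lambda>m. - f m)"
  by (simp add: symmetric_function_def)

lemma symmetric_add: "symmetric_function f \<Longrightarrow> symmetric_function g \<Longrightarrow> symmetric_function (\<lambda>m. f m + g m)"
proof -
  assume fg: "symmetric_function f" "symmetric_function g"
  then obtain d e where "bounded_degree f d" "bounded_degree g e" by (meson symmetric_bounded)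
  then have "\<exists>d. bounded_degree (\<lambda>m. f m + g m) d" using bounded_add by blast
  then show ?thesis using fg by (simp add: symmetric_function_def bounded_degree_def)
qed

lemma lookup_map_key: "bij \<pi> \<Longrightarrow> lookup (map_key \<pi> m) i = lookup m (\<pi> i)"
  by (simp add: map_key.rep_eq bij_is_inj)

lemma map_key_add: "bij \<pi> \<Longrightarrow> map_key \<pi> (a + b) = map_key \<pi> a + map_key \<pi> b"
  by (rule poly_mapping_eqI) (simp add: lookup_map_key lookup_add)

lemma map_key_inv:
  fixes \<pi> :: "nat \<Rightarrow> nat" and a :: mono
  assumes "bij \<pi>"
  shows "map_key \<pi> (map_key (inv_into UNIV \<pi>) a) = a"
    "map_key (inv_into UNIV \<pi>) (map_key \<pi> a) = a"
  using assms bij_imp_bij_inv[OF assms]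
  by (auto intro!: poly_mapping_eqI simp: lookup_map_key bij_is_inj surj_f_inv_f bij_is_surj)

lemma symmetric_smul:
  assumes "symmetric_function f" "symmetric_function g"
  shows "symmetric_function (smul f g)"
proof -
  obtain d e where "bounded_degree f d" "bounded_degree g e" using assms by (meson symmetric_bounded)
  then have b: "\<exists>d. \<forall>m. smul f g m \<noteq> 0 \<longrightarrow> monomial_degree m \<le> d"
    using bounded_smul unfolding bounded_degree_def by blast
  have "smul f g (map_key \<pi> m) = smul f g m" if \<pi>: "bij \<pi>" for \<pi> m
    unfolding smul_def
  proof (rule sum.reindex_bij_witness[where
        i = "\<lambda>(a, b). (map_key \<pi> a, map_key \<pi> b)" and
        j = "\<lambda>(a, b). (map_key (inv_into UNIV \<pi>) a, map_key (inv_into UNIV \<pi>) b)"])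
    have inv: "bij (inv_into UNIV \<pi>)" using \<pi> by (rule bij_imp_bij_inv)
    {
      fix p assume "p \<in> {(a, b). a + b = map_key \<pi> m}"
      then show "(case case p of (a, b) \<Rightarrow> (map_key (inv_into UNIV \<pi>) a, map_key (inv_into UNIV \<pi>) b)
          of (a, b) \<Rightarrow> (map_key \<pi> a, map_key \<pi> b)) = p"
        "(case p of (a, b) \<Rightarrow> (map_key (inv_into UNIV \<pi>) a, map_key (inv_into UNIV \<pi>) b))
          \<in> {(a, b). a + b = m}"
        by (auto simp: map_key_inv[OF \<pi>] simp flip: map_key_add[OF inv])
      show "(case case p of (a, b) \<Rightarrow> (map_key (inv_into UNIV \<pi>) a, map_key (inv_into UNIV \<pi>) b)
          of (a, b) \<Rightarrow> f a * g b) = (case p of (a, b) \<Rightarrow> f a * g b)"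
        using assms inv by (auto simp: symmetric_function_def split: prod.split)
    }
    fix p assume "p \<in> {(a, b). a + b = m}"
    then show "(case case p of (a, b) \<Rightarrow> (map_key \<pi> a, map_key \<pi> b)
        of (a, b) \<Rightarrow> (map_key (inv_into UNIV \<pi>) a, map_key (inv_into UNIV \<pi>) b)) = p"
      "(case p of (a, b) \<Rightarrow> (map_key \<pi> a, map_key \<pi> b))
        \<in> {(a, b). a + b = map_key \<pi> m}"
      by (auto simp: map_key_inv[OF \<pi>] map_key_add[OF \<pi>])
  qed
  then show ?thesis using b by (simp add: symmetric_function_def)
qed

lemma symmetric_one: "symmetric_function (\<lambda>m. if m = 0 then 1 else 0)"
proof -
  have "map_key \<pi> m = 0 \<longleftrightarrow> m = 0" if "bij \<pi>" for \<pi> :: "nat \<Rightarrow> nat" and m :: mono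
    using map_key_inv[OF that, of m] map_key_zero[OF bij_is_inj[OF that]]
      map_key_zero[OF bij_is_inj[OF bij_imp_bij_inv[OF that]]] by metis
  then show ?thesis by (auto simp: symmetric_function_def)
qed

lemma sym_sel: "carrier sym_ring = {f. symmetric_function f}" "\<one>\<^bsub>sym_ring\<^esub> = (\<lambda>m. if m = 0 then 1 else 0)"
  "\<zero>\<^bsub>sym_ring\<^esub> = (\<lambda>m. 0)" "f \<oplus>\<^bsub>sym_ring\<^esub> g = (\<lambda>m. f m + g m)" "f \<otimes>\<^bsub>sym_ring\<^esub> g = smul f g"
  by (simp_all add: sym_ring_def smul_def fun_eq_iff)

lemma abelian_group_sym_ring: "abelian_group sym_ring"
proof (rule abelian_groupI)
  fix x assume x: "x \<in> carrier sym_ring"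
  have "(\<lambda>m. - x m) \<oplus>\<^bsub>sym_ring\<^esub> x = \<zero>\<^bsub>sym_ring\<^esub>" by (simp add: sym_sel)
  then show "\<exists>y\<in>carrier sym_ring. y \<oplus>\<^bsub>sym_ring\<^esub> x = \<zero>\<^bsub>sym_ring\<^esub>"
    using x by (intro bexI[of _ "\<lambda>m. - x m"]) (auto simp: sym_sel symmetric_uminus)
qed (auto simp: sym_sel symmetric_add symmetric_zero add_ac)

lemma ring_sym_ring: "ring sym_ring"
proof (rule ringI[OF abelian_group_sym_ring])
  show "monoid sym_ring"
  proof (rule monoidI)
    fix x y z assume "x \<in> carrier sym_ring" "y \<in> carrier sym_ring" "z \<in> carrier sym_ring"
    then obtain d e k where b: "bounded_degree x d" "bounded_degree y e" "bounded_degree z k"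
      by (auto simp: sym_sel dest!: symmetric_bounded)
    show "x \<otimes>\<^bsub>sym_ring\<^esub> y \<otimes>\<^bsub>sym_ring\<^esub> z = x \<otimes>\<^bsub>sym_ring\<^esub> (y \<otimes>\<^bsub>sym_ring\<^esub> z)"
      unfolding sym_sel
      by (rule trunc_inject[OF bounded_smul[OF bounded_smul[OF b(1,2)] b(3)] bounded_smul[OF b(1) bounded_smul[OF b(2,3)]]])
        (simp add: trunc_smul[OF bounded_smul[OF b(1,2)] b(3)] trunc_smul[OF b(1) bounded_smul[OF b(2,3)]]
          trunc_smul[OF b(1,2)] trunc_smul[OF b(2,3)] mult.assoc)
  next
    fix x assume "x \<in> carrier sym_ring"
    then obtain d where b: "bounded_degree x d" by (auto simp: sym_sel dest!: symmetric_bounded)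
    show "\<one>\<^bsub>sym_ring\<^esub> \<otimes>\<^bsub>sym_ring\<^esub> x = x" unfolding sym_sel
      by (rule trunc_inject[OF bounded_smul[OF bounded_one b] b]) (simp add: trunc_smul[OF bounded_one b] trunc_one)
    show "x \<otimes>\<^bsub>sym_ring\<^esub> \<one>\<^bsub>sym_ring\<^esub> = x" unfolding sym_sel
      by (rule trunc_inject[OF bounded_smul[OF b bounded_one] b]) (simp add: trunc_smul[OF b bounded_one] trunc_one)
  qed (auto simp: sym_sel symmetric_smul symmetric_one)
next
  fix x y z assume "x \<in> carrier sym_ring" "y \<in> carrier sym_ring" "z \<in> carrier sym_ring"
  show "(x \<oplus>\<^bsub>sym_ring\<^esub> y) \<otimes>\<^bsub>sym_ring\<^esub> z = x \<otimes>\<^bsub>sym_ring\<^esub> z \<oplus>\<^bsub>sym_ring\<^esub> y \<otimes>\<^bsub>sym_ring\<^esub> z"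
    by (simp add: sym_sel smul_def fun_eq_iff distrib_right sum.distrib case_prod_beta)
  show "z \<otimes>\<^bsub>sym_ring\<^esub> (x \<oplus>\<^bsub>sym_ring\<^esub> y) = z \<otimes>\<^bsub>sym_ring\<^esub> x \<oplus>\<^bsub>sym_ring\<^esub> z \<otimes>\<^bsub>sym_ring\<^esub> y"
    by (simp add: sym_sel smul_def fun_eq_iff distrib_left sum.distrib case_prod_beta)
qed

lemma inv_sym_ring: "symmetric_function f \<Longrightarrow> inv\<^bsub>add_monoid sym_ring\<^esub> f = (\<lambda>m. - f m)"
  using abelian_group.minus_equality[OF abelian_group_sym_ring, of "\<lambda>m. - f m" f]
  by (simp add: sym_sel symmetric_uminus a_inv_def)

section \<open>Evaluation at the Jucys-Murphy elements\<close>

definition JM_eval :: "nat \<Rightarrow> series \<Rightarrow> gring" where "JM_eval N f = frag_extend (jmon N) (trunc N f)"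

text \<open>Multiplicative by \<open>jmon_add\<close>, that is, because the Jucys-Murphy elements commute.\<close>

lemma frag_extend_jmon_mult: "frag_extend (jmon N) (P * Q) = frag_extend (jmon N) P * frag_extend (jmon N) Q"
proof (induction P rule: frag_induct)
  case (one x)
  show ?case
    by (induction Q rule: frag_induct) (simp_all add: frag_of_mult jmon_add right_diff_distrib frag_extend_diff)
qed (simp_all add: left_diff_distrib frag_extend_diff)

lemma JM_eval_mult:
  assumes "symmetric_function f" "symmetric_function g"
  shows "JM_eval N (smul f g) = JM_eval N f * JM_eval N g"
proof -
  obtain d e where "bounded_degree f d" "bounded_degree g e" using assms by (meson symmetric_bounded)
  then show ?thesis by (simp add: JM_eval_def trunc_smul frag_extend_jmon_mult)
qed

lemma JM_eval_add:
  assumes "symmetric_function f" "symmetric_function g"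
  shows "JM_eval N (\<lambda>m. f m + g m) = JM_eval N f + JM_eval N g"
proof -
  obtain d e where "bounded_degree f d" "bounded_degree g e" using assms by (meson symmetric_bounded)
  then show ?thesis by (simp add: JM_eval_def trunc_add frag_extend_add)
qed

lemma JM_eval_one: "JM_eval N (\<lambda>m. if m = 0 then 1 else 0) = 1"
proof -
  have "frag_extend (jmon N) (frag_of 0) = 1" by (simp del: single_one)
  then show ?thesis by (simp add: JM_eval_def trunc_one)
qed

lemma JM_eval_zero: "JM_eval N (\<lambda>m. 0) = 0"
  using JM_eval_add[OF symmetric_zero symmetric_zero, of N] by simp

lemma JM_eval_uminus:
  assumes "symmetric_function f"
  shows "JM_eval N (\<lambda>m. - f m) = - JM_eval N f"
  using JM_eval_add[OF assms symmetric_uminus[OF assms], of N] JM_eval_zero[of N]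
  by (simp add: eq_neg_iff_add_eq_0 add.commute)

lemma lookup_JM_eval:
  "lookup (JM_eval N f) \<sigma> = (\<Sum>a\<in>keys (trunc N f).
    lookup (trunc N f) a * lookup (jmon N a) \<sigma>)"
  by (simp add: JM_eval_def frag_extend_def lookup_sum)

lemma bounded_elem_sym: "bounded_degree (elem_sym r) r"
proof -
  have "monomial_degree m \<le> card (keys m)" if "\<forall>i. lookup m i \<le> 1" for m :: mono
    unfolding monomial_degree_def using that sum_bounded_above[of "keys m" "lookup m" 1]
    by simp
  then show ?thesis by (auto simp: bounded_degree_def elem_sym_def)
qed

lemma JM_eval_elem_sym: "JM_eval N (elem_sym k) = JM_elem N k"
proof -
  let ?S = "{S. S \<subseteq> {..<N} \<and> card S = k}"
  have fin: "finite S" if "S \<in> ?S" for S using that finite_subset by blast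
  have keys: "keys (trunc N (elem_sym k)) = ind ` ?S"
  proof (intro equalityI subsetI)
    fix m assume "m \<in> keys (trunc N (elem_sym k))"
    then have m: "keys m \<subseteq> {..<N}" "\<And>i. lookup m i \<le> 1" "card (keys m) = k"
      by (auto simp: in_keys_iff lookup_trunc[OF bounded_elem_sym] elem_sym_def split: if_splits)
    have "m = ind (keys m)"
    proof (rule poly_mapping_eqI)
      fix i
      show "lookup m i = lookup (ind (keys m)) i"
        using m(2)[of i] by (simp add: lookup_ind in_keys_iff)
    qed
    then show "m \<in> ind ` ?S" using m by blast
  next
    fix m assume "m \<in> ind ` ?S"
    then obtain S where "S \<in> ?S" "m = ind S" by blast
    then show "m \<in> keys (trunc N (elem_sym k))"
      using fin[of S] by (simp add: in_keys_iff lookup_trunc[OF bounded_elem_sym] elem_sym_def keys_ind lookup_ind)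
  qed
  have inj: "inj_on ind ?S" by (rule inj_onI) (metis fin keys_ind)
  have one: "lookup (trunc N (elem_sym k)) (ind S) = 1" if "S \<in> ?S" for S
    using that fin[OF that] by (simp add: lookup_trunc[OF bounded_elem_sym] elem_sym_def keys_ind lookup_ind)
  have "JM_eval N (elem_sym k) = (\<Sum>S\<in>?S. frag_cmul (lookup (trunc N (elem_sym k)) (ind S)) (jmon N (ind S)))"
    unfolding JM_eval_def frag_extend_def keys using inj by (simp add: sum.reindex)
  also have "\<dots> = JM_elem N k" unfolding JM_elem_def by (rule sum.cong) (simp_all add: one)
  finally show ?thesis .
qed

section \<open>Monomial symmetric functions\<close>

definition msym :: "nat multiset \<Rightarrow> series" where "msym \<mu> a = (if mon_type a = \<mu> then 1 else 0)"

lemma mon_type_map_key: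
  assumes "bij \<pi>"
  shows "mon_type (map_key \<pi> a) = mon_type a"
proof -
  let ?b = "map_key \<pi> a"
  have inj: "inj_on \<pi> (keys ?b)" using assms by (meson bij_is_inj inj_on_subset subset_UNIV)
  have "keys ?b = \<pi> -` keys a" by (rule keys_map_key[OF bij_is_inj[OF assms]])
  then have "\<pi> ` keys ?b = keys a"
    using assms by (simp add: bij_is_surj surj_image_vimage_eq)
  then have "mset_set (keys a) = image_mset \<pi> (mset_set (keys ?b))"
    using image_mset_mset_set[OF inj] by simp
  moreover have "lookup ?b = (\<lambda>i. lookup a (\<pi> i))"
    by (rule ext) (rule lookup_map_key[OF assms])
  ultimately show ?thesis by (simp add: mon_type_def multiset.map_comp comp_def)
qed

lemma monomial_degree_mon_type: "mon_type a = mon_type b \<Longrightarrow> monomial_degree a = monomial_degree b"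
  by (metis sum_mset_mon_type)

lemma card_keys_mon_type: "mon_type a = mon_type b \<Longrightarrow> card (keys a) = card (keys b)"
  by (metis size_mon_type)

lemma bounded_msym: "bounded_degree (msym \<mu>) (sum_mset \<mu>)"
  by (auto simp: bounded_degree_def msym_def split: if_splits)

lemma symmetric_msym: "symmetric_function (msym \<mu>)"
  unfolding symmetric_function_def
proof
  show "\<exists>d. \<forall>m. msym \<mu> m \<noteq> 0 \<longrightarrow> monomial_degree m \<le> d"
    using bounded_msym unfolding bounded_degree_def by blast
qed (simp add: msym_def mon_type_map_key)

lemma same_mon_type:
  assumes "mon_type a = mon_type b"
  shows "\<exists>\<pi>. bij \<pi> \<and> map_key \<pi> b = a"
proof -
  obtain h where h: "bij_betw h (keys a) (keys b)"
      "\<And>x. x \<in> keys a \<Longrightarrow> lookup b (h x) = lookup a x"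
    using image_mset_eq_imp_bij_betw[OF finite_keys finite_keys assms[unfolded mon_type_def]] by blast
  obtain \<pi> where \<pi>: "\<pi> permutes (keys a \<union> keys b)"
      "\<And>x. x \<in> keys a \<Longrightarrow> \<pi> x = h x"
    using bij_betw_extends_to_permutes[OF finite_keys finite_keys h(1)] by blast
  have bij: "bij \<pi>" using \<pi>(1) by (rule permutes_bij)
  have "map_key \<pi> b = a"
  proof (rule poly_mapping_eqI)
    fix i
    show "lookup (map_key \<pi> b) i = lookup a i"
    proof (cases "i \<in> keys a")
      case True
      then show ?thesis using h(2) \<pi>(2) by (simp add: lookup_map_key[OF bij])
    next
      case False
      have "\<pi> i \<notin> keys b"
      proof
        assume "\<pi> i \<in> keys b"
        then have "\<pi> i \<in> h ` keys a" using h(1) by (simp add: bij_betw_def)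
        then obtain x where x: "x \<in> keys a" "\<pi> i = h x" by blast
        then have "\<pi> i = \<pi> x" using \<pi>(2) by simp
        then have "i = x" using bij by (meson bij_is_inj injD)
        then show False using x False by simp
      qed
      then show ?thesis using False
        by (simp add: lookup_map_key[OF bij] not_in_keys_iff_lookup_eq_zero)
    qed
  qed
  then show ?thesis using bij by blast
qed

lemma symmetric_eq: "symmetric_function f \<Longrightarrow> mon_type a = mon_type b \<Longrightarrow> f a = f b"
  using same_mon_type[of a b] by (auto simp: symmetric_function_def)

text \<open>Induction over symmetric functions: each is an integral combination of the monomial symmetric
  functions of the types that occur in it.\<close>

lemma symmetric_in_span:
  assumes f: "symmetric_function f"
    and zero: "(\<lambda>m. 0) \<in> G"
    and add: "\<And>f g. f \<in> G \<Longrightarrow> g \<in> G \<Longrightarrow> (\<lambda>m. f m + g m) \<in> G"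
    and neg: "\<And>f. f \<in> G \<Longrightarrow> (\<lambda>m. - f m) \<in> G"
    and gen: "\<And>a. f a \<noteq> 0 \<Longrightarrow> msym (mon_type a) \<in> G"
  shows "f \<in> G"
proof -
  have mult: "(\<lambda>m. k * g m) \<in> G" if "g \<in> G" for g and k :: int
  proof (induction k rule: int_induct[where k = 0])
    case base
    show ?case using zero by simp
  next
    case (step1 i)
    show ?case using add[OF step1(2) that] by (simp add: distrib_right)
  next
    case (step2 i)
    show ?case using add[OF step2(2) neg[OF that]] by (simp add: left_diff_distrib)
  qed
  have sum: "(\<lambda>m. \<Sum>x\<in>A. h x m) \<in> G" if "finite A" "\<And>x. x \<in> A \<Longrightarrow> h x \<in> G"
    for h and A :: "nat multiset set"
    using that by (induction A rule: finite_induct) (simp_all add: zero add)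
  let ?T = "mon_type ` {a. f a \<noteq> 0}"
  obtain d where d: "bounded_degree f d" using symmetric_bounded[OF f] by blast
  have fin: "finite ?T"
  proof (rule finite_subset[OF _ finite_partitions_wt[of "2 * d"]])
    have "card (keys a) \<le> monomial_degree a" for a
    proof -
      have "(\<Sum>i\<in>keys a. 1) \<le> monomial_degree a"
        unfolding monomial_degree_def by (rule sum_mono) (simp add: in_keys_iff Suc_le_eq)
      then show ?thesis by simp
    qed
    then have "wt (mon_type a) \<le> 2 * monomial_degree a" for a by (simp add: wt_def mult_2)
    then show "?T \<subseteq> {\<kappa> \<in> partitions. wt \<kappa> \<le> 2 * d}"
      using d unfolding bounded_degree_def by (fastforce intro: order_trans)
  qed
  define c where "c \<mu> = f (SOME a. mon_type a = \<mu>)" for \<mu>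
  have c: "c (mon_type a) = f a" for a
    unfolding c_def by (rule symmetric_eq[OF f]) (rule someI[of "\<lambda>b. mon_type b = mon_type a" a], simp)
  have "f = (\<lambda>m. \<Sum>\<mu>\<in>?T. c \<mu> * msym \<mu> m)"
  proof
    fix m
    have "(\<Sum>\<mu>\<in>?T. c \<mu> * msym \<mu> m) = (\<Sum>\<mu>\<in>?T. if \<mu> = mon_type m then f m else 0)"
      by (rule sum.cong) (auto simp: msym_def c)
    also have "\<dots> = (if mon_type m \<in> ?T then f m else 0)" using fin by simp
    also have "\<dots> = f m" by auto
    finally show "f m = (\<Sum>\<mu>\<in>?T. c \<mu> * msym \<mu> m)" by simp
  qed
  moreover have "(\<lambda>m. \<Sum>\<mu>\<in>?T. c \<mu> * msym \<mu> m) \<in> G"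
    by (rule sum[OF fin]) (use gen in \<open>auto intro: mult\<close>)
  ultimately show ?thesis by simp
qed

section \<open>Generation by the elementary symmetric functions\<close>

lemma elem_sym_msym: "elem_sym r = msym (replicate_mset r 1)"
proof
  fix m :: mono
  have "(\<forall>i. lookup m i \<le> 1) \<and> card (keys m) = r \<longleftrightarrow> mon_type m = replicate_mset r 1"
  proof
    assume m: "(\<forall>i. lookup m i \<le> 1) \<and> card (keys m) = r"
    then have "lookup m i = 1" if "i \<in> keys m" for i
      using that by (metis One_nat_def in_keys_iff le_Suc_eq le_zero_eq)
    then have "mon_type m = image_mset (\<lambda>_. 1) (mset_set (keys m))"
      unfolding mon_type_def by (intro image_mset_cong) simp
    then show "mon_type m = replicate_mset r 1" using m by (simp add: image_mset_const_eq)
  next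
    assume m: "mon_type m = replicate_mset r 1"
    have "lookup m i \<le> 1" for i
    proof (cases "i \<in> keys m")
      case True
      then have "lookup m i \<in># mon_type m" by (simp add: mon_type_def)
      then show ?thesis using m by (simp split: if_splits)
    qed (simp add: not_in_keys_iff_lookup_eq_zero)
    moreover have "card (keys m) = r" using m by (metis size_mon_type size_replicate_mset)
    ultimately show "(\<forall>i. lookup m i \<le> 1) \<and> card (keys m) = r" by blast
  qed
  then show "elem_sym r m = msym (replicate_mset r 1) m" unfolding elem_sym_def msym_def by presburger
qed

lemma symmetric_elem_sym: "symmetric_function (elem_sym r)"
  unfolding elem_sym_msym by (rule symmetric_msym)

inductive_set elem_gen :: "series set" where
  one: "(\<lambda>m. if m = 0 then 1 else 0) \<in> elem_gen"
| elem: "1 \<le> n \<Longrightarrow> elem_sym n \<in> elem_gen"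
| uminus: "f \<in> elem_gen \<Longrightarrow> (\<lambda>m. - f m) \<in> elem_gen"
| add: "f \<in> elem_gen \<Longrightarrow> g \<in> elem_gen \<Longrightarrow> (\<lambda>m. f m + g m) \<in> elem_gen"
| mult: "f \<in> elem_gen \<Longrightarrow> g \<in> elem_gen \<Longrightarrow> smul f g \<in> elem_gen"

lemma elem_gen_symmetric: "f \<in> elem_gen \<Longrightarrow> symmetric_function f"
  by (induction rule: elem_gen.induct)
    (auto intro: symmetric_one symmetric_elem_sym symmetric_uminus symmetric_add symmetric_smul)

text \<open>Divides a monomial by each of its variables once.  For a given number of variables this loses no
  information about the type (\<open>mon_type_lower_iff\<close>).\<close>

definition lower :: "mono \<Rightarrow> mono" where "lower a = a - ind (keys a)"

lemma lookup_lower: "lookup (lower a) i = lookup a i - 1"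
  by (simp add: lower_def lookup_minus lookup_ind not_in_keys_iff_lookup_eq_zero)

lemma lower_plus: "lower a + ind (keys a) = a"
  by (rule poly_mapping_eqI) (simp add: lookup_add lookup_lower lookup_ind in_keys_iff)

lemma monomial_degree_ind: "finite S \<Longrightarrow> monomial_degree (ind S) = card S"
  by (simp add: monomial_degree_def keys_ind lookup_ind)

lemma mon_type_lower:
  "mon_type a = image_mset Suc (mon_type (lower a) +
    replicate_mset (card (keys a) - card (keys (lower a))) 0)"
proof -
  let ?A = "keys a" and ?B = "keys (lower a)"
  have sub: "?B \<subseteq> ?A" by (auto simp: in_keys_iff lookup_lower)
  have "mset_set ?A = mset_set ?B + mset_set (?A - ?B)"
    using mset_set_Union[of ?B "?A - ?B"] sub by (simp add: Un_absorb1)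
  then have "mon_type a = image_mset (lookup a) (mset_set ?B) +
      image_mset (lookup a) (mset_set (?A - ?B))" by (simp add: mon_type_def)
  also have "image_mset (lookup a) (mset_set ?B) = image_mset (\<lambda>i. Suc (lookup (lower a) i)) (mset_set ?B)"
    by (rule image_mset_cong) (auto simp: in_keys_iff lookup_lower)
  also have "image_mset (lookup a) (mset_set (?A - ?B)) = image_mset (\<lambda>_. Suc 0) (mset_set (?A - ?B))"
    by (rule image_mset_cong) (auto simp: in_keys_iff lookup_lower)
  finally show ?thesis
    using sub by (simp add: mon_type_def multiset.map_comp comp_def image_mset_const_eq card_Diff_subset)
qed

lemma mon_type_lower_cong:
  assumes "mon_type a = mon_type b"
  shows "mon_type (lower a) = mon_type (lower b)"
proof -
  obtain \<pi> where \<pi>: "bij \<pi>" "map_key \<pi> b = a" using same_mon_type[OF assms] by blast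
  have "map_key \<pi> (lower b) = lower a"
    by (rule poly_mapping_eqI) (simp add: lookup_map_key[OF \<pi>(1)] lookup_lower flip: \<pi>(2))
  then show ?thesis using mon_type_map_key[OF \<pi>(1)] by metis
qed

lemma mon_type_lower_iff:
  assumes "card (keys a) = card (keys b)"
  shows "mon_type (lower b) = mon_type (lower a) \<longleftrightarrow> mon_type b = mon_type a"
proof
  assume eq: "mon_type (lower b) = mon_type (lower a)"
  then show "mon_type b = mon_type a"
    using mon_type_lower[of a] mon_type_lower[of b] card_keys_mon_type[OF eq] assms by metis
qed (rule mon_type_lower_cong)

text \<open>Let \<open>a\<close> have \<open>k\<close> variables.  A monomial \<open>b\<close> in the product of \<open>e\<^sub>k\<close> with the monomial symmetric function
  of type \<open>lower a\<close> has the degree of \<open>a\<close> and at least \<open>k\<close> variables.  If it has exactly \<open>k\<close>, then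
  its factor from \<open>e\<^sub>k\<close> is the product of all its variables and the other factor is \<open>lower b\<close>, so that
  \<open>b\<close> has the type of \<open>a\<close> and coefficient one.  Hence the product is the monomial symmetric function of
  type \<open>a\<close> plus ones of the same degree with more variables, and the induction is on the
  degree, then on the degree minus the number of variables.\<close>

lemma msym_in_elem_gen: "msym (mon_type a) \<in> elem_gen"
proof (induction a rule: wf_induct_rule[OF wf_measures[of "[monomial_degree, \<lambda>a. monomial_degree a - card (keys a)]"]])
  case (1 a)
  show ?case
  proof (cases "a = 0")
    case True
    have "mon_type m = mon_type 0 \<longleftrightarrow> m = 0" for m
    proof
      assume "mon_type m = mon_type 0"
      then have "card (keys m) = 0" using card_keys_mon_type[of m 0] by simp
      then show "m = 0" by simp
    qed simp
    then have "msym (mon_type a) = (\<lambda>m. if m = 0 then 1 else 0)" by (simp add: msym_def True fun_eq_iff)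
    then show ?thesis by (simp add: elem_gen.one)
  next
    case False
    define k where "k = card (keys a)"
    have k: "1 \<le> k" using False by (simp add: k_def Suc_le_eq card_gt_0_iff)
    have deg: "monomial_degree a = monomial_degree (lower a) + k"
    proof -
      have "monomial_degree a = monomial_degree (lower a + ind (keys a))" by (simp only: lower_plus)
      then show ?thesis by (simp add: monomial_degree_add monomial_degree_ind k_def)
    qed
    define g where "g = smul (msym (mon_type (lower a))) (elem_sym k)"
    have low: "msym (mon_type (lower a)) \<in> elem_gen" using deg k by (intro 1) simp
    then have g: "g \<in> elem_gen" unfolding g_def using k by (intro elem_gen.mult elem_gen.elem)
    have nz: "\<exists>p q. p + q = b \<and> mon_type p = mon_type (lower a) \<and>
        (\<forall>i. lookup q i \<le> 1) \<and> card (keys q) = k" if nzb: "g b \<noteq> 0" for b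
    proof -
      obtain p q where pq: "p + q = b" "msym (mon_type (lower a)) p \<noteq> 0" "elem_sym k q \<noteq> 0"
        using smul_nonzero[OF nzb[unfolded g_def]] by blast
      from pq(2) have "mon_type p = mon_type (lower a)" unfolding msym_def by meson
      moreover from pq(3) have "(\<forall>i. lookup q i \<le> 1) \<and> card (keys q) = k"
        unfolding elem_sym_def by meson
      ultimately show ?thesis using pq(1) by blast
    qed
    have gdeg: "monomial_degree b = monomial_degree a \<and> k \<le> card (keys b)" if nzb: "g b \<noteq> 0" for b
    proof -
      obtain p q where pq: "p + q = b" "mon_type p = mon_type (lower a)"
          "\<And>i. lookup q i \<le> 1" "card (keys q) = k" using nz[OF nzb] by blast
      have "elem_sym k q \<noteq> 0" using pq by (simp add: elem_sym_def)
      moreover have "q = ind (keys q)"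
      proof (rule poly_mapping_eqI)
        fix i
        show "lookup q i = lookup (ind (keys q)) i"
          using pq(3)[of i] by (simp add: lookup_ind in_keys_iff)
      qed
      then have "monomial_degree q = k" using monomial_degree_ind[OF finite_keys, of q] pq(4) by simp
      moreover have "monomial_degree p = monomial_degree (lower a)" using pq(2) by (rule monomial_degree_mon_type)
      moreover have "card (keys q) \<le> card (keys b)"
        by (rule card_mono) (use pq(1) in \<open>auto simp: keys_add_mono\<close>)
      ultimately show ?thesis using pq(1,4) deg by (auto simp: monomial_degree_add)
    qed
    have gtop: "g b = msym (mon_type a) b" if b: "card (keys b) = k" for b
    proof -
      have "smul (msym (mon_type (lower a))) (elem_sym k) b =
          (\<Sum>(p, q)\<in>{(lower b, ind (keys b))}. msym (mon_type (lower a)) p * elem_sym k q)"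
        unfolding smul_def
      proof (rule sum.mono_neutral_right[OF finite_pairs])
        show "{(lower b, ind (keys b))} \<subseteq> {(p, q). p + q = b}" by (simp add: lower_plus)
        show "\<forall>pq\<in>{(p, q). p + q = b} - {(lower b, ind (keys b))}.
            (case pq of (p, q) \<Rightarrow> msym (mon_type (lower a)) p * elem_sym k q) = 0"
        proof (rule ballI, rule ccontr)
          fix x assume x: "x \<in> {(p, q). p + q = b} - {(lower b, ind (keys b))}"
            and nz: "(case x of (p, q) \<Rightarrow> msym (mon_type (lower a)) p * elem_sym k q) \<noteq> 0"
          obtain p q where x': "x = (p, q)" by (rule prod.exhaust)
          have pq: "b = p + q" and ne: "(p, q) \<noteq> (lower b, ind (keys b))" using x x' by auto
          have "elem_sym k q \<noteq> 0" using nz x' by simp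
          then have q: "\<forall>i. lookup q i \<le> 1" "card (keys q) = k"
            unfolding elem_sym_def by meson+
          have "keys q = keys b"
            by (rule card_subset_eq) (use pq q b in \<open>auto simp: keys_add_mono\<close>)
          then have qi: "q = ind (keys b)"
            using q(1) by (intro poly_mapping_eqI) (metis One_nat_def finite_keys in_keys_iff le_Suc_eq le_zero_eq lookup_ind)
          then have "p = lower b" using lower_plus[of b] pq by (metis add_right_cancel)
          then have "(p, q) = (lower b, ind (keys b))" using qi by (rule arg_cong2[where f = Pair])
          then show False using ne by (rule notE[rotated])
        qed
      qed
      also have "\<dots> = msym (mon_type (lower a)) (lower b)"
        using b by (simp add: elem_sym_def lookup_ind keys_ind)
      also have "\<dots> = msym (mon_type a) b"
        using mon_type_lower_iff[of a b] b by (simp add: msym_def k_def)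
      finally show ?thesis by (simp add: g_def)
    qed
    define h where "h = (\<lambda>m. g m + - msym (mon_type a) m)"
    have "h \<in> elem_gen"
    proof (rule symmetric_in_span)
      show "symmetric_function h"
        unfolding h_def using elem_gen_symmetric[OF g] by (intro symmetric_add symmetric_uminus symmetric_msym)
      show "(\<lambda>m. 0) \<in> elem_gen" using elem_gen.add[OF elem_gen.one elem_gen.uminus[OF elem_gen.one]] by simp
    next
      fix b assume hb: "h b \<noteq> 0"
      have "monomial_degree b = monomial_degree a \<and> k \<le> card (keys b)"
      proof (cases "mon_type b = mon_type a")
        case True
        then show ?thesis using monomial_degree_mon_type[OF True] card_keys_mon_type[OF True] by (simp add: k_def)
      next
        case False
        then show ?thesis using hb gdeg by (simp add: h_def msym_def)
      qed
      moreover have "card (keys b) \<noteq> k" using hb gtop by (auto simp: h_def)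
      moreover have "card (keys b) \<le> monomial_degree b"
      proof -
        have "(\<Sum>i\<in>keys b. 1) \<le> monomial_degree b"
          unfolding monomial_degree_def by (rule sum_mono) (simp add: in_keys_iff Suc_le_eq)
        then show ?thesis by simp
      qed
      ultimately show "msym (mon_type b) \<in> elem_gen" by (intro 1) (auto simp: k_def)
    qed (auto intro: elem_gen.add elem_gen.uminus)
    then have "(\<lambda>m. g m + - h m) \<in> elem_gen" using g by (intro elem_gen.add elem_gen.uminus)
    then show ?thesis by (simp add: h_def)
  qed
qed

theorem symmetric_elem_gen: "symmetric_function f \<Longrightarrow> f \<in> elem_gen"
proof (erule symmetric_in_span)
  show "(\<lambda>m. 0) \<in> elem_gen" using elem_gen.add[OF elem_gen.one elem_gen.uminus[OF elem_gen.one]] by simp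
qed (auto intro: elem_gen.add elem_gen.uminus msym_in_elem_gen)

section \<open>Leading terms\<close>

lemma perms_iff: "\<sigma> \<in> perms n \<longleftrightarrow> supp \<sigma> \<subseteq> {..<Suc n}"
proof -
  have "x \<noteq> 0" if "x \<in> supp \<sigma>" for x using that by (metis zero_notin_supp)
  then show ?thesis by (auto simp: perms_def subset_iff less_Suc_eq_le Suc_le_eq)
qed

lemma lookup_JM_eval_nonzero:
  assumes "bounded_degree f d" "lookup (JM_eval N f) \<sigma> \<noteq> 0"
  shows "\<exists>a. keys a \<subseteq> {..<N} \<and> f a \<noteq> 0 \<and> lookup (jmon N a) \<sigma> \<noteq> 0"
proof -
  obtain a where "a \<in> keys (trunc N f)"
      "lookup (trunc N f) a * lookup (jmon N a) \<sigma> \<noteq> 0"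
    using assms(2) unfolding lookup_JM_eval by (meson sum.not_neutral_contains_not_neutral)
  then show ?thesis using lookup_trunc[OF assms(1), of N a] by (auto split: if_splits)
qed

lemma JM_eval_rank:
  assumes "bounded_degree f d" "lookup (JM_eval N f) \<sigma> \<noteq> 0"
  shows "sum_mset (rtype \<sigma>) \<le> d"
proof -
  obtain a where a: "keys a \<subseteq> {..<N}" "f a \<noteq> 0" "lookup (jmon N a) \<sigma> \<noteq> 0"
    using lookup_JM_eval_nonzero[OF assms] by blast
  then have "sum_mset (rtype \<sigma>) \<le> monomial_degree a" using jmon_supp[OF a(1,3)] by simp
  also have "\<dots> \<le> d" using assms(1) a(2) by (simp add: bounded_degree_def)
  finally show ?thesis .
qed

lemma JM_eval_msym_wt:
  assumes "lookup (JM_eval N (msym \<mu>)) \<sigma> \<noteq> 0"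
  shows "wt (rtype \<sigma>) \<le> wt \<mu>"
proof -
  obtain a where a: "keys a \<subseteq> {..<N}" "msym \<mu> a \<noteq> 0" "lookup (jmon N a) \<sigma> \<noteq> 0"
    using lookup_JM_eval_nonzero[OF bounded_msym assms] by blast
  then have "card (supp \<sigma>) \<le> mwt a" using jmon_supp[OF a(1,3)] by simp
  moreover have "mon_type a = \<mu>" using a(2) by (simp add: msym_def split: if_splits)
  ultimately show ?thesis by (simp add: card_supp flip: wt_mon_type)
qed

lemma expo_keys_subset: "supp \<sigma> \<subseteq> {..<N} \<Longrightarrow> keys (expo \<sigma>) \<subseteq> {..<N}"
  by (auto simp: keys_expo)

lemma JM_eval_msym_top:
  assumes "supp \<sigma> \<subseteq> {..<N}" "wt (rtype \<sigma>) = wt \<mu>"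
  shows "lookup (JM_eval N (msym \<mu>)) \<sigma> = (if rtype \<sigma> = \<mu> then 1 else 0)"
proof -
  let ?K = "keys (trunc N (msym \<mu>))"
  have K: "a \<in> ?K \<longleftrightarrow> keys a \<subseteq> {..<N} \<and> mon_type a = \<mu>" for a
    by (simp add: in_keys_iff lookup_trunc[OF bounded_msym] msym_def)
  have "lookup (JM_eval N (msym \<mu>)) \<sigma> = (\<Sum>a\<in>?K. if a = expo \<sigma> then 1 else 0)"
    unfolding lookup_JM_eval
  proof (rule sum.cong[OF refl])
    fix a assume "a \<in> ?K"
    then have a: "keys a \<subseteq> {..<N}" "mon_type a = \<mu>" unfolding K by auto
    then have "card (supp \<sigma>) = mwt a" using assms(2) by (simp add: card_supp flip: wt_mon_type)
    then have "lookup (jmon N a) \<sigma> = (if expo \<sigma> = a then 1 else 0)" by (rule jmon_top[OF a(1)])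
    moreover have "lookup (trunc N (msym \<mu>)) a = 1"
      using a by (simp add: lookup_trunc[OF bounded_msym] msym_def)
    ultimately show "lookup (trunc N (msym \<mu>)) a * lookup (jmon N a) \<sigma> =
        (if a = expo \<sigma> then 1 else 0)" by auto
  qed
  also have "\<dots> = (if expo \<sigma> \<in> ?K then 1 else 0)" by simp
  also have "expo \<sigma> \<in> ?K \<longleftrightarrow> rtype \<sigma> = \<mu>"
    unfolding K rtype_def using expo_keys_subset[OF assms(1)] by simp
  finally show ?thesis .
qed

section \<open>From symmetric functions to the Farahat-Higman algebra\<close>

lemma csum_JM_elem: "ev n (\<Sum>\<mu>\<in>partitions_of k. FH_basis \<mu>) = JM_eval (Suc n) (elem_sym k)"
proof (rule poly_mapping_eqI)
  fix \<sigma>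
  have fin: "finite (partitions_of k)"
  proof (rule finite_subset[OF _ finite_partitions_wt[of "2 * k"]], rule subsetI)
    fix \<mu> assume "\<mu> \<in> partitions_of k"
    then have m: "\<mu> \<in> partitions" "sum_mset \<mu> = k" by (auto simp: partitions_of_def)
    have "size \<mu> \<le> sum_mset \<mu>" using m(1)
    proof (induction \<mu>)
      case (add x \<mu>)
      then show ?case by (cases x) (auto simp: partitions_def)
    qed simp
    then show "\<mu> \<in> {\<kappa> \<in> partitions. wt \<kappa> \<le> 2 * k}" using m by (simp add: wt_def)
  qed
  have ev: "ev n (\<Sum>\<mu>\<in>partitions_of k. FH_basis \<mu>) = (\<Sum>\<mu>\<in>partitions_of k. csum n \<mu>)"
    by (subst ev_sum) (auto simp: partitions_of_def FH_carrier_basis ev_basis)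
  have "lookup (ev n (\<Sum>\<mu>\<in>partitions_of k. FH_basis \<mu>)) \<sigma> =
      (\<Sum>\<mu>\<in>partitions_of k. if \<mu> = rtype \<sigma> then (if \<sigma> \<in> perms n then 1 else 0) else 0)"
    unfolding ev lookup_sum by (intro sum.cong refl) (auto simp: lookup_csum)
  also have "\<dots> = (if rtype \<sigma> \<in> partitions_of k then (if \<sigma> \<in> perms n then 1 else 0) else 0)"
    using fin by simp
  also have "\<dots> = lookup (JM_eval (Suc n) (elem_sym k)) \<sigma>"
    unfolding JM_eval_elem_sym lookup_JM_elem perms_iff by (simp add: partitions_of_def)
  finally show "lookup (ev n (\<Sum>\<mu>\<in>partitions_of k. FH_basis \<mu>)) \<sigma> =
      lookup (JM_eval (Suc n) (elem_sym k)) \<sigma>" .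
qed

text \<open>The symmetric functions with this property form a subring, which contains all \<open>e\<^sub>k\<close>.\<close>

lemma JM_eval_in_FH: "symmetric_function f \<Longrightarrow> \<exists>c\<in>FH_carrier. \<forall>n. ev n c = JM_eval (Suc n) f"
proof (drule symmetric_elem_gen, induction rule: elem_gen.induct)
  case one
  show ?case by (rule bexI[of _ "FH_basis {#}"]) (simp_all add: ev_one JM_eval_one FH_carrier_basis)
next
  case (elem k)
  show ?case
  proof (rule bexI[of _ "\<Sum>\<mu>\<in>partitions_of k. FH_basis \<mu>"])
    show "(\<Sum>\<mu>\<in>partitions_of k. FH_basis \<mu>) \<in> FH_carrier"
      by (auto simp: partitions_of_def intro!: FH_carrier_sum FH_carrier_basis)
  qed (simp add: csum_JM_elem)
next
  case (uminus f)
  then obtain c where c: "c \<in> FH_carrier" "\<forall>n. ev n c = JM_eval (Suc n) f" by blast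
  have "ev n (- c) = - ev n c" for n
    using ev_add[OF c(1) FH_carrier_uminus[OF c(1)], of n] by (simp add: eq_neg_iff_add_eq_0 add.commute)
  then show ?case using c uminus elem_gen_symmetric
    by (intro bexI[of _ "- c"]) (auto simp: JM_eval_uminus FH_carrier_uminus)
next
  case (add f g)
  then obtain c d where "c \<in> FH_carrier" "\<forall>n. ev n c = JM_eval (Suc n) f"
    "d \<in> FH_carrier" "\<forall>n. ev n d = JM_eval (Suc n) g" by blast
  then show ?case using add elem_gen_symmetric
    by (intro bexI[of _ "c + d"]) (auto simp: ev_add JM_eval_add FH_carrier_add)
next
  case (mult f g)
  then obtain c d where "c \<in> FH_carrier" "\<forall>n. ev n c = JM_eval (Suc n) f"
    "d \<in> FH_carrier" "\<forall>n. ev n d = JM_eval (Suc n) g" by blast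
  then show ?case using mult elem_gen_symmetric
    by (intro bexI[of _ "c \<otimes>\<^bsub>FH\<^esub> d"]) (auto simp: ev_mult JM_eval_mult FH_carrier_mult)
qed

definition psi :: "series \<Rightarrow> (nat multiset \<Rightarrow>\<^sub>0 rat poly)"
  where "psi f = (SOME c. c \<in> FH_carrier \<and> (\<forall>n. ev n c = JM_eval (Suc n) f))"

lemma psi: assumes "symmetric_function f"
  shows psi_FH: "psi f \<in> FH_carrier" and ev_psi: "ev n (psi f) = JM_eval (Suc n) f"
proof -
  have "\<exists>c. c \<in> FH_carrier \<and> (\<forall>n. ev n c = JM_eval (Suc n) f)" using JM_eval_in_FH[OF assms] by blast
  from someI_ex[OF this] have "psi f \<in> FH_carrier \<and> (\<forall>n. ev n (psi f) = JM_eval (Suc n) f)"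
    unfolding psi_def .
  then show "psi f \<in> FH_carrier" "ev n (psi f) = JM_eval (Suc n) f" by simp_all
qed

lemma psi_eqI:
  assumes "symmetric_function f" "c \<in> FH_carrier" "\<And>n. ev n c = JM_eval (Suc n) f"
  shows "psi f = c"
  by (rule ev_inject[OF psi_FH[OF assms(1)] assms(2)]) (simp only: ev_psi[OF assms(1)] assms(3))

text \<open>The permutations of type \<open>\<kappa>\<close> give the values of the coefficient at all large \<open>n\<close>, and a polynomial
  that is constant there is constant.\<close>

lemma coeff_eqI:
  assumes c: "c \<in> FH_carrier" and "\<kappa> \<in> partitions"
    and eq: "\<And>n \<sigma>. \<sigma> \<in> perms n \<Longrightarrow> rtype \<sigma> = \<kappa> \<Longrightarrow> lookup (ev n c) \<sigma> = k"
  shows "lookup c \<kappa> = of_int k"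
proof -
  obtain \<sigma> where \<sigma>: "rtype \<sigma> = \<kappa>" using ex_rtype assms(2) by blast
  obtain m where m: "supp \<sigma> \<subseteq> {1..m}" using supp_bounded by blast
  show ?thesis
  proof (rule int_valued_eqI[OF lookup_FH[OF c] int_valued_of_int])
    fix n assume "m \<le> n"
    then have s: "\<sigma> \<in> perms n" using m by (auto simp: perms_def)
    show "\<lfloor>poly (lookup c \<kappa>) (of_nat n)\<rfloor> = \<lfloor>poly (of_int k) (of_nat n)\<rfloor>"
      using eq[OF s \<sigma>] s by (simp add: lookup_ev \<sigma>)
  qed
qed

text \<open>A monomial of degree \<open>d\<close> in the Jucys-Murphy elements is a sum of products of \<open>d\<close> transpositions,
  each of which raises the rank by at most one.\<close>

lemma psi_degree:
  assumes "symmetric_function f" "bounded_degree f d"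
  shows "psi f \<in> FH_le d"
  unfolding FH_le_iff
proof (intro conjI allI impI psi_FH[OF assms(1)])
  fix \<kappa> assume k: "d < sum_mset \<kappa>"
  show "lookup (psi f) \<kappa> = 0"
  proof (cases "\<kappa> \<in> partitions")
    case True
    have "lookup (psi f) \<kappa> = of_int 0"
    proof (rule coeff_eqI[OF psi_FH[OF assms(1)] True])
      fix n \<sigma> assume "\<sigma> \<in> perms n" "rtype \<sigma> = \<kappa>"
      then show "lookup (ev n (psi f)) \<sigma> = 0"
        using JM_eval_rank[OF assms(2), of "Suc n" \<sigma>] k unfolding ev_psi[OF assms(1)] by force
    qed
    then show ?thesis by simp
  qed (use psi_FH[OF assms(1)] in \<open>simp add: FH_carrier_iff\<close>)
qed

text \<open>The leading terms of the monomials of type \<open>\<mu>\<close> are the permutations of type \<open>\<mu>\<close>, each occurring once;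
  all other terms move fewer points.\<close>

lemma psi_msym:
  assumes "\<kappa> \<in> partitions" "wt \<mu> \<le> wt \<kappa>"
  shows "lookup (psi (msym \<mu>)) \<kappa> = (if \<kappa> = \<mu> then 1 else 0)"
proof -
  have "lookup (psi (msym \<mu>)) \<kappa> = of_int (if \<kappa> = \<mu> then 1 else 0)"
  proof (rule coeff_eqI[OF psi_FH[OF symmetric_msym] assms(1)])
    fix n \<sigma> assume \<sigma>: "\<sigma> \<in> perms n" "rtype \<sigma> = \<kappa>"
    show "lookup (ev n (psi (msym \<mu>))) \<sigma> = (if \<kappa> = \<mu> then 1 else 0)"
    proof (cases "wt \<kappa> = wt \<mu>")
      case True
      then show ?thesis unfolding ev_psi[OF symmetric_msym]
        using JM_eval_msym_top[of \<sigma> "Suc n" \<mu>] \<sigma> by (simp add: perms_iff)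
    next
      case False
      then show ?thesis unfolding ev_psi[OF symmetric_msym]
        using JM_eval_msym_wt[of "Suc n" \<mu> \<sigma>] \<sigma> assms(2) by force
    qed
  qed
  then show ?thesis by simp
qed

section \<open>Monoid rings\<close>

lemma frag_cmul_diff_right: "frag_cmul k (a - b) = frag_cmul k a - frag_cmul k b"
  by (rule poly_mapping_eqI) (simp add: lookup_minus right_diff_distrib)

lemma frag_extend_diff_fun: "frag_extend (\<lambda>x. f x - g x) c = frag_extend f c - frag_extend g c"
  by (simp add: frag_extend_def frag_cmul_diff_right sum_subtractf)

lemma frag_extend_add_fun: "frag_extend (\<lambda>x. f x + g x) c = frag_extend f c + frag_extend g c"
  by (simp add: frag_extend_def frag_cmul_distrib2 sum.distrib)

lemma monoid_ring_sel:
  "carrier (monoid_ring G) = {c. keys c \<subseteq> carrier G}"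
  "\<one>\<^bsub>monoid_ring G\<^esub> = frag_of \<one>\<^bsub>G\<^esub>" "\<zero>\<^bsub>monoid_ring G\<^esub> = 0" "c \<oplus>\<^bsub>monoid_ring G\<^esub> d = c + d"
  by (simp_all add: monoid_ring_def)

lemma monoid_ring_mult_of [simp]:
  "frag_of x \<otimes>\<^bsub>monoid_ring G\<^esub> frag_of y = frag_of (x \<otimes>\<^bsub>G\<^esub> y)"
  by (simp add: monoid_ring_def)

lemma monoid_ring_mult_diff:
  "(a - b) \<otimes>\<^bsub>monoid_ring G\<^esub> c = a \<otimes>\<^bsub>monoid_ring G\<^esub> c - b \<otimes>\<^bsub>monoid_ring G\<^esub> c"
  "c \<otimes>\<^bsub>monoid_ring G\<^esub> (a - b) = c \<otimes>\<^bsub>monoid_ring G\<^esub> a - c \<otimes>\<^bsub>monoid_ring G\<^esub> b"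
  by (simp_all add: monoid_ring_def frag_extend_diff frag_extend_diff_fun)

lemma monoid_ring_mult_add:
  "(a + b) \<otimes>\<^bsub>monoid_ring G\<^esub> c = a \<otimes>\<^bsub>monoid_ring G\<^esub> c + b \<otimes>\<^bsub>monoid_ring G\<^esub> c"
  "c \<otimes>\<^bsub>monoid_ring G\<^esub> (a + b) = c \<otimes>\<^bsub>monoid_ring G\<^esub> a + c \<otimes>\<^bsub>monoid_ring G\<^esub> b"
  by (simp_all add: monoid_ring_def frag_extend_add frag_extend_add_fun)

lemma monoid_ring_mult_0 [simp]:
  "0 \<otimes>\<^bsub>monoid_ring G\<^esub> c = 0" "c \<otimes>\<^bsub>monoid_ring G\<^esub> 0 = 0"
  by (simp_all add: monoid_ring_def frag_extend_def)

lemma keys_diff_subset: "keys a \<subseteq> S \<Longrightarrow> keys b \<subseteq> S \<Longrightarrow> keys (a - b :: _ \<Rightarrow>\<^sub>0 int) \<subseteq> S"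
  by (meson keys_diff le_sup_iff order_trans)

lemma keys_add_subset: "keys a \<subseteq> S \<Longrightarrow> keys b \<subseteq> S \<Longrightarrow> keys (a + b :: _ \<Rightarrow>\<^sub>0 int) \<subseteq> S"
  by (meson keys_add le_sup_iff order_trans)

lemma monoid_ring_closed:
  assumes "monoid G" "keys c \<subseteq> carrier G" "keys d \<subseteq> carrier G"
  shows "keys (c \<otimes>\<^bsub>monoid_ring G\<^esub> d) \<subseteq> carrier G"
  using assms(2)
proof (induction c rule: frag_induction)
  case (one x)
  show ?case
    using assms(3)
  proof (induction d rule: frag_induction)
    case (one y)
    then show ?case using \<open>x \<in> carrier G\<close> monoid.m_closed[OF assms(1)] by simp
  qed (simp_all add: monoid_ring_mult_diff keys_diff_subset)
qed (simp_all add: monoid_ring_mult_diff keys_diff_subset)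

lemma monoid_ring_assoc:
  assumes G: "monoid G" and "keys a \<subseteq> carrier G"
    and b: "keys b \<subseteq> carrier G" and c: "keys c \<subseteq> carrier G"
  shows "a \<otimes>\<^bsub>monoid_ring G\<^esub> b \<otimes>\<^bsub>monoid_ring G\<^esub> c = a \<otimes>\<^bsub>monoid_ring G\<^esub> (b \<otimes>\<^bsub>monoid_ring G\<^esub> c)"
  using assms(2)
proof (induction a rule: frag_induction)
  case (one x)
  note x = one
  show ?case
    using b
  proof (induction b rule: frag_induction)
    case (one y)
    note y = one
    show ?case
      using c
    proof (induction c rule: frag_induction)
      case (one z)
      then show ?case using monoid.m_assoc[OF G x y] by simp
    qed (simp_all add: monoid_ring_mult_diff)
  qed (simp_all add: monoid_ring_mult_diff)
qed (simp_all add: monoid_ring_mult_diff)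

lemma ring_monoid_ring:
  assumes G: "monoid G"
  shows "ring (monoid_ring G)"
proof (rule ringI)
  show "abelian_group (monoid_ring G)"
  proof (rule abelian_groupI)
    fix x assume "x \<in> carrier (monoid_ring G)"
    then show "\<exists>y\<in>carrier (monoid_ring G). y \<oplus>\<^bsub>monoid_ring G\<^esub> x = \<zero>\<^bsub>monoid_ring G\<^esub>"
      by (intro bexI[of _ "- x"]) (simp_all add: monoid_ring_sel)
  qed (auto simp: monoid_ring_sel add_ac dest: subsetD[OF keys_add])
  show "monoid (monoid_ring G)"
  proof (rule monoidI)
    fix x assume x: "x \<in> carrier (monoid_ring G)"
    then have "keys x \<subseteq> carrier G" by (simp add: monoid_ring_sel)
    then show "\<one>\<^bsub>monoid_ring G\<^esub> \<otimes>\<^bsub>monoid_ring G\<^esub> x = x" unfolding monoid_ring_sel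
      by (induction x rule: frag_induction)
        (simp_all add: monoid_ring_mult_diff monoid.l_one[OF G])
    from \<open>keys x \<subseteq> carrier G\<close>
    show "x \<otimes>\<^bsub>monoid_ring G\<^esub> \<one>\<^bsub>monoid_ring G\<^esub> = x" unfolding monoid_ring_sel
      by (induction x rule: frag_induction)
        (simp_all add: monoid_ring_mult_diff monoid.r_one[OF G])
  qed (simp_all add: monoid_ring_sel monoid_ring_closed[OF G] monoid_ring_assoc[OF G] monoid.one_closed[OF G])
qed (simp_all add: monoid_ring_mult_add monoid_ring_sel)

section \<open>Tensor products of rings\<close>

locale tensor_rings = A: ring A + B: ring B for A :: "'a ring" and B :: "'b ring"
begin

abbreviation "M \<equiv> monoid_ring (A \<times>\<times> B)"
abbreviation "I \<equiv> tensor_ideal A B"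
abbreviation "T \<equiv> tensor_ring A B"

lemma ring_M: "ring M"
  by (intro ring_monoid_ring DirProd_monoid A.monoid_axioms B.monoid_axioms)

lemma carrier_M: "c \<in> carrier M \<longleftrightarrow> keys c \<subseteq> carrier A \<times> carrier B"
  by (simp add: monoid_ring_sel)

lemma relations_carrier: "tensor_relations A B \<subseteq> carrier M"
proof -
  have "frag_of x - frag_of y - frag_of z \<in> carrier M"
    if "x \<in> carrier A \<times> carrier B" "y \<in> carrier A \<times> carrier B" "z \<in> carrier A \<times> carrier B" for x y z
    unfolding carrier_M using that by (intro keys_diff_subset) simp_all
  then show ?thesis unfolding tensor_relations_def by auto
qed

lemma ideal_I: "ideal I M"
  unfolding tensor_ideal_def by (rule ring.genideal_ideal[OF ring_M relations_carrier])

lemma relations_I: "tensor_relations A B \<subseteq> I"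
  unfolding tensor_ideal_def by (rule ring.genideal_self[OF ring_M relations_carrier])

interpretation I: ideal I M by (rule ideal_I)

lemma ring_T: "ring T" unfolding tensor_ring_def by (rule I.quotient_is_ring)

interpretation T: ring T by (rule ring_T)

definition coset :: "('a \<times> 'b \<Rightarrow>\<^sub>0 int) \<Rightarrow> ('a \<times> 'b \<Rightarrow>\<^sub>0 int) set" where "coset c = I +>\<^bsub>M\<^esub> c"

lemma coset_alt: "coset c = (\<lambda>i. i + c) ` I"
  by (auto simp: coset_def a_r_coset_def' monoid_ring_sel)

lemma carrier_T: "carrier T = coset ` carrier M"
  by (auto simp: tensor_ring_def FactRing_def A_RCOSETS_def' coset_def)

lemma pure_coset: "pure_tensor A B a b = coset (frag_of (a, b))"
  by (simp add: pure_tensor_def coset_def)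

lemma coset_hom: "coset \<in> ring_hom M T"
  using I.rcos_ring_hom by (simp add: tensor_ring_def coset_def[abs_def])

lemma coset_mult: "c \<in> carrier M \<Longrightarrow> d \<in> carrier M \<Longrightarrow> coset (c \<otimes>\<^bsub>M\<^esub> d) = coset c \<otimes>\<^bsub>T\<^esub> coset d"
  by (rule ring_hom_mult[OF coset_hom])

lemma coset_add: "c \<in> carrier M \<Longrightarrow> d \<in> carrier M \<Longrightarrow> coset (c + d) = coset c \<oplus>\<^bsub>T\<^esub> coset d"
  using ring_hom_add[OF coset_hom] by (simp add: monoid_ring_sel)

lemma coset_one: "coset (frag_of (\<one>\<^bsub>A\<^esub>, \<one>\<^bsub>B\<^esub>)) = \<one>\<^bsub>T\<^esub>"
  using ring_hom_one[OF coset_hom] by (simp add: monoid_ring_sel)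

lemma additive_I: "additive_subgroup I M" by (rule I.additive_subgroup_axioms)

lemma I_0: "0 \<in> I" using additive_subgroup.zero_closed[OF additive_I] by (simp add: monoid_ring_sel)

lemma I_add: "c \<in> I \<Longrightarrow> d \<in> I \<Longrightarrow> c + d \<in> I" using additive_subgroup.a_closed[OF additive_I, of c d] by (simp add: monoid_ring_sel)

lemma I_uminus: "c \<in> I \<Longrightarrow> - c \<in> I"
proof -
  assume c: "c \<in> I"
  then have cM: "c \<in> carrier M" by (rule I.a_Hcarr)
  have "\<ominus>\<^bsub>M\<^esub> c = - c"
    using cM by (intro I.minus_equality) (simp_all add: monoid_ring_sel)
  then show ?thesis using additive_subgroup.a_inv_closed[OF additive_I c] by simp
qed

lemma I_diff: "c \<in> I \<Longrightarrow> d \<in> I \<Longrightarrow> c - d \<in> I"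
  using I_add[OF _ I_uminus, of c d] by simp

lemma coset_eqI: "c - d \<in> I \<Longrightarrow> coset c = coset d"
proof -
  assume cd: "c - d \<in> I"
  have "coset c \<subseteq> coset d" if "c - d \<in> I" for c d
  proof
    fix x assume "x \<in> coset c"
    then obtain i where "i \<in> I" "x = i + c" by (auto simp: coset_alt)
    then show "x \<in> coset d" unfolding coset_alt
      by (intro image_eqI[of _ _ "i + (c - d)"]) (simp_all add: I_add that)
  qed
  moreover have "d - c \<in> I" using I_uminus[OF cd] by simp
  ultimately show ?thesis using cd by blast
qed

lemma coset_zero: "coset 0 = \<zero>\<^bsub>T\<^esub>"
  by (simp add: coset_alt tensor_ring_def FactRing_def)

lemma relation_left:
  assumes "a \<in> carrier A" "a' \<in> carrier A" "b \<in> carrier B"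
  shows "frag_of (a \<oplus>\<^bsub>A\<^esub> a', b) - (frag_of (a, b) + frag_of (a', b)) \<in> I"
  unfolding diff_diff_eq[symmetric]
  by (rule subsetD[OF relations_I], unfold tensor_relations_def, intro UnI1 CollectI exI conjI, rule refl)
    (rule assms)+

lemma relation_right:
  assumes "a \<in> carrier A" "b \<in> carrier B" "b' \<in> carrier B"
  shows "frag_of (a, b \<oplus>\<^bsub>B\<^esub> b') - (frag_of (a, b) + frag_of (a, b')) \<in> I"
  unfolding diff_diff_eq[symmetric]
  by (rule subsetD[OF relations_I], unfold tensor_relations_def, intro UnI2 CollectI exI conjI, rule refl)
    (rule assms)+

lemma relation_left_0: "b \<in> carrier B \<Longrightarrow> frag_of (\<zero>\<^bsub>A\<^esub>, b) \<in> I"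
  using I_uminus[OF relation_left[of "\<zero>\<^bsub>A\<^esub>" "\<zero>\<^bsub>A\<^esub>" b]] by simp

lemma relation_right_0: "a \<in> carrier A \<Longrightarrow> frag_of (a, \<zero>\<^bsub>B\<^esub>) \<in> I"
  using I_uminus[OF relation_right[of a "\<zero>\<^bsub>B\<^esub>" "\<zero>\<^bsub>B\<^esub>"]] by simp

lemma pure_closed: "a \<in> carrier A \<Longrightarrow> b \<in> carrier B \<Longrightarrow> pure_tensor A B a b \<in> carrier T"
  unfolding pure_coset carrier_T by (intro imageI) (simp add: carrier_M)

lemma pure_mult:
  assumes "a \<in> carrier A" "a' \<in> carrier A" "b \<in> carrier B" "b' \<in> carrier B"
  shows "pure_tensor A B a b \<otimes>\<^bsub>T\<^esub> pure_tensor A B a' b' = pure_tensor A B (a \<otimes>\<^bsub>A\<^esub> a') (b \<otimes>\<^bsub>B\<^esub> b')"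
  unfolding pure_coset using assms by (subst coset_mult[symmetric]) (simp_all add: carrier_M)

lemma pure_add_right:
  assumes "a \<in> carrier A" "b \<in> carrier B" "b' \<in> carrier B"
  shows "pure_tensor A B a (b \<oplus>\<^bsub>B\<^esub> b') = pure_tensor A B a b \<oplus>\<^bsub>T\<^esub> pure_tensor A B a b'"
  unfolding pure_coset using assms
  by (subst coset_add[symmetric]) (simp_all add: carrier_M coset_eqI relation_right)

lemma pure_zero_right: "a \<in> carrier A \<Longrightarrow> pure_tensor A B a \<zero>\<^bsub>B\<^esub> = \<zero>\<^bsub>T\<^esub>"
  unfolding pure_coset coset_zero[symmetric] by (rule coset_eqI) (simp add: relation_right_0)

lemma pure_uminus_right:
  assumes "a \<in> carrier A" "b \<in> carrier B"
  shows "pure_tensor A B a (\<ominus>\<^bsub>B\<^esub> b) = \<ominus>\<^bsub>T\<^esub> pure_tensor A B a b"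
proof (rule T.minus_equality[symmetric])
  show "pure_tensor A B a (\<ominus>\<^bsub>B\<^esub> b) \<oplus>\<^bsub>T\<^esub> pure_tensor A B a b = \<zero>\<^bsub>T\<^esub>"
    using assms by (simp add: pure_add_right[symmetric] B.l_neg pure_zero_right)
qed (use assms in \<open>simp_all add: pure_closed\<close>)

text \<open>The universal property for ring homomorphisms: the kernel of \<open>h\<close> is an ideal, so it contains the ideal
  generated by the relations.  The second conclusion serves to compare \<open>h\<close> on congruent
  elements.\<close>

lemma factor_hom:
  assumes S: "ring S" and h: "h \<in> ring_hom M S"
    and rel: "\<And>x. x \<in> tensor_relations A B \<Longrightarrow> h x = \<zero>\<^bsub>S\<^esub>"
  shows "\<exists>g \<in> ring_hom T S. \<forall>c\<in>carrier M. g (coset c) = h c"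
    and "\<And>x. x \<in> I \<Longrightarrow> h x = \<zero>\<^bsub>S\<^esub>"
proof -
  interpret h: ring_hom_ring M S h by (rule ring_hom_ringI2[OF ring_M S h])
  have "tensor_relations A B \<subseteq> a_kernel M S h"
  proof
    fix x assume "x \<in> tensor_relations A B"
    then have "x \<in> carrier M" "h x = \<zero>\<^bsub>S\<^esub>" using relations_carrier rel by (blast, blast)
    then show "x \<in> a_kernel M S h" unfolding a_kernel_def' by simp
  qed
  then have "I \<subseteq> a_kernel M S h"
    unfolding tensor_ideal_def by (rule ring.genideal_minimal[OF ring_M h.kernel_is_ideal])
  then have sub: "I \<subseteq> {x \<in> carrier M. h x = \<zero>\<^bsub>S\<^esub>}" unfolding a_kernel_def' .
  have "h x = \<zero>\<^bsub>S\<^esub>" if "x \<in> I" for x using subsetD[OF sub that] by simp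
  then show hI: "\<And>x. x \<in> I \<Longrightarrow> h x = \<zero>\<^bsub>S\<^esub>" .
  define g where "g X = the_elem (h ` X)" for X
  have g: "g (coset c) = h c" if c: "c \<in> carrier M" for c
  proof -
    have hc: "h c \<in> carrier S" using c by (rule h.hom_closed)
    have "h (i + c) = h c" if "i \<in> I" for i
    proof -
      have "h (i \<oplus>\<^bsub>M\<^esub> c) = h i \<oplus>\<^bsub>S\<^esub> h c" using I.a_Hcarr[OF that] c by (rule h.hom_add)
      then show ?thesis using hI[OF that] hc ring.ring_simprules(8)[OF S] by (simp add: monoid_ring_sel)
    qed
    then have "h ` coset c = {h c}" using I_0 by (auto simp: coset_alt image_iff)
    then show ?thesis by (simp add: g_def)
  qed
  have "g \<in> ring_hom T S"
  proof (rule ring_hom_memI)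
    fix X Y assume "X \<in> carrier T" "Y \<in> carrier T"
    then obtain c d where cd: "c \<in> carrier M" "d \<in> carrier M" "X = coset c" "Y = coset d"
      unfolding carrier_T by blast
    show "g (X \<otimes>\<^bsub>T\<^esub> Y) = g X \<otimes>\<^bsub>S\<^esub> g Y"
      using cd I.m_closed[OF cd(1,2)] by (simp add: g h.hom_mult flip: coset_mult)
    have "c + d \<in> carrier M" using I.a_closed[OF cd(1,2)] by (simp add: monoid_ring_sel)
    moreover have "h (c + d) = h c \<oplus>\<^bsub>S\<^esub> h d" using h.hom_add[OF cd(1,2)] by (simp add: monoid_ring_sel)
    ultimately show "g (X \<oplus>\<^bsub>T\<^esub> Y) = g X \<oplus>\<^bsub>S\<^esub> g Y"
      using cd by (simp add: g flip: coset_add)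
  next
    fix X assume "X \<in> carrier T"
    then obtain c where "c \<in> carrier M" "X = coset c" unfolding carrier_T by blast
    then show "g X \<in> carrier S" using g h.hom_closed by simp
  next
    have "frag_of (\<one>\<^bsub>A\<^esub>, \<one>\<^bsub>B\<^esub>) \<in> carrier M" by (simp add: carrier_M)
    then show "g \<one>\<^bsub>T\<^esub> = \<one>\<^bsub>S\<^esub>"
      using g h.hom_one by (simp add: monoid_ring_sel flip: coset_one)
  qed
  then show "\<exists>g \<in> ring_hom T S. \<forall>c\<in>carrier M. g (coset c) = h c" using g by blast
qed

end

section \<open>The isomorphism\<close>

lemma ring_int_valued_ring: "ring int_valued_ring"
proof (rule ringI)
  show "abelian_group int_valued_ring"
  proof (rule abelian_groupI)
    fix x assume "x \<in> carrier int_valued_ring"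
    then show "\<exists>y\<in>carrier int_valued_ring. y \<oplus>\<^bsub>int_valued_ring\<^esub> x = \<zero>\<^bsub>int_valued_ring\<^esub>"
      by (intro bexI[of _ "- x"]) (simp_all add: int_valued_ring_def int_valued_uminus)
  qed (auto simp: int_valued_ring_def int_valued_add)
  show "monoid int_valued_ring"
    by (rule monoidI) (auto simp: int_valued_ring_def int_valued_mult)
qed (auto simp: int_valued_ring_def algebra_simps)

interpretation RL: tensor_rings int_valued_ring sym_ring
  by (intro tensor_rings.intro ring_int_valued_ring ring_sym_ring)

lemma iv_sel: "carrier int_valued_ring = int_valued" "\<one>\<^bsub>int_valued_ring\<^esub> = 1" "\<zero>\<^bsub>int_valued_ring\<^esub> = 0"
  "p \<oplus>\<^bsub>int_valued_ring\<^esub> q = p + q" "p \<otimes>\<^bsub>int_valued_ring\<^esub> q = p * q"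
  by (simp_all add: int_valued_ring_def)

lemma a_inv_sym_ring: "symmetric_function f \<Longrightarrow> \<ominus>\<^bsub>sym_ring\<^esub> f = (\<lambda>m. - f m)"
  unfolding a_inv_def by (rule inv_sym_ring)

lemma a_inv_FH: "x \<in> FH_carrier \<Longrightarrow> \<ominus>\<^bsub>FH\<^esub> x = - x"
  unfolding a_inv_def by (rule inv_FH)

abbreviation pure :: "rat poly \<Rightarrow> series \<Rightarrow> (rat poly \<times> series \<Rightarrow>\<^sub>0 int) set"
  where "pure \<equiv> pure_tensor int_valued_ring sym_ring"

text \<open>The linear extension of \<open>(p, f) \<mapsto> p \<psi>(f)\<close> to the free abelian group on the pairs.\<close>

definition psi_lift :: "(rat poly \<times> series \<Rightarrow>\<^sub>0 int) \<Rightarrow> (nat multiset \<Rightarrow>\<^sub>0 rat poly)"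
  where "psi_lift c = (\<Sum>x\<in>keys c.
    FH_smult (of_int (lookup c x) * fst x) (psi (snd x)))"

text \<open>The specialisation of \<open>p \<psi>(f)\<close> at \<open>n\<close>.  In these terms \<open>psi_lift\<close> becomes an extension by linearity
  with values in a group ring, where multiplicativity can be checked on pairs.\<close>

definition pure_eval :: "nat \<Rightarrow> rat poly \<times> series \<Rightarrow> gring"
  where "pure_eval n x = of_int (val n (fst x)) * JM_eval (Suc n) (snd x)"

lemma carrier_RL_M:
  "c \<in> carrier RL.M \<longleftrightarrow> keys c \<subseteq> int_valued \<times> {f. symmetric_function f}"
  unfolding RL.carrier_M iv_sel sym_sel ..

lemma psi_lift_FH:
  assumes "c \<in> carrier RL.M"
  shows "psi_lift c \<in> FH_carrier"
  unfolding psi_lift_def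
proof (intro FH_carrier_sum FH_carrier_smult int_valued_mult int_valued_of_int psi_FH)
  fix x assume "x \<in> keys c"
  then have "x \<in> int_valued \<times> {f. symmetric_function f}" using assms unfolding carrier_RL_M by blast
  then show "fst x \<in> int_valued" "symmetric_function (snd x)" by auto
qed

lemma ev_psi_lift:
  assumes "c \<in> carrier RL.M"
  shows "ev n (psi_lift c) = frag_extend (pure_eval n) c"
proof -
  have x: "fst x \<in> int_valued \<and> symmetric_function (snd x)" if "x \<in> keys c" for x
    using subsetD[OF assms[unfolded carrier_RL_M] that] by (simp add: mem_Times_iff)
  have "ev n (psi_lift c) = (\<Sum>x\<in>keys c.
      ev n (FH_smult (of_int (lookup c x) * fst x) (psi (snd x))))"
    unfolding psi_lift_def using x
    by (intro ev_sum FH_carrier_smult int_valued_mult int_valued_of_int psi_FH) auto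
  also have "\<dots> = (\<Sum>x\<in>keys c. frag_cmul (lookup c x) (pure_eval n x))"
  proof (rule sum.cong[OF refl])
    fix k assume "k \<in> keys c"
    note k = x[OF this]
    show "ev n (FH_smult (of_int (lookup c k) * fst k) (psi (snd k))) =
        frag_cmul (lookup c k) (pure_eval n k)"
      using k by (simp add: ev_smult int_valued_mult psi_FH val_mult ev_psi pure_eval_def
          frag_cmul_of_int mult.assoc)
  qed
  finally show ?thesis by (simp add: frag_extend_def)
qed

lemma pure_eval_mult:
  assumes "p \<in> int_valued" "q \<in> int_valued" "symmetric_function f" "symmetric_function g"
  shows "pure_eval n (p * q, smul f g) = pure_eval n (p, f) * pure_eval n (q, g)"
proof -
  have "pure_eval n (p * q, smul f g) =
      of_int (val n p) * ((of_int (val n q) * JM_eval (Suc n) f) * JM_eval (Suc n) g)"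
    using assms by (simp add: pure_eval_def val_mult JM_eval_mult mult.assoc)
  also have "\<dots> = pure_eval n (p, f) * pure_eval n (q, g)"
    unfolding of_int_commute[of "val n q" "JM_eval (Suc n) f"] by (simp add: pure_eval_def mult.assoc)
  finally show ?thesis .
qed

lemma frag_extend_pure_eval_mult:
  assumes "keys c \<subseteq> int_valued \<times> {f. symmetric_function f}"
    and d: "keys d \<subseteq> int_valued \<times> {f. symmetric_function f}"
  shows "frag_extend (pure_eval n) (c \<otimes>\<^bsub>RL.M\<^esub> d) = frag_extend (pure_eval n) c * frag_extend (pure_eval n) d"
  using assms(1)
proof (induction c rule: frag_induction)
  case (one x)
  note x = one
  show ?case
    using d
  proof (induction d rule: frag_induction)
    case (one y)
    obtain p f q g where xy: "x = (p, f)" "y = (q, g)" by (metis surj_pair)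
    then have "frag_of x \<otimes>\<^bsub>RL.M\<^esub> frag_of y = frag_of (p * q, smul f g)"
      by (simp add: iv_sel sym_sel)
    then show ?case using x one unfolding xy by (simp add: pure_eval_mult)
  qed (simp_all add: monoid_ring_mult_diff frag_extend_diff right_diff_distrib)
qed (simp_all add: monoid_ring_mult_diff frag_extend_diff left_diff_distrib)

lemma psi_lift_hom: "psi_lift \<in> ring_hom RL.M FH"
proof (rule ring_hom_memI)
  fix c d assume c: "c \<in> carrier RL.M" and d: "d \<in> carrier RL.M"
  have cd: "c \<otimes>\<^bsub>RL.M\<^esub> d \<in> carrier RL.M" using c d by (rule ring.ring_simprules(5)[OF RL.ring_M])
  show "psi_lift (c \<otimes>\<^bsub>RL.M\<^esub> d) = psi_lift c \<otimes>\<^bsub>FH\<^esub> psi_lift d"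
  proof (rule ev_inject[OF psi_lift_FH[OF cd] FH_carrier_mult[OF psi_lift_FH[OF c] psi_lift_FH[OF d]]])
    fix n
    show "ev n (psi_lift (c \<otimes>\<^bsub>RL.M\<^esub> d)) = ev n (psi_lift c \<otimes>\<^bsub>FH\<^esub> psi_lift d)"
      unfolding ev_mult[OF psi_lift_FH[OF c] psi_lift_FH[OF d]] ev_psi_lift[OF c] ev_psi_lift[OF d]
        ev_psi_lift[OF cd] by (rule frag_extend_pure_eval_mult) (use c d carrier_RL_M in auto)
  qed
  have cd: "c + d \<in> carrier RL.M" using ring.ring_simprules(1)[OF RL.ring_M c d] by (simp add: monoid_ring_sel)
  have "psi_lift (c + d) = psi_lift c + psi_lift d"
  proof (rule ev_inject[OF psi_lift_FH[OF cd] FH_carrier_add[OF psi_lift_FH[OF c] psi_lift_FH[OF d]]])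
    fix n
    show "ev n (psi_lift (c + d)) = ev n (psi_lift c + psi_lift d)"
      unfolding ev_add[OF psi_lift_FH[OF c] psi_lift_FH[OF d]] ev_psi_lift[OF c] ev_psi_lift[OF d]
        ev_psi_lift[OF cd] by (rule frag_extend_add)
  qed
  then show "psi_lift (c \<oplus>\<^bsub>RL.M\<^esub> d) = psi_lift c \<oplus>\<^bsub>FH\<^esub> psi_lift d"
    unfolding monoid_ring_sel FH_sel .
next
  fix c assume "c \<in> carrier RL.M"
  then show "psi_lift c \<in> carrier FH" unfolding FH_sel by (rule psi_lift_FH)
next
  have one: "\<one>\<^bsub>RL.M\<^esub> \<in> carrier RL.M" by (rule ring.ring_simprules(6)[OF RL.ring_M])
  show "psi_lift \<one>\<^bsub>RL.M\<^esub> = \<one>\<^bsub>FH\<^esub>" unfolding FH_sel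
  proof (rule ev_inject[OF psi_lift_FH[OF one] FH_carrier_basis[OF empty_partition]])
    fix n
    show "ev n (psi_lift \<one>\<^bsub>RL.M\<^esub>) = ev n (FH_basis {#})"
      unfolding ev_psi_lift[OF one] ev_one
      by (simp add: monoid_ring_sel iv_sel sym_sel pure_eval_def JM_eval_one)
  qed
qed

lemma psi_lift_pure: "psi_lift (frag_of (p, f)) = FH_smult p (psi f)"
  by (simp add: psi_lift_def)

lemma psi_lift_eq_0I:
  assumes "c \<in> carrier RL.M" "\<And>n. frag_extend (pure_eval n) c = 0"
  shows "psi_lift c = 0"
  by (rule ev_inject[OF psi_lift_FH[OF assms(1)] FH_carrier_0]) (simp add: ev_psi_lift[OF assms(1)] assms(2))

lemma psi_lift_relations:
  assumes "x \<in> tensor_relations int_valued_ring sym_ring"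
  shows "psi_lift x = \<zero>\<^bsub>FH\<^esub>"
  unfolding FH_sel
proof (rule psi_lift_eq_0I)
  show "x \<in> carrier RL.M" using assms RL.relations_carrier by blast
  fix n
  consider (left) p q f where "p \<in> int_valued" "q \<in> int_valued" "symmetric_function f"
      "x = frag_of (p + q, f) - frag_of (p, f) - frag_of (q, f)"
    | (right) p f g where "p \<in> int_valued" "symmetric_function f" "symmetric_function g"
      "x = frag_of (p, \<lambda>m. f m + g m) - frag_of (p, f) - frag_of (p, g)"
    using assms unfolding tensor_relations_def iv_sel sym_sel by blast
  then show "frag_extend (pure_eval n) x = 0"
  proof cases
    case left
    then show ?thesis by (simp add: frag_extend_diff pure_eval_def val_add distrib_right)
  next
    case right
    then show ?thesis by (simp add: frag_extend_diff pure_eval_def JM_eval_add distrib_left)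
  qed
qed

lemma psi_lift_I: "x \<in> RL.I \<Longrightarrow> psi_lift x = 0"
  using RL.factor_hom(2)[OF ring_FH psi_lift_hom psi_lift_relations] by (simp add: FH_sel)

text \<open>Represents the tensor \<open>\<Sum>\<^sub>\<mu> r\<^sub>\<mu> \<otimes> m\<^sub>\<mu>\<close>.  By \<open>is_msym_comb_all\<close> below every tensor has this form, so that
  injectivity of \<open>\<Psi>\<close> need only be checked on these.\<close>

definition msym_comb :: "(nat multiset \<Rightarrow>\<^sub>0 rat poly) \<Rightarrow> (rat poly \<times> series \<Rightarrow>\<^sub>0 int)"
  where "msym_comb r = (\<Sum>\<mu>\<in>keys r. frag_of (lookup r \<mu>, msym \<mu>))"

lemma I_sum: "(\<And>x. x \<in> A \<Longrightarrow> f x \<in> RL.I) \<Longrightarrow> sum f A \<in> RL.I"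
  by (induction A rule: infinite_finite_induct) (auto intro: RL.I_0 RL.I_add)

lemma I_trans: "a - b \<in> RL.I \<Longrightarrow> b - c \<in> RL.I \<Longrightarrow> a - c \<in> RL.I"
  using RL.I_add[of "a - b" "b - c"] by simp

lemma frag_of_0_I: "symmetric_function f \<Longrightarrow> frag_of (0, f) \<in> RL.I"
  using RL.relation_left_0[of f] by (simp add: iv_sel sym_sel)

lemma msym_comb_superset:
  assumes "finite S" "keys r \<subseteq> S"
  shows "(\<Sum>\<mu>\<in>S. frag_of (lookup r \<mu>, msym \<mu>)) - msym_comb r \<in> RL.I"
proof -
  have "(\<Sum>\<mu>\<in>S. frag_of (lookup r \<mu>, msym \<mu>)) - msym_comb r =
      (\<Sum>\<mu>\<in>S - keys r. frag_of (lookup r \<mu>, msym \<mu>))"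
    unfolding msym_comb_def sum.subset_diff[OF assms(2,1)] by simp
  also have "\<dots> \<in> RL.I"
    by (rule I_sum) (auto simp: not_in_keys_iff_lookup_eq_zero intro: frag_of_0_I symmetric_msym)
  finally show ?thesis .
qed

lemma msym_comb_add:
  assumes "r \<in> FH_carrier" "s \<in> FH_carrier"
  shows "msym_comb r + msym_comb s - msym_comb (r + s) \<in> RL.I"
proof -
  let ?S = "keys r \<union> keys s"
  let ?sum = "\<lambda>r. (\<Sum>\<mu>\<in>?S. frag_of (lookup r \<mu>, msym \<mu>))"
  have r: "?sum r - msym_comb r \<in> RL.I" and s: "?sum s - msym_comb s \<in> RL.I"
    and rs: "?sum (r + s) - msym_comb (r + s) \<in> RL.I"
    using keys_add[of r s] by (auto intro!: msym_comb_superset)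
  have "?sum (r + s) - (?sum r + ?sum s) = (\<Sum>\<mu>\<in>?S.
      frag_of (lookup r \<mu> + lookup s \<mu>, msym \<mu>) -
        (frag_of (lookup r \<mu>, msym \<mu>) + frag_of (lookup s \<mu>, msym \<mu>)))"
    by (simp add: lookup_add sum_subtractf sum.distrib)
  also have "\<dots> \<in> RL.I"
  proof (rule I_sum)
    fix \<mu>
    show "frag_of (lookup r \<mu> + lookup s \<mu>, msym \<mu>) -
        (frag_of (lookup r \<mu>, msym \<mu>) + frag_of (lookup s \<mu>, msym \<mu>)) \<in> RL.I"
      using RL.relation_left[of "lookup r \<mu>" "lookup s \<mu>" "msym \<mu>"]
      by (simp add: iv_sel sym_sel symmetric_msym lookup_FH assms)
  qed
  finally have D: "?sum (r + s) - (?sum r + ?sum s) \<in> RL.I" .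
  have "msym_comb r + msym_comb s - msym_comb (r + s) =
      (?sum (r + s) - msym_comb (r + s)) - (?sum (r + s) - (?sum r + ?sum s))
      - (?sum r - msym_comb r) - (?sum s - msym_comb s)"
    by (simp add: algebra_simps)
  also have "\<dots> \<in> RL.I" by (intro RL.I_diff rs D r s)
  finally show ?thesis .
qed

lemma msym_comb_0: "msym_comb 0 = 0" by (simp add: msym_comb_def)

lemma msym_comb_uminus:
  assumes "r \<in> FH_carrier"
  shows "- msym_comb r - msym_comb (- r) \<in> RL.I"
proof -
  have "- (msym_comb r + msym_comb (- r) - msym_comb (r + - r)) \<in> RL.I"
    by (intro RL.I_uminus msym_comb_add assms FH_carrier_uminus)
  then show ?thesis by (simp add: msym_comb_0)
qed

definition is_msym_comb :: "(rat poly \<times> series \<Rightarrow>\<^sub>0 int) \<Rightarrow> bool"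
  where "is_msym_comb c \<longleftrightarrow> (\<exists>r\<in>FH_carrier. c - msym_comb r \<in> RL.I)"

lemma is_msym_comb_I: "c \<in> RL.I \<Longrightarrow> is_msym_comb c"
  unfolding is_msym_comb_def by (intro bexI[of _ 0]) (simp_all add: msym_comb_0)

lemma is_msym_comb_cong: "is_msym_comb d \<Longrightarrow> c - d \<in> RL.I \<Longrightarrow> is_msym_comb c"
  unfolding is_msym_comb_def using I_trans by blast

lemma is_msym_comb_add: "is_msym_comb c \<Longrightarrow> is_msym_comb d \<Longrightarrow> is_msym_comb (c + d)"
proof -
  assume "is_msym_comb c" "is_msym_comb d"
  then obtain r s where rs: "r \<in> FH_carrier" "c - msym_comb r \<in> RL.I" "s \<in> FH_carrier" "d - msym_comb s \<in> RL.I"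
    unfolding is_msym_comb_def by blast
  have "c + d - msym_comb (r + s) =
      (c - msym_comb r) + (d - msym_comb s) + (msym_comb r + msym_comb s - msym_comb (r + s))"
    by (simp add: algebra_simps)
  also have "\<dots> \<in> RL.I" by (intro RL.I_add rs msym_comb_add)
  finally show ?thesis unfolding is_msym_comb_def using FH_carrier_add[OF rs(1,3)] by blast
qed

lemma is_msym_comb_uminus: "is_msym_comb c \<Longrightarrow> is_msym_comb (- c)"
proof -
  assume "is_msym_comb c"
  then obtain r where r: "r \<in> FH_carrier" "c - msym_comb r \<in> RL.I" unfolding is_msym_comb_def by blast
  have "- c - msym_comb (- r) = - (c - msym_comb r) + (- msym_comb r - msym_comb (- r))" by simp
  also have "\<dots> \<in> RL.I" by (intro RL.I_add RL.I_uminus r msym_comb_uminus)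
  finally show ?thesis unfolding is_msym_comb_def using FH_carrier_uminus[OF r(1)] by blast
qed

lemma is_msym_comb_pure:
  assumes p: "p \<in> int_valued" and f: "symmetric_function f"
  shows "is_msym_comb (frag_of (p, f))"
proof -
  let ?G = "{f. symmetric_function f \<and> is_msym_comb (frag_of (p, f))}"
  have rel: "frag_of (p, \<lambda>m. f m + g m) - (frag_of (p, f) + frag_of (p, g)) \<in> RL.I"
    if "symmetric_function f" "symmetric_function g" for f g
    using RL.relation_right[of p f g] that p by (simp add: iv_sel sym_sel)
  have zero: "frag_of (p, \<lambda>m. 0) \<in> RL.I"
    using RL.relation_right_0[of p] p by (simp add: iv_sel sym_sel)
  have "f \<in> ?G"
  proof (rule symmetric_in_span[OF f])
    show "(\<lambda>m. 0) \<in> ?G" using zero by (simp add: symmetric_zero is_msym_comb_I)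
  next
    fix f g assume "f \<in> ?G" "g \<in> ?G"
    then have fg: "symmetric_function f" "symmetric_function g"
      "is_msym_comb (frag_of (p, f) + frag_of (p, g))" by (auto intro: is_msym_comb_add)
    show "(\<lambda>m. f m + g m) \<in> ?G"
      using is_msym_comb_cong[OF fg(3) rel[OF fg(1,2)]] fg by (simp add: symmetric_add)
  next
    fix f assume f: "f \<in> ?G"
    then have fs: "symmetric_function f" and fc: "is_msym_comb (- frag_of (p, f))"
      by (auto intro: is_msym_comb_uminus)
    have "frag_of (p, \<lambda>m. - f m) - (- frag_of (p, f)) =
      frag_of (p, \<lambda>m. 0) - (frag_of (p, \<lambda>m. f m + - f m) - (frag_of (p, f) + frag_of (p, \<lambda>m. - f m)))"
      by simp
    also have "\<dots> \<in> RL.I" by (rule RL.I_diff[OF zero rel[OF fs symmetric_uminus[OF fs]]])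
    finally show "(\<lambda>m. - f m) \<in> ?G"
      using is_msym_comb_cong[OF fc] fs by (simp add: symmetric_uminus)
  next
    fix a
    have "is_msym_comb (frag_of (p, msym (mon_type a)))"
    proof (cases "p = 0")
      case True
      then show ?thesis by (auto intro: is_msym_comb_I frag_of_0_I symmetric_msym)
    next
      case False
      then have "msym_comb (single (mon_type a) p) = frag_of (p, msym (mon_type a))"
        by (simp add: msym_comb_def)
      moreover have "single (mon_type a) p \<in> FH_carrier"
        using p by (auto simp: FH_carrier_iff lookup_single when_def)
      ultimately show ?thesis unfolding is_msym_comb_def
        by (intro bexI[of _ "single (mon_type a) p"]) (simp_all add: RL.I_0)
    qed
    then show "msym (mon_type a) \<in> ?G" by (simp add: symmetric_msym)
  qed
  then show ?thesis by simp
qed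

lemma is_msym_comb_all: "c \<in> carrier RL.M \<Longrightarrow> is_msym_comb c"
  unfolding carrier_RL_M
proof (induction c rule: frag_induction)
  case zero
  show ?case by (intro is_msym_comb_I RL.I_0)
next
  case (one x)
  then show ?case by (cases x) (auto intro: is_msym_comb_pure)
next
  case (diff a b)
  then show ?case using is_msym_comb_add[OF _ is_msym_comb_uminus, of a b] by simp
qed

lemma msym_comb_carrier:
  assumes "r \<in> FH_carrier"
  shows "msym_comb r \<in> carrier RL.M"
proof -
  have sum: "sum f A \<in> carrier RL.M" if "\<And>x. x \<in> A \<Longrightarrow> f x \<in> carrier RL.M" for f and A :: "nat multiset set"
    using that
  proof (induction A rule: infinite_finite_induct)
    case (insert x A)
    then show ?case unfolding carrier_RL_M by (simp add: keys_add_subset)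
  qed (simp_all add: carrier_RL_M)
  show ?thesis unfolding msym_comb_def
    by (rule sum) (simp add: carrier_RL_M symmetric_msym lookup_FH assms)
qed

lemma psi_lift_msym_comb:
  assumes r: "r \<in> FH_carrier"
  shows "psi_lift (msym_comb r) =
    (\<Sum>\<mu>\<in>keys r. FH_smult (lookup r \<mu>) (psi (msym \<mu>)))"
proof (rule ev_inject[OF psi_lift_FH[OF msym_comb_carrier[OF r]]])
  show "(\<Sum>\<mu>\<in>keys r. FH_smult (lookup r \<mu>) (psi (msym \<mu>))) \<in> FH_carrier"
    by (intro FH_carrier_sum FH_carrier_smult lookup_FH r psi_FH symmetric_msym)
  fix n
  show "ev n (psi_lift (msym_comb r)) =
      ev n (\<Sum>\<mu>\<in>keys r. FH_smult (lookup r \<mu>) (psi (msym \<mu>)))"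
    unfolding ev_psi_lift[OF msym_comb_carrier[OF r]]
    by (subst ev_sum)
      (simp_all add: FH_carrier_smult lookup_FH r psi_FH symmetric_msym msym_comb_def frag_extend_sum
        pure_eval_def ev_smult ev_psi)
qed

text \<open>At a \<open>\<kappa>\<close> of maximal weight with \<open>r\<^sub>\<kappa> \<noteq> 0\<close>, the image has the coefficient \<open>r\<^sub>\<kappa>\<close>, by \<open>psi_msym\<close>.\<close>

lemma psi_lift_msym_comb_inj:
  assumes r: "r \<in> FH_carrier" and 0: "psi_lift (msym_comb r) = 0"
  shows "r = 0"
proof (rule ccontr)
  assume "r \<noteq> 0"
  then have ne: "keys r \<noteq> {}" by simp
  have "Max (wt ` keys r) \<in> wt ` keys r" using ne by (intro Max_in) auto
  then obtain \<kappa> where "\<kappa> \<in> keys r" "wt \<kappa> = Max (wt ` keys r)" by force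
  then have k: "\<kappa> \<in> keys r" "\<And>\<mu>. \<mu> \<in> keys r \<Longrightarrow> wt \<mu> \<le> wt \<kappa>" by simp_all
  have kp: "\<kappa> \<in> partitions" using k(1) r by (auto simp: FH_carrier_def)
  have "0 = lookup (psi_lift (msym_comb r)) \<kappa>" by (simp add: 0)
  also have "\<dots> = (\<Sum>\<mu>\<in>keys r. if \<mu> = \<kappa> then lookup r \<kappa> else 0)"
    unfolding psi_lift_msym_comb[OF r] lookup_sum
    by (rule sum.cong) (use k kp in \<open>auto simp: psi_msym\<close>)
  also have "\<dots> = lookup r \<kappa>" using k(1) by simp
  finally show False using k(1) by (simp add: in_keys_iff)
qed

text \<open>The map induced by \<open>psi_lift\<close> on the tensor product; it exists by \<open>factor_hom\<close>.\<close>

definition Psi :: "(rat poly \<times> series \<Rightarrow>\<^sub>0 int) set \<Rightarrow> (nat multiset \<Rightarrow>\<^sub>0 rat poly)"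
  where "Psi = (SOME g. g \<in> ring_hom RL.T FH \<and> (\<forall>c\<in>carrier RL.M. g (RL.coset c) = psi_lift c))"

lemma Psi_hom: "Psi \<in> ring_hom RL.T FH" and Psi_coset: "c \<in> carrier RL.M \<Longrightarrow> Psi (RL.coset c) = psi_lift c"
proof -
  have "\<exists>g. g \<in> ring_hom RL.T FH \<and> (\<forall>c\<in>carrier RL.M. g (RL.coset c) = psi_lift c)"
    using RL.factor_hom(1)[OF ring_FH psi_lift_hom psi_lift_relations] by blast
  from someI_ex[OF this] have *: "Psi \<in> ring_hom RL.T FH \<and> (\<forall>c\<in>carrier RL.M. Psi (RL.coset c) = psi_lift c)"
    unfolding Psi_def .
  then show "Psi \<in> ring_hom RL.T FH" by simp
  show "Psi (RL.coset c) = psi_lift c" if "c \<in> carrier RL.M" using * that by simp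
qed

interpretation T: ring RL.T by (rule RL.ring_T)

interpretation Psi: ring_hom_ring RL.T FH Psi
  by (rule ring_hom_ringI2[OF RL.ring_T ring_FH Psi_hom])

lemma Psi_pure:
  assumes "p \<in> int_valued" "symmetric_function f"
  shows "Psi (pure p f) = FH_smult p (psi f)"
  unfolding RL.pure_coset using assms by (subst Psi_coset) (simp_all add: carrier_RL_M psi_lift_pure)

lemma pure_closed: "p \<in> int_valued \<Longrightarrow> symmetric_function f \<Longrightarrow> pure p f \<in> carrier RL.T"
  using RL.pure_closed[of p f] by (simp add: iv_sel sym_sel)

lemma inj_Psi: "inj_on Psi (carrier RL.T)"
proof (rule inj_onI)
  fix X Y assume "X \<in> carrier RL.T" "Y \<in> carrier RL.T" and eq: "Psi X = Psi Y"
  then obtain c d where c: "c \<in> carrier RL.M" "X = RL.coset c" and d: "d \<in> carrier RL.M" "Y = RL.coset d"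
    unfolding RL.carrier_T by blast
  have cd: "c - d \<in> carrier RL.M" using c d unfolding carrier_RL_M by (intro keys_diff_subset)
  then obtain r where r: "r \<in> FH_carrier" "(c - d) - msym_comb r \<in> RL.I"
    using is_msym_comb_all unfolding is_msym_comb_def by blast
  have add: "psi_lift (a + b) = psi_lift a + psi_lift b" if "a \<in> carrier RL.M" "b \<in> carrier RL.M" for a b
    using ring_hom_add[OF psi_lift_hom that] by (simp add: monoid_ring_sel FH_sel)
  have "psi_lift d + psi_lift (c - d) = psi_lift d" using add[OF d(1) cd] eq c d by (simp add: Psi_coset)
  then have "psi_lift (c - d) = 0" by simp
  moreover have "psi_lift ((c - d) - msym_comb r) = 0" using r(2) by (rule psi_lift_I)
  moreover have "(c - d) - msym_comb r \<in> carrier RL.M"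
    using cd msym_comb_carrier[OF r(1)] unfolding carrier_RL_M by (rule keys_diff_subset)
  then have "psi_lift (c - d) = psi_lift ((c - d) - msym_comb r) + psi_lift (msym_comb r)"
    using add[OF _ msym_comb_carrier[OF r(1)], of "(c - d) - msym_comb r"] by simp
  ultimately have "psi_lift (msym_comb r) = 0" by simp
  then have "r = 0" by (rule psi_lift_msym_comb_inj[OF r(1)])
  then have "c - d \<in> RL.I" using r(2) by (simp add: msym_comb_0)
  then show "X = Y" unfolding c d by (rule RL.coset_eqI)
qed

lemma sym_le_bounded:
  assumes "f \<in> sym_le i"
  shows "symmetric_function f \<and> bounded_degree f i"
  using assms unfolding sym_le_def
proof (induction rule: generate.induct)
  case one
  show ?case by (simp add: sym_sel symmetric_zero bounded_degree_def)
next
  case (incl h)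
  then show ?case by (auto simp: sym_homogeneous_def sym_sel bounded_degree_def)
next
  case (inv h)
  then have h: "symmetric_function h" "bounded_degree h i"
    by (auto simp: sym_homogeneous_def sym_sel bounded_degree_def)
  then show ?case unfolding inv_sym_ring[OF h(1)] by (simp add: symmetric_uminus bounded_degree_def)
next
  case (eng f g)
  then have "bounded_degree (\<lambda>m. f m + g m) (max i i)" by (intro bounded_add) auto
  then show ?case using eng by (simp add: sym_sel symmetric_add)
qed

lemma msym_sym_le: "sum_mset \<mu> \<le> i \<Longrightarrow> msym \<mu> \<in> sym_le i"
  unfolding sym_le_def
proof (rule generate.incl)
  assume "sum_mset \<mu> \<le> i"
  moreover have "msym \<mu> \<in> sym_homogeneous (sum_mset \<mu>)"
    by (auto simp: sym_homogeneous_def sym_sel symmetric_msym msym_def split: if_splits)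
  ultimately show "msym \<mu> \<in> (\<Union>d\<le>i. sym_homogeneous d)" by blast
qed

abbreviation tensor_le :: "nat \<Rightarrow> (rat poly \<times> series \<Rightarrow>\<^sub>0 int) set set"
  where "tensor_le i \<equiv> tensor_sub int_valued_ring sym_ring (sym_le i)"

lemma tensor_le_gens:
  "{pure a b | a b. a \<in> carrier int_valued_ring \<and> b \<in> sym_le i} \<subseteq> carrier (add_monoid RL.T)"
  using sym_le_bounded pure_closed by (auto simp: iv_sel)

lemma tensor_le_subgroup: "subgroup (tensor_le i) (add_monoid RL.T)"
  unfolding tensor_sub_def by (rule group.generate_is_subgroup[OF T.a_group tensor_le_gens])

lemma tensor_le_carrier: "tensor_le i \<subseteq> carrier RL.T"
  using subgroup.subset[OF tensor_le_subgroup[of i]] by simp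

lemma Psi_tensor_le_subset: "X \<in> tensor_le i \<Longrightarrow> Psi X \<in> FH_le i"
proof -
  have pure: "Psi h \<in> FH_le i \<and> h \<in> carrier RL.T"
    if gen: "h \<in> {pure a b | a b. a \<in> carrier int_valued_ring \<and> b \<in> sym_le i}" for h
  proof -
    obtain a b where h: "h = pure a b" "a \<in> int_valued" "b \<in> sym_le i" using gen unfolding iv_sel by blast
    then have b: "symmetric_function b" "bounded_degree b i" using sym_le_bounded by auto
    then show ?thesis
      using psi_degree[OF b] h
      by (simp add: Psi_pure pure_closed FH_le_iff FH_carrier_smult)
  qed
  assume "X \<in> tensor_le i"
  then show "Psi X \<in> FH_le i" unfolding tensor_sub_def
  proof (induction rule: generate.induct)
    case one
    show ?case using Psi.hom_zero by (simp add: FH_sel FH_le_iff)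
  next
    case (incl h)
    then show ?case using pure by blast
  next
    case (inv h)
    have "Psi (inv\<^bsub>add_monoid RL.T\<^esub> h) = \<ominus>\<^bsub>FH\<^esub> Psi h"
      using Psi.hom_a_inv[of h] pure[OF inv] by (simp add: a_inv_def)
    also have "\<dots> = - Psi h" using pure[OF inv] by (intro a_inv_FH) (simp add: FH_le_iff)
    finally show ?case using pure[OF inv] by (simp add: FH_le_iff FH_carrier_uminus)
  next
    case (eng X Y)
    have "X \<in> carrier RL.T" "Y \<in> carrier RL.T"
      using eng(1,2) group.generate_in_carrier[OF T.a_group tensor_le_gens] by auto
    then have "Psi (X \<oplus>\<^bsub>RL.T\<^esub> Y) = Psi X + Psi Y" using Psi.hom_add by (simp add: FH_sel)
    then show ?case using eng(3,4) by (simp add: FH_le_iff FH_carrier_add lookup_add)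
  qed
qed

lemma image_add: "c \<in> Psi ` tensor_le i \<Longrightarrow> d \<in> Psi ` tensor_le i \<Longrightarrow> c + d \<in> Psi ` tensor_le i"
proof -
  assume "c \<in> Psi ` tensor_le i" "d \<in> Psi ` tensor_le i"
  then obtain X Y where XY: "X \<in> tensor_le i" "Y \<in> tensor_le i" "c = Psi X" "d = Psi Y" by blast
  have "X \<oplus>\<^bsub>RL.T\<^esub> Y \<in> tensor_le i" using subgroup.m_closed[OF tensor_le_subgroup XY(1,2)] by simp
  moreover have "Psi (X \<oplus>\<^bsub>RL.T\<^esub> Y) = c + d"
    using Psi.hom_add[of X Y] subsetD[OF tensor_le_carrier] XY by (simp add: FH_sel)
  ultimately show ?thesis by (metis imageI)
qed

lemma image_0: "0 \<in> Psi ` tensor_le i"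
proof -
  have "\<zero>\<^bsub>RL.T\<^esub> \<in> tensor_le i" using subgroup.one_closed[OF tensor_le_subgroup] by simp
  moreover have "Psi \<zero>\<^bsub>RL.T\<^esub> = 0" using Psi.hom_zero by (simp add: FH_sel)
  ultimately show ?thesis by (metis imageI)
qed

lemma image_sum: "(\<And>x. x \<in> A \<Longrightarrow> f x \<in> Psi ` tensor_le i) \<Longrightarrow> sum f A \<in> Psi ` tensor_le i"
  by (induction A rule: infinite_finite_induct) (auto intro: image_add image_0)

text \<open>Back substitution in the unitriangular system \<open>psi_msym\<close>, by induction on the weight.  The terms to be
  subtracted stay in the same step of the filtration by \<open>psi_degree\<close>.\<close>

lemma basis_in_image:
  assumes "\<kappa> \<in> partitions" "sum_mset \<kappa> \<le> i" "p \<in> int_valued"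
  shows "FH_smult p (FH_basis \<kappa>) \<in> Psi ` tensor_le i"
  using assms
proof (induction "wt \<kappa>" arbitrary: \<kappa> p rule: less_induct)
  case less
  let ?c = "psi (msym \<kappa>)"
  have cF: "?c \<in> FH_carrier" by (rule psi_FH[OF symmetric_msym])
  have deg: "?c \<in> FH_le (sum_mset \<kappa>)" by (rule psi_degree[OF symmetric_msym bounded_msym])
  have c1: "lookup ?c \<kappa> = 1" using psi_msym[OF less.prems(1), of \<kappa>] by simp
  have lower: "wt \<mu> < wt \<kappa>" if "\<mu> \<in> keys ?c - {\<kappa>}" for \<mu>
  proof (rule ccontr)
    assume "\<not> wt \<mu> < wt \<kappa>"
    moreover have "\<mu> \<in> partitions" using that cF by (auto simp: FH_carrier_def)
    ultimately have "lookup ?c \<mu> = 0" using psi_msym[of \<mu> \<kappa>] that by simp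
    then show False using that by (simp add: in_keys_iff)
  qed
  have "FH_smult p ?c \<in> Psi ` tensor_le i"
  proof -
    have "pure p (msym \<kappa>) \<in> tensor_le i"
      unfolding tensor_sub_def using less.prems msym_sym_le[OF less.prems(2)]
      by (intro generate.incl) (auto simp: iv_sel)
    moreover have "Psi (pure p (msym \<kappa>)) = FH_smult p ?c"
      by (rule Psi_pure[OF less.prems(3) symmetric_msym])
    ultimately show ?thesis by (metis imageI)
  qed
  moreover have "FH_smult (- (p * lookup ?c \<mu>)) (FH_basis \<mu>) \<in> Psi ` tensor_le i"
    if \<mu>: "\<mu> \<in> keys ?c - {\<kappa>}" for \<mu>
  proof (rule less.hyps[OF lower[OF \<mu>]])
    show "\<mu> \<in> partitions" using \<mu> cF by (auto simp: FH_carrier_def)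
    have "sum_mset \<mu> \<le> sum_mset \<kappa>" using \<mu> deg unfolding FH_le_def by blast
    then show "sum_mset \<mu> \<le> i" using less.prems(2) by simp
    show "- (p * lookup ?c \<mu>) \<in> int_valued"
      by (intro int_valued_uminus int_valued_mult less.prems lookup_FH cF)
  qed
  then have "(\<Sum>\<mu>\<in>keys ?c - {\<kappa>}. FH_smult (- (p * lookup ?c \<mu>)) (FH_basis \<mu>))
      \<in> Psi ` tensor_le i" by (rule image_sum)
  ultimately have "FH_smult p ?c +
      (\<Sum>\<mu>\<in>keys ?c - {\<kappa>}. FH_smult (- (p * lookup ?c \<mu>)) (FH_basis \<mu>))
      \<in> Psi ` tensor_le i" by (rule image_add)
  also have "FH_smult p ?c +
      (\<Sum>\<mu>\<in>keys ?c - {\<kappa>}. FH_smult (- (p * lookup ?c \<mu>)) (FH_basis \<mu>)) =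
      FH_smult p (FH_basis \<kappa>)"
  proof (rule poly_mapping_eqI)
    fix \<nu>
    have "(\<Sum>\<mu>\<in>keys ?c - {\<kappa>}. - (p * lookup ?c \<mu>) * (if \<mu> = \<nu> then 1 else 0)) =
        (if \<nu> \<in> keys ?c - {\<kappa>} then - (p * lookup ?c \<nu>) else 0)"
      by (simp add: if_distrib cong: if_cong)
    then show "lookup (FH_smult p ?c +
        (\<Sum>\<mu>\<in>keys ?c - {\<kappa>}. FH_smult (- (p * lookup ?c \<mu>)) (FH_basis \<mu>))) \<nu> =
        lookup (FH_smult p (FH_basis \<kappa>)) \<nu>"
      unfolding lookup_add lookup_sum lookup_FH_smult lookup_FH_basis
      using c1 by (auto simp: in_keys_iff)
  qed
  finally show ?case .
qed

lemma Psi_tensor_le: "Psi ` tensor_le i = FH_le i"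
proof
  show "Psi ` tensor_le i \<subseteq> FH_le i" using Psi_tensor_le_subset by blast
  show "FH_le i \<subseteq> Psi ` tensor_le i"
  proof
    fix c assume c: "c \<in> FH_le i"
    have "(\<Sum>\<kappa>\<in>keys c. FH_smult (lookup c \<kappa>) (FH_basis \<kappa>)) \<in> Psi ` tensor_le i"
      by (rule image_sum, rule basis_in_image) (use c in \<open>auto simp: FH_le_def FH_carrier_def\<close>)
    then show "c \<in> Psi ` tensor_le i" unfolding FH_expansion[symmetric] .
  qed
qed

lemma bij_Psi: "bij_betw Psi (carrier RL.T) FH_carrier"
  unfolding bij_betw_def
proof (intro conjI inj_Psi equalityI)
  show "Psi ` carrier RL.T \<subseteq> FH_carrier" using Psi.hom_closed by (auto simp: FH_sel)
  show "FH_carrier \<subseteq> Psi ` carrier RL.T"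
  proof
    fix c assume c: "c \<in> FH_carrier"
    define i where "i = Max (insert 0 (sum_mset ` keys c))"
    have "sum_mset \<kappa> \<le> i" if "\<kappa> \<in> keys c" for \<kappa>
      unfolding i_def using that by (intro Max_ge) auto
    then have "c \<in> FH_le i" using c by (simp add: FH_le_def)
    then show "c \<in> Psi ` carrier RL.T" using Psi_tensor_le[of i] tensor_le_carrier[of i] by blast
  qed
qed

abbreviation "TA \<equiv> tensor_algebra int_valued_ring sym_ring"

lemma tensor_algebra_sel:
  "carrier TA = carrier RL.T" "x \<otimes>\<^bsub>TA\<^esub> y = x \<otimes>\<^bsub>RL.T\<^esub> y" "\<one>\<^bsub>TA\<^esub> = \<one>\<^bsub>RL.T\<^esub>"
  "x \<oplus>\<^bsub>TA\<^esub> y = x \<oplus>\<^bsub>RL.T\<^esub> y" "p \<odot>\<^bsub>TA\<^esub> x = pure p \<one>\<^bsub>sym_ring\<^esub> \<otimes>\<^bsub>RL.T\<^esub> x"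
  by (simp_all add: tensor_algebra_def)

lemma ring_hom_TA: "ring_hom TA FH = ring_hom RL.T FH"
  by (simp add: ring_hom_def tensor_algebra_sel)

lemma psi_one: "psi (\<lambda>m. if m = 0 then 1 else 0) = FH_basis {#}"
  by (rule psi_eqI) (simp_all add: symmetric_one FH_carrier_basis ev_one JM_eval_one)

lemma Psi_alg_hom: "Psi \<in> alg_hom int_valued_ring TA FH"
  unfolding alg_hom_def ring_hom_TA mem_Collect_eq
proof (intro conjI ballI Psi_hom)
  fix p X assume p: "p \<in> carrier int_valued_ring" and X: "X \<in> carrier TA"
  have P: "Psi X \<in> FH_carrier" using X Psi.hom_closed by (simp add: tensor_algebra_sel FH_sel)
  have p': "p \<in> int_valued" using p by (simp add: iv_sel)
  have "Psi (p \<odot>\<^bsub>TA\<^esub> X) = Psi (pure p (\<lambda>m. if m = 0 then 1 else 0)) \<otimes>\<^bsub>FH\<^esub> Psi X"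
    unfolding tensor_algebra_sel sym_sel
    using X p' by (intro Psi.hom_mult pure_closed symmetric_one) (simp_all add: tensor_algebra_sel)
  also have "\<dots> = FH_smult p (FH_basis {#}) \<otimes>\<^bsub>FH\<^esub> Psi X"
    by (simp add: Psi_pure p' symmetric_one psi_one)
  also have "\<dots> = FH_smult p (Psi X)"
    using p' P by (intro ev_inject)
      (simp_all add: FH_carrier_mult FH_carrier_smult FH_carrier_basis ev_mult ev_smult ev_one)
  finally show "Psi (p \<odot>\<^bsub>TA\<^esub> X) = p \<odot>\<^bsub>FH\<^esub> Psi X" by (simp add: FH_sel)
qed

lemma Psi_elem: "Psi (pure 1 (elem_sym n)) = (\<Sum>\<mu>\<in>partitions_of n. FH_basis \<mu>)"
proof -
  have "psi (elem_sym n) = (\<Sum>\<mu>\<in>partitions_of n. FH_basis \<mu>)"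
  proof (rule psi_eqI[OF symmetric_elem_sym])
    show "(\<Sum>\<mu>\<in>partitions_of n. FH_basis \<mu>) \<in> FH_carrier"
      by (intro FH_carrier_sum FH_carrier_basis) (simp add: partitions_of_def)
  qed (rule csum_JM_elem)
  moreover have "FH_smult 1 c = c" for c by (rule poly_mapping_eqI) simp
  ultimately show ?thesis by (simp add: Psi_pure symmetric_elem_sym)
qed

text \<open>The symmetric functions \<open>f\<close> such that the two maps agree on \<open>1 \<otimes> f\<close> form a subring, and the pure
  tensors generate the tensor product additively.\<close>

lemma alg_hom_unique:
  assumes \<Phi>: "\<Phi> \<in> alg_hom int_valued_ring TA FH" and \<Theta>: "\<Theta> \<in> alg_hom int_valued_ring TA FH"
    and eq: "\<And>n. 1 \<le> n \<Longrightarrow> \<Phi> (pure 1 (elem_sym n)) = \<Theta> (pure 1 (elem_sym n))"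
    and X: "X \<in> carrier TA"
  shows "\<Phi> X = \<Theta> X"
proof -
  have hom: "\<Phi> \<in> ring_hom RL.T FH" "\<Theta> \<in> ring_hom RL.T FH"
    using \<Phi> \<Theta> by (auto simp: alg_hom_def ring_hom_TA)
  interpret \<Phi>: ring_hom_ring RL.T FH \<Phi> by (rule ring_hom_ringI2[OF RL.ring_T ring_FH hom(1)])
  interpret \<Theta>: ring_hom_ring RL.T FH \<Theta> by (rule ring_hom_ringI2[OF RL.ring_T ring_FH hom(2)])
  have one: "\<Phi> (pure 1 f) = \<Theta> (pure 1 f)" if "f \<in> elem_gen" for f
    using that
  proof (induction rule: elem_gen.induct)
    case one
    have "pure 1 (\<lambda>m. if m = 0 then 1 else 0) = \<one>\<^bsub>RL.T\<^esub>"
      using RL.coset_one unfolding RL.pure_coset iv_sel sym_sel .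
    then show ?case by simp
  next
    case (elem n)
    then show ?case by (rule eq)
  next
    case (uminus f)
    have f: "symmetric_function f" using uminus.hyps by (rule elem_gen_symmetric)
    have "pure 1 (\<lambda>m. - f m) = \<ominus>\<^bsub>RL.T\<^esub> pure 1 f"
      using RL.pure_uminus_right[of 1 f] f by (simp add: iv_sel sym_sel a_inv_sym_ring)
    then show ?case using uminus.IH pure_closed[OF int_valued_1 f] \<Phi>.hom_a_inv \<Theta>.hom_a_inv by simp
  next
    case (add f g)
    have f: "symmetric_function f" "symmetric_function g" using add.hyps elem_gen_symmetric by auto
    have "pure 1 (\<lambda>m. f m + g m) = pure 1 f \<oplus>\<^bsub>RL.T\<^esub> pure 1 g"
      using RL.pure_add_right[of 1 f g] f by (simp add: iv_sel sym_sel)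
    then show ?case using add.IH pure_closed[OF int_valued_1 f(1)] pure_closed[OF int_valued_1 f(2)]
      by (simp add: \<Phi>.hom_add \<Theta>.hom_add)
  next
    case (mult f g)
    have f: "symmetric_function f" "symmetric_function g" using mult.hyps elem_gen_symmetric by auto
    have "pure 1 (smul f g) = pure 1 f \<otimes>\<^bsub>RL.T\<^esub> pure 1 g"
      using RL.pure_mult[of 1 1 f g] f by (simp add: iv_sel sym_sel)
    then show ?case using mult.IH pure_closed[OF int_valued_1 f(1)] pure_closed[OF int_valued_1 f(2)]
      by (simp add: \<Phi>.hom_mult \<Theta>.hom_mult)
  qed
  have pure: "\<Phi> (pure p f) = \<Theta> (pure p f)" if p: "p \<in> int_valued" and f: "symmetric_function f" for p f
  proof -
    have "pure p f = p \<odot>\<^bsub>TA\<^esub> pure 1 f"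
      using RL.pure_mult[of p 1 "\<one>\<^bsub>sym_ring\<^esub>" f] monoid.l_one[OF ring.is_monoid[OF ring_sym_ring], of f]
        monoid.one_closed[OF ring.is_monoid[OF ring_sym_ring]] p f
      by (simp add: tensor_algebra_sel iv_sel) (simp add: sym_sel)
    moreover have "p \<in> carrier int_valued_ring" "pure 1 f \<in> carrier TA"
      using p pure_closed[OF int_valued_1 f] by (simp_all add: iv_sel tensor_algebra_sel)
    ultimately show ?thesis
      using \<Phi> \<Theta> one[OF symmetric_elem_gen[OF f]] by (simp add: alg_hom_def)
  qed
  obtain c where c: "keys c \<subseteq> int_valued \<times> {f. symmetric_function f}" "X = RL.coset c"
    using X unfolding tensor_algebra_sel RL.carrier_T carrier_RL_M[symmetric] by blast
  have "\<Phi> (RL.coset c) = \<Theta> (RL.coset c) \<and> c \<in> carrier RL.M" using c(1)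
  proof (induction c rule: frag_induction)
    case zero
    show ?case unfolding RL.coset_zero by (simp add: carrier_RL_M)
  next
    case (one x)
    then obtain p f where x: "x = (p, f)" "p \<in> int_valued" "symmetric_function f" by blast
    then show ?case using pure[OF x(2,3)] by (simp add: RL.pure_coset carrier_RL_M)
  next
    case (diff a b)
    have ab: "a - b \<in> carrier RL.M" using diff.IH unfolding carrier_RL_M by (intro keys_diff_subset) auto
    have T: "RL.coset (a - b) \<in> carrier RL.T" "RL.coset b \<in> carrier RL.T"
      using ab diff.IH unfolding RL.carrier_T by blast+
    have a: "RL.coset a = RL.coset (a - b) \<oplus>\<^bsub>RL.T\<^esub> RL.coset b"
      using RL.coset_add[OF ab, of b] diff.IH by simp
    have "\<Phi> (RL.coset (a - b)) + \<Phi> (RL.coset b) = \<Theta> (RL.coset (a - b)) + \<Theta> (RL.coset b)"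
      using diff.IH \<Phi>.hom_add[OF T] \<Theta>.hom_add[OF T] unfolding a by (simp add: FH_sel)
    then show ?case using diff.IH ab by simp
  qed
  then show ?thesis by (simp add: c(2))
qed

theorem theorem3p8:
  shows "\<exists>\<Psi> \<in> filtered_alg_iso int_valued_ring
            (tensor_algebra int_valued_ring sym_ring)
            (\<lambda>i. tensor_sub int_valued_ring sym_ring (sym_le i))
            FH FH_filtration.
          (\<forall>n\<ge>1. \<Psi> (pure_tensor int_valued_ring sym_ring 1 (elem_sym n)) =
             (\<Sum>\<mu>\<in>partitions_of n. FH_basis \<mu>)) \<and>
          (\<forall>\<Phi> \<in> alg_hom int_valued_ring (tensor_algebra int_valued_ring sym_ring) FH.
             (\<forall>n\<ge>1. \<Phi> (pure_tensor int_valued_ring sym_ring 1 (elem_sym n)) =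
                (\<Sum>\<mu>\<in>partitions_of n. FH_basis \<mu>)) \<longrightarrow>
             (\<forall>x \<in> carrier (tensor_algebra int_valued_ring sym_ring). \<Phi> x = \<Psi> x))"
proof (intro bexI[of _ Psi] conjI allI ballI impI)
  show "Psi \<in> filtered_alg_iso int_valued_ring TA tensor_le FH FH_filtration"
    using Psi_alg_hom bij_Psi Psi_tensor_le
    by (simp add: filtered_alg_iso_def tensor_algebra_sel FH_sel FH_filtration_eq)
  show "Psi (pure 1 (elem_sym n)) = (\<Sum>\<mu>\<in>partitions_of n. FH_basis \<mu>)" for n by (rule Psi_elem)
  fix \<Phi> X assume \<Phi>: "\<Phi> \<in> alg_hom int_valued_ring TA FH" and X: "X \<in> carrier TA"
    and elem: "\<forall>n\<ge>1. \<Phi> (pure 1 (elem_sym n)) = (\<Sum>\<mu>\<in>partitions_of n. FH_basis \<mu>)"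
  have "\<Phi> (pure 1 (elem_sym n)) = Psi (pure 1 (elem_sym n))" if "1 \<le> n" for n
    unfolding Psi_elem by (rule elem[rule_format, OF that])
  then show "\<Phi> X = Psi X" by (rule alg_hom_unique[OF \<Phi> Psi_alg_hom _ X])
qed

end
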